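(* Let $\lambda \in \mathbb{C}$ and let $Y\neq\{0\}$ be a Möbius invariant subspace of $X_{\lambda}(\mathbb{D}^2)$ (the case $Y=X_\lambda(\mathbb{D}^2)$ being allowed). Then one and only one of the following four alternatives holds. - ($E_0$) $Y=X_{\lambda}(\mathbb{D}^2) \cap \mathcal{H}(\Omega)$ and $\dim Y<\infty$. - ($E_+$) $X_{\lambda}(\mathbb{D}^2) \cap \mathcal{H}(\Omega_+)$ is dense in $Y$. - ($E_-$) $X_{\lambda}(\mathbb{D}^2) \cap \mathcal{H}(\Omega_-)$ is dense in $Y$. - (NE) $X_{\lambda}(\mathbb{D}^2) \cap \mathcal{H}(\Omega_* )$ is dense in $Y$. In this case $Y=X_{\lambda}(\mathbb{D}^2)$. In addition: (i) ($E_0$), ($E_+$) and ($E_-$) cannot occur if $\lambda\neq 4m(m+1)$ for every non-negative integer $m$. (ii) ($E_0$) holds if and only if $\dim Y<\infty$. In this case, $\dim Y=2m+1$ and $\lambda=4m(m+1)$ for some non-negative integer $m$. (iii) None of the density statements (NE), ($E_+$) and ($E_-$) may be improved to equalities.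
   Context: $\widehat{\mathbb{C}}=\mathbb{C}\cup\{\infty\}$, $\mathbb{D}$ is the open unit disk, $\mathbb{D}^2=\mathbb{D}\times\mathbb{D}$. With the conventions $z\cdot\infty=\infty\cdot z=\infty$ for $z\in\widehat{\mathbb{C}}\setminus\{0\}$ and $0\cdot\infty=\infty\cdot 0=1$, put $\Omega=\{(z,w)\in\widehat{\mathbb{C}}^2: z\cdot w\neq 1\}$, an open complex submanifold of $\widehat{\mathbb{C}}^2$, and $\Omega_+=\Omega\setminus\{(z,\infty):z\in\widehat{\mathbb{C}}\}$, $\Omega_-=\Omega\setminus\{(\infty,w):w\in\widehat{\mathbb{C}}\}$, $\Omega_*=\{(z,w)\in\mathbb{C}^2: zw\in\mathbb{C}\setminus[1,\infty)\}$. All of these domains contain $\mathbb{D}^2$. $\mathcal{H}(D)$ denotes the space of holomorphic functions $D\to\mathbb{C}$ with the topology of locally uniform convergence. $\Delta_{zw}=4(1-zw)^2\partial_z\partial_w$ and $X_\lambda(\mathbb{D}^2)=\{F\in\mathcal{H}(\mathbb{D}^2):\Delta_{zw}F=\lambda F\}$. The Möbius group $\mathcal{M}$ of $\Omega$ consists of all maps $(z,w)\mapsto\big(\psi(z),1/\psi(1/w)\big)$ and $(z,w)\mapsto\big(\psi(w),1/\psi(1/z)\big)$, where $\psi$ runs through all Möbius transformations of $\widehat{\mathbb{C}}$. The Möbius group of the bidisk is $\mathcal{M}(\mathbb{D}^2)=\mathrm{Aut}(\mathbb{D}^2)\cap\mathcal{M}$, where $\mathrm{Aut}(\mathbb{D}^2)$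 is the group of biholomorphic automorphisms of $\mathbb{D}^2$; it consists of the maps of the two above forms with $\psi$ running through the conformal automorphisms of $\mathbb{D}$. A Möbius invariant subspace is a closed subspace $Y$ such that $F\circ T\in Y$ for all $F\in Y$ and all $T\in\mathcal{M}(\mathbb{D}^2)$. For a domain $V\supseteq\mathbb{D}^2$, $X_\lambda(\mathbb{D}^2)\cap\mathcal{H}(V)$ denotes the set of all $F\in X_\lambda(\mathbb{D}^2)$ that have a holomorphic extension to $V$. For $Y\subseteq X_\lambda(\mathbb{D}^2)$, "$X_\lambda(\mathbb{D}^2)\cap\mathcal{H}(V)$ is dense in $Y$" means that $X_\lambda(\mathbb{D}^2)\cap\mathcal{H}(V)\subseteq Y$ and every function in $Y$ can be approximated locally uniformly on $\mathbb{D}^2$ by functions in $X_\lambda(\mathbb{D}^2)\cap\mathcal{H}(V)$. *)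

theory Defs
  imports "HOL-Complex_Analysis.Complex_Analysis" "HOL-Library.Function_Algebras"
begin

definition holomorphic2_on :: "(complex \<times> complex \<Rightarrow> complex) \<Rightarrow> (complex \<times> complex) set \<Rightarrow> bool"
  where "holomorphic2_on f S \<longleftrightarrow>
    (\<forall>p\<in>S. \<exists>a b. (f has_derivative (\<lambda>(h, k). a * h + b * k)) (at p))"

text \<open>Elements of \<open>hol_space D\<close> represent functions on \<open>D\<close>; they are normalised to vanish outside
  \<open>D\<close>, so that equality and the linear structure are those of functions on \<open>D\<close>.\<close>

definition hol_space :: "(complex \<times> complex) set \<Rightarrow> (complex \<times> complex \<Rightarrow> complex) set"
  where "hol_space D = {F. holomorphic2_on F D \<and> (\<forall>p. p \<notin> D \<longrightarrow> F p = 0)}"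

text \<open>The topology of locally uniform convergence; since \<open>D\<close> is going to be open in \<open>\<complex>\<^sup>2\<close>, hence
  locally compact, this is uniform convergence on compact subsets.\<close>

definition loc_unif_nhd ::
    "(complex \<times> complex) set \<Rightarrow> (complex \<times> complex) set \<Rightarrow> real \<Rightarrow>
     (complex \<times> complex \<Rightarrow> complex) \<Rightarrow> (complex \<times> complex \<Rightarrow> complex) set"
  where "loc_unif_nhd D K e F = {G \<in> hol_space D. \<forall>p\<in>K. dist (G p) (F p) < e}"

definition hol_topology :: "(complex \<times> complex) set \<Rightarrow> (complex \<times> complex \<Rightarrow> complex) topology"
  where "hol_topology D = topology (\<lambda>U. U \<subseteq> hol_space D \<and>
    (\<forall>F\<in>U. \<exists>K e. compact K \<and> K \<subseteq> D \<and> 0 < e \<and> loc_unif_nhd D K e F \<subseteq> U))"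

lemma openin_hol_topology:
  "openin (hol_topology D) U \<longleftrightarrow> U \<subseteq> hol_space D \<and>
    (\<forall>F\<in>U. \<exists>K e. compact K \<and> K \<subseteq> D \<and> 0 < e \<and> loc_unif_nhd D K e F \<subseteq> U)"
proof -
  have "istopology (\<lambda>U. U \<subseteq> hol_space D \<and>
    (\<forall>F\<in>U. \<exists>K e. compact K \<and> K \<subseteq> D \<and> 0 < e \<and> loc_unif_nhd D K e F \<subseteq> U))"
    (is "istopology ?P")
    unfolding istopology_def
  proof (intro conjI allI impI)
    fix S T assume S: "?P S" and T: "?P T"
    show "S \<inter> T \<subseteq> hol_space D" using S by blast
    show "\<forall>F\<in>S \<inter> T. \<exists>K e. compact K \<and> K \<subseteq> D \<and> 0 < e \<and> loc_unif_nhd D K e F \<subseteq> S \<inter> T"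
    proof
      fix F assume F: "F \<in> S \<inter> T"
      obtain K e where K: "compact K" "K \<subseteq> D" "0 < e" "loc_unif_nhd D K e F \<subseteq> S"
        using S F by blast
      obtain L d where L: "compact L" "L \<subseteq> D" "0 < d" "loc_unif_nhd D L d F \<subseteq> T"
        using T F by blast
      have "loc_unif_nhd D (K \<union> L) (min e d) F \<subseteq> S \<inter> T"
        using K(4) L(4) unfolding loc_unif_nhd_def by auto
      then show "\<exists>K e. compact K \<and> K \<subseteq> D \<and> 0 < e \<and> loc_unif_nhd D K e F \<subseteq> S \<inter> T"
        using K L by (intro exI[of _ "K \<union> L"] exI[of _ "min e d"]) (auto intro: compact_Un)
    qed
  next
    fix \<K> assume A: "\<forall>U\<in>\<K>. ?P U"
    show "\<Union>\<K> \<subseteq> hol_space D" using A by blast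
    show "\<forall>F\<in>\<Union>\<K>. \<exists>K e. compact K \<and> K \<subseteq> D \<and> 0 < e \<and> loc_unif_nhd D K e F \<subseteq> \<Union>\<K>"
    proof
      fix F assume "F \<in> \<Union>\<K>"
      then obtain U where U: "U \<in> \<K>" "F \<in> U" by blast
      have "?P U" using A U(1) by (rule bspec)
      then obtain K e where K: "compact K" "K \<subseteq> D" "0 < e" "loc_unif_nhd D K e F \<subseteq> U"
        using U(2) by blast
      have "loc_unif_nhd D K e F \<subseteq> \<Union>\<K>" using K(4) U(1) by (rule order_trans[OF _ Union_upper])
      with K show "\<exists>K e. compact K \<and> K \<subseteq> D \<and> 0 < e \<and> loc_unif_nhd D K e F \<subseteq> \<Union>\<K>"
        by (intro exI[of _ K] exI[of _ e] conjI)
    qed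
  qed
  then show ?thesis
    by (simp add: hol_topology_def topology_inverse')
qed

lemma topspace_hol_topology: "topspace (hol_topology D) = hol_space D"
proof -
  have "openin (hol_topology D) (hol_space D)"
    unfolding openin_hol_topology loc_unif_nhd_def
    by (auto intro!: exI[of _ "{}"] exI[of _ "1::real"])
  then show ?thesis
    using openin_hol_topology[of D "topspace (hol_topology D)"] openin_subset[of "hol_topology D" "hol_space D"]
      openin_topspace[of "hol_topology D"] by (metis subset_antisym)
qed

lemma holomorphic2_on_imp_continuous_on: "holomorphic2_on f S \<Longrightarrow> continuous_on S f"
  unfolding holomorphic2_on_def
  by (intro continuous_at_imp_continuous_on ballI) (blast dest: has_derivative_continuous)

lemma openin_loc_unif_nhd:
  assumes "compact K" "K \<subseteq> D" "F \<in> hol_space D"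
  shows "openin (hol_topology D) (loc_unif_nhd D K e F)"
  unfolding openin_hol_topology
proof (intro conjI ballI)
  show "loc_unif_nhd D K e F \<subseteq> hol_space D" by (auto simp: loc_unif_nhd_def)
  fix G assume G: "G \<in> loc_unif_nhd D K e F"
  show "\<exists>L d. compact L \<and> L \<subseteq> D \<and> 0 < d \<and> loc_unif_nhd D L d G \<subseteq> loc_unif_nhd D K e F"
  proof (cases "K = {}")
    case True
    then show ?thesis
      by (intro exI[of _ "{}"] exI[of _ "1::real"]) (auto simp: loc_unif_nhd_def)
  next
    case False
    have "continuous_on K G" "continuous_on K F"
      using G assms by (auto simp: loc_unif_nhd_def hol_space_def
          intro!: continuous_on_subset[OF holomorphic2_on_imp_continuous_on])
    then have "continuous_on K (\<lambda>p. dist (G p) (F p))" by (intro continuous_intros)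
    then obtain q where q: "q \<in> K" "\<And>p. p \<in> K \<Longrightarrow> dist (G p) (F p) \<le> dist (G q) (F q)"
      using continuous_attains_sup[OF assms(1) False] by blast
    define d where "d = e - dist (G q) (F q)"
    have d: "0 < d" using G q(1) by (auto simp: d_def loc_unif_nhd_def)
    have "loc_unif_nhd D K d G \<subseteq> loc_unif_nhd D K e F"
    proof
      fix H assume H: "H \<in> loc_unif_nhd D K d G"
      have "dist (H p) (F p) < e" if "p \<in> K" for p
      proof -
        have "dist (H p) (G p) < d" using H that by (simp add: loc_unif_nhd_def)
        then show ?thesis
          using q(2)[OF that] dist_triangle[of "H p" "F p" "G p"] by (simp add: d_def)
      qed
      then show "H \<in> loc_unif_nhd D K e F" using H by (auto simp: loc_unif_nhd_def)
    qed
    then show ?thesis using assms(1,2) d by (intro exI[of _ K] exI[of _ d] conjI)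
  qed
qed

lemma closure_of_hol_topology:
  assumes "A \<subseteq> hol_space D"
  shows "hol_topology D closure_of A =
    {F \<in> hol_space D. \<forall>K e. compact K \<and> K \<subseteq> D \<and> 0 < e \<longrightarrow>
       (\<exists>G\<in>A. \<forall>p\<in>K. dist (G p) (F p) < e)}" (is "_ = ?R")
proof
  show "hol_topology D closure_of A \<subseteq> ?R"
  proof
    fix F assume F: "F \<in> hol_topology D closure_of A"
    then have FD: "F \<in> hol_space D" by (simp add: in_closure_of topspace_hol_topology)
    have "\<exists>G\<in>A. \<forall>p\<in>K. dist (G p) (F p) < e" if Ke: "compact K" "K \<subseteq> D" "0 < e" for K e
    proof -
      have "F \<in> loc_unif_nhd D K e F" using Ke FD by (simp add: loc_unif_nhd_def)
      then obtain G where "G \<in> A" "G \<in> loc_unif_nhd D K e F"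
        using F openin_loc_unif_nhd[OF Ke(1,2) FD, of e] unfolding in_closure_of by blast
      then show ?thesis by (auto simp: loc_unif_nhd_def)
    qed
    then show "F \<in> ?R" using FD by blast
  qed
  show "?R \<subseteq> hol_topology D closure_of A"
  proof
    fix F assume F: "F \<in> ?R"
    have "\<exists>G. G \<in> A \<and> G \<in> U" if U: "F \<in> U" "openin (hol_topology D) U" for U
    proof -
      obtain K e where K: "compact K" "K \<subseteq> D" "0 < e" "loc_unif_nhd D K e F \<subseteq> U"
        using U unfolding openin_hol_topology by blast
      then obtain G where G: "G \<in> A" "\<forall>p\<in>K. dist (G p) (F p) < e" using F by blast
      then have "G \<in> loc_unif_nhd D K e F" using assms by (auto simp: loc_unif_nhd_def)
      then show ?thesis using G K by blast
    qed
    then show "F \<in> hol_topology D closure_of A"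
      using F by (simp add: in_closure_of topspace_hol_topology)
  qed
qed

global_interpretation cfun: vector_space
  "\<lambda>(c::complex) (F :: complex \<times> complex \<Rightarrow> complex) p. c * F p"
  by unfold_locales (auto simp: fun_eq_iff algebra_simps)

text \<open>\<^term>\<open>cfun.dim\<close> is \<open>0\<close> on infinite-dimensional subspaces, so finiteness has to be stated
  separately.\<close>

definition finite_dim :: "(complex \<times> complex \<Rightarrow> complex) set \<Rightarrow> bool"
  where "finite_dim Y \<longleftrightarrow> (\<exists>B. finite B \<and> B \<subseteq> Y \<and> Y \<subseteq> cfun.span B)"

text \<open>\<^term>\<open>None\<close> is the point at infinity.\<close>

type_synonym sphere = "complex option"

fun sphere_mult :: "sphere \<Rightarrow> sphere \<Rightarrow> sphere" where
  "sphere_mult (Some z) (Some w) = Some (z * w)"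
| "sphere_mult (Some z) None = (if z = 0 then Some 1 else None)"
| "sphere_mult None (Some w) = (if w = 0 then Some 1 else None)"
| "sphere_mult None None = None"

fun sphere_inverse :: "sphere \<Rightarrow> sphere" where
  "sphere_inverse (Some z) = (if z = 0 then None else Some (1 / z))"
| "sphere_inverse None = Some 0"

text \<open>The standard atlas, given by the inverses \<open>\<complex> \<Rightarrow> sphere\<close> of the two charts.\<close>

definition sphere_params :: "(complex \<Rightarrow> sphere) set"
  where "sphere_params = {Some, \<lambda>\<zeta>. sphere_inverse (Some \<zeta>)}"

definition sphere_holomorphic2_on :: "(sphere \<times> sphere \<Rightarrow> complex) \<Rightarrow> (sphere \<times> sphere) set \<Rightarrow> bool"
  where "sphere_holomorphic2_on G V \<longleftrightarrow>
    (\<forall>\<sigma>\<in>sphere_params. \<forall>\<tau>\<in>sphere_params.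
       holomorphic2_on (\<lambda>(z, w). G (\<sigma> z, \<tau> w)) {(z, w). (\<sigma> z, \<tau> w) \<in> V})"

definition Omega :: "(sphere \<times> sphere) set"
  where "Omega = {(z, w). sphere_mult z w \<noteq> Some 1}"

definition Omega_plus :: "(sphere \<times> sphere) set"
  where "Omega_plus = Omega - {(z, None) |z. True}"

definition Omega_minus :: "(sphere \<times> sphere) set"
  where "Omega_minus = Omega - {(None, w) |w. True}"

definition Omega_star :: "(sphere \<times> sphere) set"
  where "Omega_star = {(Some z, Some w) |z w. z * w \<notin> complex_of_real ` {1..}}"

definition bidisk :: "(complex \<times> complex) set"
  where "bidisk = ball 0 1 \<times> ball 0 1"

definition Delta_zw :: "(complex \<times> complex \<Rightarrow> complex) \<Rightarrow> complex \<times> complex \<Rightarrow> complex"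
  where "Delta_zw F = (\<lambda>(z, w). 4 * (1 - z * w)\<^sup>2 * deriv (\<lambda>\<zeta>. deriv (\<lambda>\<omega>. F (\<zeta>, \<omega>)) w) z)"

definition eigenspace :: "complex \<Rightarrow> (complex \<times> complex \<Rightarrow> complex) set"
  where "eigenspace lam = {F \<in> hol_space bidisk. \<forall>p\<in>bidisk. Delta_zw F p = lam * F p}"

definition eigenspace_ext ::
    "complex \<Rightarrow> (sphere \<times> sphere) set \<Rightarrow> (complex \<times> complex \<Rightarrow> complex) set"
  where "eigenspace_ext lam V = {F \<in> eigenspace lam.
    \<exists>G. sphere_holomorphic2_on G V \<and> (\<forall>(z, w)\<in>bidisk. G (Some z, Some w) = F (z, w))}"

definition dense_in ::
    "(complex \<times> complex \<Rightarrow> complex) set \<Rightarrow> (complex \<times> complex \<Rightarrow> complex) set \<Rightarrow> bool"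
  where "dense_in A Y \<longleftrightarrow> A \<subseteq> Y \<and> Y \<subseteq> hol_topology bidisk closure_of A"

fun moebius :: "complex \<Rightarrow> complex \<Rightarrow> complex \<Rightarrow> complex \<Rightarrow> sphere \<Rightarrow> sphere" where
  "moebius a b c d (Some z) = (if c * z + d = 0 then None else Some ((a * z + b) / (c * z + d)))"
| "moebius a b c d None = (if c = 0 then None else Some (a / c))"

definition moebius_maps :: "(sphere \<Rightarrow> sphere) set"
  where "moebius_maps = {moebius a b c d |a b c d. a * d - b * c \<noteq> 0}"

text \<open>The maps below are written on the whole of \<open>sphere \<times> sphere\<close>; each of them maps \<^term>\<open>Omega\<close>
  onto itself.\<close>

definition moebius_group :: "(sphere \<times> sphere \<Rightarrow> sphere \<times> sphere) set"
  where "moebius_group =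
    {(\<lambda>(z, w). (\<psi> z, sphere_inverse (\<psi> (sphere_inverse w)))) |\<psi>. \<psi> \<in> moebius_maps} \<union>
    {(\<lambda>(z, w). (\<psi> w, sphere_inverse (\<psi> (sphere_inverse z)))) |\<psi>. \<psi> \<in> moebius_maps}"

definition holomorphic2_map_on ::
    "(complex \<times> complex \<Rightarrow> complex \<times> complex) \<Rightarrow> (complex \<times> complex) set \<Rightarrow> bool"
  where "holomorphic2_map_on T S \<longleftrightarrow>
    holomorphic2_on (fst \<circ> T) S \<and> holomorphic2_on (snd \<circ> T) S"

text \<open>Only the values on the bidisk of a member of \<open>Aut_bidisk\<close> are relevant.\<close>

definition Aut_bidisk :: "(complex \<times> complex \<Rightarrow> complex \<times> complex) set"
  where "Aut_bidisk = {T. bij_betw T bidisk bidisk \<and> holomorphic2_map_on T bidisk \<and>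
    holomorphic2_map_on (inv_into bidisk T) bidisk}"

definition moebius_group_bidisk :: "(complex \<times> complex \<Rightarrow> complex \<times> complex) set"
  where "moebius_group_bidisk = {T \<in> Aut_bidisk. \<exists>M\<in>moebius_group.
    \<forall>(z, w)\<in>bidisk. M (Some z, Some w) = (Some (fst (T (z, w))), Some (snd (T (z, w))))}"

definition moebius_invariant_subspace ::
    "complex \<Rightarrow> (complex \<times> complex \<Rightarrow> complex) set \<Rightarrow> bool"
  where "moebius_invariant_subspace lam Y \<longleftrightarrow>
    cfun.subspace Y \<and>
    closedin (subtopology (hol_topology bidisk) (eigenspace lam)) Y \<and>
    (\<forall>F\<in>Y. \<forall>T\<in>moebius_group_bidisk. (\<lambda>p. if p \<in> bidisk then F (T p) else 0) \<in> Y)"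

definition alt_E0 :: "complex \<Rightarrow> (complex \<times> complex \<Rightarrow> complex) set \<Rightarrow> bool"
  where "alt_E0 lam Y \<longleftrightarrow> Y = eigenspace_ext lam Omega \<and> finite_dim Y"

definition alt_Eplus :: "complex \<Rightarrow> (complex \<times> complex \<Rightarrow> complex) set \<Rightarrow> bool"
  where "alt_Eplus lam Y \<longleftrightarrow> dense_in (eigenspace_ext lam Omega_plus) Y"

definition alt_Eminus :: "complex \<Rightarrow> (complex \<times> complex \<Rightarrow> complex) set \<Rightarrow> bool"
  where "alt_Eminus lam Y \<longleftrightarrow> dense_in (eigenspace_ext lam Omega_minus) Y"

definition alt_NE :: "complex \<Rightarrow> (complex \<times> complex \<Rightarrow> complex) set \<Rightarrow> bool"
  where "alt_NE lam Y \<longleftrightarrow> dense_in (eigenspace_ext lam Omega_star) Y"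

end

(* Swapping the variables belongs to the Moebius group, so an invariant subspace is symmetric
   under F(z,w) -> F(w,z). An eigenfunction is determined by F(z,0) and F(0,w) and is a locally
   uniformly convergent sum of the weight functions z^n f_n(zw) and their swaps, where f_n is the
   hypergeometric solution of (1-t)^2 (t f'' + (n+1) f') = (lam/4) f with f(0) = 1. Averaging over
   rotations shows that an invariant subspace contains the n-th weight function as soon as one of
   its members has a nonzero n-th coefficient; the first order term of a hyperbolic translation
   leads from weight n to weights n-1 and n+1, the latter step being blocked only for
   lam = 4n(n+1). Hence the nonzero invariant subspaces are the full eigenspace and, for
   lam = 4m(m+1), the span of the weights up to m, and the alternatives E+ and E- never occur.
   The f_n extend to the slit plane via t = 4u/(1+u)^2; for lam = 4m(m+1) they are rational.
   A function extending to Omega_plus has no weight-n part for large n, because that part would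
   be entire in v = zw/(1-zw) while its Taylor coefficients force radius of convergence 1. *)

theory Submission
  imports Defs
begin

section \<open>Holomorphic functions of two variables\<close>

text \<open>The equation dz (dw F) = lam F / (4 (1 - zw)^2) is a Goursat problem: its
  characteristics are parallel to the axes and 1 - zw has no zero in the bidisk, so values on z = 0
  and w = 0 determine F. The coefficients of the weight expansion are the Taylor coefficients of
  F(z,0) and F(0,w), hence continuous functionals; vanishing of a weight is therefore a closed
  condition, and density is refuted in this way. The number 4n(n+1) has two sources: it is the lam
  at which the first order coefficient n - lam/(4(n+1)) of a translation vanishes, and the lam at
  which the Taylor recursion in v breaks off. For lam = 4m(m+1) the swap of weight m+1 extends to
  \<open>Omega_plus\<close> while weight m+1 does not; an inclusion or a density statement fails
  accordingly, which rules out E+, and E- by symmetry. \<open>holomorphic2_on\<close> supplies no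
  more than a complex-linear derivative at each point. Separately holomorphic, locally bounded
  functions form an equivalent class on open sets that is visibly stable under partial derivatives,
  and the second order calculus is obtained through it.\<close>

definition dz :: "(complex \<times> complex \<Rightarrow> complex) \<Rightarrow> complex \<times> complex \<Rightarrow> complex"
  where "dz F = (\<lambda>(z, w). deriv (\<lambda>\<zeta>. F (\<zeta>, w)) z)"

definition dw :: "(complex \<times> complex \<Rightarrow> complex) \<Rightarrow> complex \<times> complex \<Rightarrow> complex"
  where "dw F = (\<lambda>(z, w). deriv (\<lambda>\<omega>. F (z, \<omega>)) w)"

lemma Delta_zw_eq: "Delta_zw F (z, w) = 4 * (1 - z * w)\<^sup>2 * dz (dw F) (z, w)"
  by (simp add: Delta_zw_def dz_def dw_def)

text \<open>Osgood's hypotheses. Local boundedness is preferred to continuity because Cauchy's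
  estimate passes it on to the partial derivatives, so that the class is closed under
  \<open>dz\<close> and \<open>dw\<close>.\<close>

definition separately_holomorphic_on ::
    "(complex \<times> complex \<Rightarrow> complex) \<Rightarrow> (complex \<times> complex) set \<Rightarrow> bool"
  where "separately_holomorphic_on F S \<longleftrightarrow>
    (\<forall>p\<in>S. \<exists>M. \<forall>\<^sub>F q in nhds p. norm (F q) \<le> M) \<and>
    (\<forall>(z, w)\<in>S. (\<lambda>\<zeta>. F (\<zeta>, w)) field_differentiable (at z) \<and>
                (\<lambda>\<omega>. F (z, \<omega>)) field_differentiable (at w))"

lemma separately_holomorphic_on_local:
  assumes "separately_holomorphic_on F S" "open S" "(z0, w0) \<in> S"
  obtains r M where "r > 0" "M > 0" "ball z0 r \<times> ball w0 r \<subseteq> S"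
    "\<And>z w. z \<in> ball z0 r \<Longrightarrow> w \<in> ball w0 r \<Longrightarrow> norm (F (z, w)) \<le> M"
    "\<And>w. w \<in> ball w0 r \<Longrightarrow> (\<lambda>\<zeta>. F (\<zeta>, w)) holomorphic_on ball z0 r"
    "\<And>z. z \<in> ball z0 r \<Longrightarrow> (\<lambda>\<omega>. F (z, \<omega>)) holomorphic_on ball w0 r"
proof -
  obtain M where "\<forall>\<^sub>F q in nhds (z0, w0). norm (F q) \<le> M"
    using assms unfolding separately_holomorphic_on_def by blast
  then obtain T where T: "open T" "(z0, w0) \<in> T" "\<And>q. q \<in> T \<Longrightarrow> norm (F q) \<le> M"
    unfolding eventually_nhds by blast
  obtain A B where AB: "open A" "open B" "(z0, w0) \<in> A \<times> B" "A \<times> B \<subseteq> S \<inter> T"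
    using open_prod_elim[of "S \<inter> T" "(z0, w0)"] assms T by blast
  obtain r1 where r1: "r1 > 0" "ball z0 r1 \<subseteq> A" using AB open_contains_ball by blast
  obtain r2 where r2: "r2 > 0" "ball w0 r2 \<subseteq> B" using AB open_contains_ball by blast
  define r where "r = min r1 r2"
  have sub: "ball z0 r \<times> ball w0 r \<subseteq> S \<inter> T"
  proof -
    have "ball z0 r \<subseteq> A" "ball w0 r \<subseteq> B" using r1 r2 by (auto simp: r_def)
    then show ?thesis using AB(4) by blast
  qed
  have d: "(\<lambda>\<zeta>. F (\<zeta>, w)) field_differentiable (at z)" "(\<lambda>\<omega>. F (z, \<omega>)) field_differentiable (at w)"
    if "(z, w) \<in> S" for z w
    using assms(1) that unfolding separately_holomorphic_on_def by blast+
  show ?thesis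
  proof (rule that[of r "max M 1"])
    show "ball z0 r \<times> ball w0 r \<subseteq> S" using sub by blast
    show "norm (F (z, w)) \<le> max M 1" if "z \<in> ball z0 r" "w \<in> ball w0 r" for z w
    proof -
      have "norm (F (z, w)) \<le> M" using T(3)[of "(z, w)"] sub that by blast
      then show ?thesis by simp
    qed
    show "(\<lambda>\<zeta>. F (\<zeta>, w)) holomorphic_on ball z0 r" if "w \<in> ball w0 r" for w
      unfolding holomorphic_on_def
      using d sub that by (blast intro: field_differentiable_at_within)
    show "(\<lambda>\<omega>. F (z, \<omega>)) holomorphic_on ball w0 r" if "z \<in> ball z0 r" for z
      unfolding holomorphic_on_def
      using d sub that by (blast intro: field_differentiable_at_within)
  qed (use r1 r2 in \<open>auto simp: r_def\<close>)
qed

text \<open>Cauchy's inequality on the circle of radius r/4 around z, which lies in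
  \<open>ball a r\<close> since |z - a| < r/2. The bound depends on f only through M, hence is
  uniform over the slices of a bounded function.\<close>

lemma deriv_bound_ball:
  assumes "f holomorphic_on ball a r" "\<And>z. z \<in> ball a r \<Longrightarrow> norm (f z) \<le> M" "z \<in> ball a (r / 2)" "r > 0"
  shows "norm ((deriv ^^ n) f z) \<le> fact n * M / (r / 4) ^ n"
proof -
  have sub: "cball z (r / 4) \<subseteq> ball a r"
  proof
    fix x assume "x \<in> cball z (r / 4)"
    then show "x \<in> ball a r"
      using assms(3,4) dist_triangle[of a x z] by (simp add: dist_commute)
  qed
  show ?thesis
  proof (rule Cauchy_inequality)
    show "f holomorphic_on ball z (r / 4)"
      using assms(1) sub ball_subset_cball by (meson holomorphic_on_subset order_trans)
    show "continuous_on (cball z (r / 4)) f"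
      using assms(1) sub by (meson holomorphic_on_imp_continuous_on continuous_on_subset)
    show "norm (f x) \<le> M" if "norm (z - x) = r / 4" for x
      by (rule assms(2)) (use sub that in \<open>auto simp: dist_norm\<close>)
  qed (use assms in auto)
qed

lemma separately_holomorphic_swap:
  assumes "separately_holomorphic_on F S" "open S"
  shows "separately_holomorphic_on (F \<circ> prod.swap) (prod.swap ` S)"
proof -
  have "\<exists>M. \<forall>\<^sub>F q in nhds (w, z). norm (F (prod.swap q)) \<le> M" if "(z, w) \<in> S" for z w
  proof -
    have "\<exists>M. \<forall>\<^sub>F q in nhds (z, w). norm (F q) \<le> M"
      using assms(1) that unfolding separately_holomorphic_on_def by (rule_tac bspec) simp_all
    then obtain M where M: "\<forall>\<^sub>F q in nhds (z, w). norm (F q) \<le> M" by (rule exE)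
    have "filterlim prod.swap (nhds (z, w)) (nhds (w, z))"
      using isCont_swap[of "(w, z)"] unfolding isCont_def tendsto_at_iff_tendsto_nhds by simp
    from eventually_compose_filterlim[OF M this] show ?thesis by (rule exI)
  qed
  then show ?thesis
    using assms unfolding separately_holomorphic_on_def by auto
qed

text \<open>The slices share one bound M near p, so by Cauchy's estimate they share the Lipschitz
  constant B = M/(r/4). The increment of F is split into a move in z at height w and a move in w
  over z0.\<close>

lemma separately_holomorphic_imp_continuous:
  assumes F: "separately_holomorphic_on F S" "open S" "p \<in> S"
  shows "isCont F p"
proof -
  obtain z0 w0 where p: "p = (z0, w0)" by (cases p)
  obtain r M where r: "r > 0" "M > 0" "ball z0 r \<times> ball w0 r \<subseteq> S"
    and b: "\<And>z w. z \<in> ball z0 r \<Longrightarrow> w \<in> ball w0 r \<Longrightarrow> norm (F (z, w)) \<le> M"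
    and hz: "\<And>w. w \<in> ball w0 r \<Longrightarrow> (\<lambda>\<zeta>. F (\<zeta>, w)) holomorphic_on ball z0 r"
    and hw: "\<And>z. z \<in> ball z0 r \<Longrightarrow> (\<lambda>\<omega>. F (z, \<omega>)) holomorphic_on ball w0 r"
    using separately_holomorphic_on_local[OF F(1,2)] F(3) p by metis
  define B where "B = M / (r / 4)"
  have lip: "norm (f x - f y) \<le> B * norm (x - y)"
    if "f holomorphic_on ball a r" "\<And>z. z \<in> ball a r \<Longrightarrow> norm (f z) \<le> M"
      "x \<in> ball a (r/2)" "y \<in> ball a (r/2)" for f :: "complex \<Rightarrow> complex" and a x y
  proof (rule field_differentiable_bound[of "ball a (r/2)"])
    fix z assume z: "z \<in> ball a (r / 2)"
    then have "z \<in> ball a r" using r by auto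
    then show "(f has_field_derivative deriv f z) (at z within ball a (r/2))"
      by (intro DERIV_subset[OF holomorphic_derivI[OF that(1)]]) auto
    show "norm (deriv f z) \<le> B"
      using deriv_bound_ball[of f a r M z 1] that z r by (simp add: B_def)
  qed (use that in auto)
  have ev: "\<forall>\<^sub>F q in at p. dist (F q) (F p) \<le> B * (norm (fst q - z0) + norm (snd q - w0))"
  proof -
    have o: "open (ball z0 (r/2) \<times> ball w0 (r/2))" by (intro open_Times) auto
    have "\<forall>\<^sub>F q in nhds p. q \<in> ball z0 (r/2) \<times> ball w0 (r/2)"
      using eventually_nhds_in_open[OF o, of p] r p by auto
    then have "\<forall>\<^sub>F q in nhds p. dist (F q) (F p) \<le> B * (norm (fst q - z0) + norm (snd q - w0))"
    proof eventually_elim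
      case (elim q)
      obtain z w where q: "q = (z, w)" by (cases q)
      have zw: "z \<in> ball z0 (r/2)" "w \<in> ball w0 (r/2)" "z0 \<in> ball z0 (r/2)" "w0 \<in> ball w0 (r/2)"
         "w \<in> ball w0 r" "z0 \<in> ball z0 r"
        using elim q r by auto
      have "norm (F (z, w) - F (z0, w)) \<le> B * norm (z - z0)"
        using lip[OF hz[of w] b[of _ w] zw(1,3)] zw by auto
      moreover have "norm (F (z0, w) - F (z0, w0)) \<le> B * norm (w - w0)"
        using lip[OF hw[of z0] b[of z0 _] zw(2,4)] zw by auto
      moreover have "dist (F (z, w)) (F (z0, w0)) \<le> norm (F (z, w) - F (z0, w)) + norm (F (z0, w) - F (z0, w0))"
        by (metis dist_norm dist_triangle)
      ultimately show ?case unfolding q p by (simp add: distrib_left)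
    qed
    then show ?thesis by (simp add: eventually_nhds_conv_at)
  qed
  have "((\<lambda>q. B * (norm (fst q - z0) + norm (snd q - w0))) \<longlongrightarrow> B * (norm (fst p - z0) + norm (snd p - w0))) (at p)"
    by (intro tendsto_intros)
  then have "((\<lambda>q. B * (norm (fst q - z0) + norm (snd q - w0))) \<longlongrightarrow> 0) (at p)"
    by (simp add: p)
  then have "((\<lambda>q. dist (F q) (F p)) \<longlongrightarrow> 0) (at p)"
    by (rule Lim_null_comparison[rotated]) (use ev in simp)
  then show ?thesis
    unfolding isCont_def by (rule iffD2[OF tendsto_dist_iff])
qed

text \<open>Taylor's formula of order one with the Cauchy bound 2 M/(r/4)^2 = 32 M/r^2 for the
  second derivative. Uniformity over all f with bound M makes difference quotients in one variable
  converge uniformly in the other.\<close>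

lemma deriv_quadratic_bound:
  assumes f: "f holomorphic_on ball a r" "\<And>z. z \<in> ball a r \<Longrightarrow> norm (f z) \<le> M"
    and r: "r > 0" and h: "norm h < r / 2"
  shows "norm (f (a + h) - f a - h * deriv f a) \<le> 32 * M / r\<^sup>2 * norm h ^ 2"
proof -
  have "norm ((deriv ^^ 0) f (a + h) - (\<Sum>i\<le>1. (deriv ^^ i) f a * (a + h - a) ^ i / fact i))
      \<le> (2 * M / (r/4)^2) * norm (a + h - a) ^ Suc 1 / fact 1"
  proof (rule complex_Taylor[of "ball a (r/2)"])
    fix i :: nat and x assume x: "x \<in> ball a (r/2)"
    have "(deriv ^^ i) f holomorphic_on ball a r" by (intro holomorphic_higher_deriv f) auto
    moreover have "x \<in> ball a r" using x r by auto
    ultimately show "((deriv ^^ i) f has_field_derivative (deriv ^^ Suc i) f x) (at x within ball a (r/2))"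
      by (auto intro!: holomorphic_derivI)
  next
    fix x assume x: "x \<in> ball a (r/2)"
    show "norm ((deriv ^^ Suc 1) f x) \<le> 2 * M / (r/4)^2"
      using deriv_bound_ball[OF f x r, of 2] by (simp add: numeral_2_eq_2)
  qed (use h r in \<open>auto simp: dist_norm\<close>)
  then show ?thesis by (simp add: field_simps power2_eq_square)
qed

text \<open>The difference quotients \<open>Q h\<close> in z are holomorphic in w and converge
  uniformly to dz F(z0, .) as h tends to 0. So the limit is holomorphic in w, and its w-derivative
  is the limit of the w-derivatives of \<open>Q h\<close>. These are the difference quotients of
  \<open>dw F\<close> in z, whence both the z-differentiability of \<open>dw F\<close> and the
  symmetry of the mixed derivative.\<close>

lemma separately_holomorphic_dz:
  assumes F: "separately_holomorphic_on F S" "open S"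
  shows "separately_holomorphic_on (dz F) S"
    and "\<And>p. p \<in> S \<Longrightarrow> dw (dz F) p = dz (dw F) p"
    and "\<And>z w. (z, w) \<in> S \<Longrightarrow> (\<lambda>\<zeta>. dw F (\<zeta>, w)) field_differentiable at z"
proof -
  have *: "(\<exists>M. \<forall>\<^sub>F q in nhds (z0, w0). norm (dz F q) \<le> M) \<and>
     (\<lambda>\<zeta>. dz F (\<zeta>, w0)) field_differentiable (at z0) \<and>
     (\<lambda>\<omega>. dz F (z0, \<omega>)) field_differentiable (at w0) \<and>
     ((\<lambda>\<zeta>. dw F (\<zeta>, w0)) has_field_derivative dw (dz F) (z0, w0)) (at z0)" if p: "(z0, w0) \<in> S" for z0 w0
  proof -
    obtain r M where r: "r > 0" "M > 0" "ball z0 r \<times> ball w0 r \<subseteq> S"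
      and b: "\<And>z w. z \<in> ball z0 r \<Longrightarrow> w \<in> ball w0 r \<Longrightarrow> norm (F (z, w)) \<le> M"
      and hz: "\<And>w. w \<in> ball w0 r \<Longrightarrow> (\<lambda>\<zeta>. F (\<zeta>, w)) holomorphic_on ball z0 r"
      and hw: "\<And>z. z \<in> ball z0 r \<Longrightarrow> (\<lambda>\<omega>. F (z, \<omega>)) holomorphic_on ball w0 r"
      using separately_holomorphic_on_local[OF F p] by metis
    have bd: "\<forall>\<^sub>F q in nhds (z0, w0). norm (dz F q) \<le> M / (r / 4)"
    proof -
      have o: "open (ball z0 (r/2) \<times> ball w0 (r/2))" by (intro open_Times) auto
      have "\<forall>\<^sub>F q in nhds (z0, w0). q \<in> ball z0 (r/2) \<times> ball w0 (r/2)"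
        using eventually_nhds_in_open[OF o] r by auto
      then show ?thesis
      proof eventually_elim
        case (elim q)
        obtain z w where q: "q = (z, w)" by (cases q)
        have zw: "z \<in> ball z0 (r/2)" "w \<in> ball w0 r" using elim q r by auto
        show ?case
          using deriv_bound_ball[OF hz b, of w z 1] zw r by (simp add: q dz_def)
      qed
    qed
    have w0: "w0 \<in> ball w0 r" and z0: "z0 \<in> ball z0 r" using r by auto
    have "deriv (\<lambda>\<zeta>. F (\<zeta>, w0)) holomorphic_on ball z0 r"
      by (intro holomorphic_deriv hz w0) auto
    then have d1: "(\<lambda>\<zeta>. dz F (\<zeta>, w0)) field_differentiable (at z0)"
      unfolding dz_def using z0 by (simp add: holomorphic_on_imp_differentiable_at)
    define Q where "Q = (\<lambda>h w. (F (z0 + h, w) - F (z0, w)) / h)"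
    have ul: "uniform_limit (ball w0 r) Q (\<lambda>w. dz F (z0, w)) (at 0)"
      unfolding uniform_limit_iff
    proof (intro allI impI)
      fix e :: real assume e: "e > 0"
      define C where "C = 32 * M / r\<^sup>2"
      have C: "C > 0" using r by (simp add: C_def)
      have "\<forall>\<^sub>F h in at 0. h \<noteq> 0 \<and> norm h < min (r/2) (e / C)" 
        unfolding eventually_at using r e C by (intro exI[of _ "min (r/2) (e / C)"]) auto
      then show "\<forall>\<^sub>F h in at 0. \<forall>w\<in>ball w0 r. dist (Q h w) (dz F (z0, w)) < e"
      proof eventually_elim
        case (elim h)
        show ?case
        proof
          fix w assume w: "w \<in> ball w0 r"
          have "norm (F (z0 + h, w) - F (z0, w) - h * dz F (z0, w)) \<le> C * norm h ^ 2"
            using deriv_quadratic_bound[OF hz[OF w] b[OF _ w] r(1), of h] elim by (simp add: dz_def C_def)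
          moreover have "Q h w - dz F (z0, w) = (F (z0 + h, w) - F (z0, w) - h * dz F (z0, w)) / h"
            using elim by (simp add: Q_def field_simps)
          ultimately have "norm (Q h w - dz F (z0, w)) \<le> C * norm h ^ 2 / norm h"
            by (simp only: norm_divide divide_right_mono norm_ge_zero)
          also have "\<dots> = C * norm h" using elim by (simp add: power2_eq_square)
          also have "\<dots> < e" using elim C by (simp add: field_simps)
          finally show "dist (Q h w) (dz F (z0, w)) < e" by (simp add: dist_norm)
        qed
      qed
    qed
    have zev: "\<forall>\<^sub>F h in at 0. z0 + h \<in> ball z0 r"
      unfolding eventually_at using r by (auto intro!: exI[of _ r] simp: dist_norm)
    have Qh: "\<forall>\<^sub>F h in at 0. Q h holomorphic_on ball w0 r"
      using zev
    proof eventually_elim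
      case (elim h)
      show ?case unfolding Q_def divide_inverse by (intro holomorphic_intros hw elim z0)
    qed
    have hol: "(\<lambda>w. dz F (z0, w)) holomorphic_on ball w0 (r/2)"
    proof -
      have "\<forall>\<^sub>F h in at 0. continuous_on (cball w0 (r/2)) (Q h) \<and> Q h holomorphic_on ball w0 (r/2)"
        using Qh
      proof eventually_elim
        case (elim h)
        have "cball w0 (r/2) \<subseteq> ball w0 r" using r by auto
        then show ?case using elim
          by (meson holomorphic_on_imp_continuous_on continuous_on_subset holomorphic_on_subset ball_subset_cball order_trans)
      qed
      moreover have "uniform_limit (cball w0 (r/2)) Q (\<lambda>w. dz F (z0, w)) (at 0)"
        by (rule uniform_limit_on_subset[OF ul]) (use r in auto)
      ultimately show ?thesis
        by (rule holomorphic_uniform_limit) auto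
    qed
    then have d2: "(\<lambda>\<omega>. dz F (z0, \<omega>)) field_differentiable (at w0)"
      using r by (simp add: holomorphic_on_imp_differentiable_at)
    have "((\<lambda>h. deriv (Q h) w0) \<longlongrightarrow> deriv (\<lambda>w. dz F (z0, w)) w0) (at 0)"
      by (rule deriv_complex_uniform_limit[OF ul Qh]) (use r in auto)
    moreover have "\<forall>\<^sub>F h in at 0. deriv (Q h) w0 = (dw F (z0 + h, w0) - dw F (z0, w0)) / h"
      using zev
    proof eventually_elim
      case (elim h)
      have "((\<lambda>\<omega>. F (z, \<omega>)) has_field_derivative dw F (z, w0)) (at w0)" if "z \<in> ball z0 r" for z
        unfolding dw_def using holomorphic_derivI[OF hw[OF that] _ w0] by simp
      from this[OF elim] this[OF z0] show ?case
        unfolding Q_def divide_inverse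
        by (intro DERIV_imp_deriv) (auto intro!: derivative_eq_intros)
    qed
    ultimately have "((\<lambda>h. (dw F (z0 + h, w0) - dw F (z0, w0)) / h) \<longlongrightarrow> deriv (\<lambda>w. dz F (z0, w)) w0) (at 0)"
      by (rule Lim_transform_eventually)
    then have d3: "((\<lambda>\<zeta>. dw F (\<zeta>, w0)) has_field_derivative dw (dz F) (z0, w0)) (at z0)"
      unfolding DERIV_def by (simp add: dw_def[of "dz F"])
    from bd d1 d2 d3 show ?thesis by blast
  qed
  then show "separately_holomorphic_on (dz F) S" unfolding separately_holomorphic_on_def by auto
  show "dw (dz F) p = dz (dw F) p" if "p \<in> S" for p
  proof -
    obtain z w where p: "p = (z, w)" by (cases p)
    have "((\<lambda>\<zeta>. dw F (\<zeta>, w)) has_field_derivative dw (dz F) (z, w)) (at z)" using * that p by blast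
    from DERIV_imp_deriv[OF this] show ?thesis by (simp add: p dz_def[of "dw F"])
  qed
  show "(\<lambda>\<zeta>. dw F (\<zeta>, w)) field_differentiable at z" if "(z, w) \<in> S" for z w
    using *[OF that] field_differentiable_def by blast
qed

lemma dw_swap: "dw F = dz (F \<circ> prod.swap) \<circ> prod.swap"
  and dz_swap: "dz F = dw (F \<circ> prod.swap) \<circ> prod.swap"
  by (auto simp: fun_eq_iff dw_def dz_def)

lemma open_image_swap: "open (S :: ('a::topological_space \<times> 'b::topological_space) set) \<Longrightarrow> open (prod.swap ` S)"
proof -
  assume "open S"
  moreover have "prod.swap ` S = prod.swap -` S" by (force simp: image_iff)
  moreover have "continuous_on UNIV (prod.swap :: 'b \<times> 'a \<Rightarrow> 'a \<times> 'b)"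
    unfolding prod.swap_def by (intro continuous_intros)
  ultimately show ?thesis using open_vimage[of S prod.swap] by simp
qed

lemma separately_holomorphic_dw:
  assumes "separately_holomorphic_on F S" "open S"
  shows "separately_holomorphic_on (dw F) S"
proof -
  have o: "open (prod.swap ` S)" using assms(2) by (rule open_image_swap)
  have "separately_holomorphic_on (dz (F \<circ> prod.swap) \<circ> prod.swap) (prod.swap ` prod.swap ` S)"
    by (rule separately_holomorphic_swap[OF separately_holomorphic_dz(1)[OF separately_holomorphic_swap[OF assms] o] o])
  then show ?thesis by (simp add: dw_swap[of F] image_image)
qed

text \<open>Total differentiability follows from one partial derivative at the point and continuity
  of the other; \<open>dw F\<close> is continuous because it is again separately
  holomorphic.\<close>

lemma separately_holomorphic_imp_holomorphic2_on:
  assumes F: "separately_holomorphic_on F S" "open S"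
  shows "holomorphic2_on F S"
  unfolding holomorphic2_on_def
proof
  fix p assume "p \<in> S"
  then obtain z0 w0 where p: "p = (z0, w0)" and pS: "(z0, w0) \<in> S" by (cases p) auto
  obtain r M where r: "r > 0" "M > 0" "ball z0 r \<times> ball w0 r \<subseteq> S"
    and b: "\<And>z w. z \<in> ball z0 r \<Longrightarrow> w \<in> ball w0 r \<Longrightarrow> norm (F (z, w)) \<le> M"
    and hz: "\<And>w. w \<in> ball w0 r \<Longrightarrow> (\<lambda>\<zeta>. F (\<zeta>, w)) holomorphic_on ball z0 r"
    and hw: "\<And>z. z \<in> ball z0 r \<Longrightarrow> (\<lambda>\<omega>. F (z, \<omega>)) holomorphic_on ball w0 r"
    using separately_holomorphic_on_local[OF F pS] by metis
  have pin: "z0 \<in> ball z0 r" "w0 \<in> ball w0 r" "(z0, w0) \<in> ball z0 r \<times> ball w0 r" using r by auto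
  have "((\<lambda>(x, y). F (x, y)) has_derivative
      (\<lambda>(tx, ty). dz F (z0, w0) * tx + blinfun_apply (blinfun_mult_right (dw F (z0, w0))) ty))
      (at (z0, w0) within ball z0 r \<times> ball w0 r)"
  proof (rule has_derivative_partialsI)
    show "((\<lambda>x. F (x, w0)) has_derivative (*) (dz F (z0, w0))) (at z0 within ball z0 r)"
      using holomorphic_derivI[OF hz[OF pin(2)] open_ball pin(1), of "ball z0 r"]
      by (simp add: has_field_derivative_def dz_def)
    show "((\<lambda>y. F (x, y)) has_derivative blinfun_apply (blinfun_mult_right (dw F (x, y)))) (at y within ball w0 r)"
      if "x \<in> ball z0 r" "y \<in> ball w0 r" for x y
      using holomorphic_derivI[OF hw[OF that(1)] open_ball that(2), of "ball w0 r"]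
      by (simp add: has_field_derivative_def dw_def)
    have "isCont (dw F) (z0, w0)"
      using separately_holomorphic_imp_continuous[OF separately_holomorphic_dw[OF F] F(2) pS] .
    then have "isCont (\<lambda>q. blinfun_mult_right (dw F q)) (z0, w0)"
      by (rule bounded_linear.continuous[OF bounded_linear_blinfun_mult_right])
    then show "continuous (at (z0, w0) within ball z0 r \<times> ball w0 r) (\<lambda>(x, y). blinfun_mult_right (dw F (x, y)))"
      by (simp add: case_prod_unfold continuous_at_imp_continuous_at_within)
  qed (use pin in auto)
  moreover have "at (z0, w0) within ball z0 r \<times> ball w0 r = at (z0, w0)"
    by (rule at_within_open[OF pin(3)]) (intro open_Times open_ball)
  ultimately have "(F has_derivative (\<lambda>(h, k). dz F (z0, w0) * h + dw F (z0, w0) * k)) (at p)"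
    by (simp add: p)
  then show "\<exists>a b. (F has_derivative (\<lambda>(h, k). a * h + b * k)) (at p)" by blast
qed

lemma holomorphic2_on_imp_separately_holomorphic:
  assumes F: "holomorphic2_on F S"
  shows "separately_holomorphic_on F S"
  unfolding separately_holomorphic_on_def
proof (intro conjI ballI)
  fix p assume p: "p \<in> S"
  then have "isCont F p" using F unfolding holomorphic2_on_def by (blast dest: has_derivative_continuous)
  then have "isCont (\<lambda>q. norm (F q)) p" by (intro continuous_intros)
  then have "((\<lambda>q. norm (F q)) \<longlongrightarrow> norm (F p)) (nhds p)"
    unfolding isCont_def by (rule iffD1[OF tendsto_at_iff_tendsto_nhds])
  then have "\<forall>\<^sub>F q in nhds p. norm (F q) < norm (F p) + 1" by (rule order_tendstoD) simp
  then show "\<exists>M. \<forall>\<^sub>F q in nhds p. norm (F q) \<le> M"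
    by (intro exI[of _ "norm (F p) + 1"]) (auto elim: eventually_mono)
next
  fix p assume p: "p \<in> S"
  obtain z w where zw: "p = (z, w)" by (cases p)
  from p F obtain a b where d: "(F has_derivative (\<lambda>(h, k). a * h + b * k)) (at p)"
    unfolding holomorphic2_on_def by blast
  have "((\<lambda>\<zeta>. (\<zeta>, w)) has_derivative (\<lambda>h. (h, 0))) (at z)"
    by (rule has_derivative_Pair[OF has_derivative_ident has_derivative_const])
  from has_derivative_compose[OF this d[unfolded zw]]
  have d1: "((\<lambda>\<zeta>. F (\<zeta>, w)) has_derivative (\<lambda>h. a * h)) (at z)" by simp
  have "((\<lambda>\<omega>. (z, \<omega>)) has_derivative (\<lambda>h. (0, h))) (at w)"
    by (rule has_derivative_Pair[OF has_derivative_const has_derivative_ident])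
  from has_derivative_compose[OF this d[unfolded zw]]
  have d2: "((\<lambda>\<omega>. F (z, \<omega>)) has_derivative (\<lambda>h. b * h)) (at w)" by simp
  show "case p of (z, w) \<Rightarrow> (\<lambda>\<zeta>. F (\<zeta>, w)) field_differentiable at z \<and> (\<lambda>\<omega>. F (z, \<omega>)) field_differentiable at w"
    using d1 d2 unfolding field_differentiable_def has_field_derivative_def zw by auto
qed

lemma holomorphic2_on_iff_separately:
  "open S \<Longrightarrow> holomorphic2_on F S \<longleftrightarrow> separately_holomorphic_on F S"
  using separately_holomorphic_imp_holomorphic2_on holomorphic2_on_imp_separately_holomorphic by blast

lemma holomorphic2_on_fst_snd:
  assumes "holomorphic2_on F S" "(z, w) \<in> S"
  shows "(\<lambda>\<zeta>. F (\<zeta>, w)) field_differentiable at z" "(\<lambda>\<omega>. F (z, \<omega>)) field_differentiable at w"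
  using holomorphic2_on_imp_separately_holomorphic[OF assms(1)] assms(2)
  unfolding separately_holomorphic_on_def by auto

lemma holomorphic2_on_slice:
  assumes F: "holomorphic2_on F S"
  shows "(\<And>\<zeta>. \<zeta> \<in> A \<Longrightarrow> (\<zeta>, w) \<in> S) \<Longrightarrow> (\<lambda>\<zeta>. F (\<zeta>, w)) holomorphic_on A"
    and "(\<And>\<omega>. \<omega> \<in> A \<Longrightarrow> (z, \<omega>) \<in> S) \<Longrightarrow> (\<lambda>\<omega>. F (z, \<omega>)) holomorphic_on A"
  subgoal unfolding holomorphic_on_def
    by (blast intro: field_differentiable_at_within holomorphic2_on_fst_snd(1)[OF F])
  subgoal unfolding holomorphic_on_def
    by (blast intro: field_differentiable_at_within holomorphic2_on_fst_snd(2)[OF F])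
  done

lemma holomorphic2_on_dw: "holomorphic2_on F S \<Longrightarrow> open S \<Longrightarrow> holomorphic2_on (dw F) S"
  by (simp add: holomorphic2_on_iff_separately separately_holomorphic_dw)

lemma holomorphic2_on_dz: "holomorphic2_on F S \<Longrightarrow> open S \<Longrightarrow> holomorphic2_on (dz F) S"
  by (simp add: holomorphic2_on_iff_separately separately_holomorphic_dz)

lemma dw_dz_commute: "holomorphic2_on F S \<Longrightarrow> open S \<Longrightarrow> p \<in> S \<Longrightarrow> dw (dz F) p = dz (dw F) p"
  by (simp add: holomorphic2_on_iff_separately separately_holomorphic_dz)

text \<open>Weierstrass' theorem including the mixed derivative, so that the eigenvalue equation
  survives limits. Cauchy's estimate in w gives convergence of \<open>dw (F k)\<close> uniformly in
  z, and the one-variable theorem in z does the rest.\<close>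

lemma holomorphic2_on_uniform_limit:
  assumes S: "open S" and F: "\<And>k. holomorphic2_on (F k) S"
    and ul: "\<And>K. compact K \<Longrightarrow> K \<subseteq> S \<Longrightarrow> uniform_limit K F G sequentially"
  shows "holomorphic2_on G S"
    and "p \<in> S \<Longrightarrow> (\<lambda>k. dz (dw (F k)) p) \<longlonglongrightarrow> dz (dw G) p"
proof -
  have box: "\<exists>r>0. cball z r \<times> cball w r \<subseteq> S" if zw: "(z, w) \<in> S" for z w
  proof -
    obtain A B where AB: "open A" "open B" "(z, w) \<in> A \<times> B" "A \<times> B \<subseteq> S"
      using open_prod_elim[of S "(z, w)"] S zw by blast
    obtain r1 where r1: "r1 > 0" "cball z r1 \<subseteq> A" using AB open_contains_cball by blast
    obtain r2 where r2: "r2 > 0" "cball w r2 \<subseteq> B" using AB open_contains_cball by blast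
    have "cball z (min r1 r2) \<subseteq> A" "cball w (min r1 r2) \<subseteq> B" using r1 r2 by auto
    then show ?thesis using r1 r2 AB(4) by (intro exI[of _ "min r1 r2"]) auto
  qed
  have *: "(\<exists>M. \<forall>\<^sub>F q in nhds (z, w). norm (G q) \<le> M) \<and>
      (\<lambda>\<zeta>. G (\<zeta>, w)) field_differentiable (at z) \<and> (\<lambda>\<omega>. G (z, \<omega>)) field_differentiable (at w)"
    if zw: "(z, w) \<in> S" for z w
  proof -
    obtain r where r: "r > 0" "cball z r \<times> cball w r \<subseteq> S" using box zw by blast
    have cK: "compact (cball z r \<times> cball w r)" by (intro compact_Times compact_cball)
    note u = ul[OF cK r(2)]
    have "continuous_on (cball z r \<times> cball w r) G"
    proof (rule uniform_limit_theorem[OF _ u])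
      show "\<forall>\<^sub>F k in sequentially. continuous_on (cball z r \<times> cball w r) (F k)"
        using r(2) F by (intro always_eventually allI)
          (meson holomorphic2_on_imp_continuous_on continuous_on_subset)
    qed simp
    from compact_imp_bounded[OF compact_continuous_image[OF this cK]]
    obtain M where M: "\<And>q. q \<in> cball z r \<times> cball w r \<Longrightarrow> norm (G q) \<le> M"
      unfolding bounded_iff by blast
    have o: "open (ball z r \<times> ball w r)" by (intro open_Times open_ball)
    have "\<forall>\<^sub>F q in nhds (z, w). q \<in> ball z r \<times> ball w r"
      using eventually_nhds_in_open[OF o] r by auto
    then have 1: "\<forall>\<^sub>F q in nhds (z, w). norm (G q) \<le> M"
      by eventually_elim (use M in auto)
    have uz: "uniform_limit (cball z r) (\<lambda>k \<zeta>. F k (\<zeta>, w)) (\<lambda>\<zeta>. G (\<zeta>, w)) sequentially"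
      by (rule uniform_limit_compose'[OF u, where h = "\<lambda>\<zeta>. (\<zeta>, w)", unfolded comp_def]) (use r in auto)
    have uw: "uniform_limit (cball w r) (\<lambda>k \<omega>. F k (z, \<omega>)) (\<lambda>\<omega>. G (z, \<omega>)) sequentially"
      by (rule uniform_limit_compose'[OF u, where h = "\<lambda>\<omega>. (z, \<omega>)", unfolded comp_def]) (use r in auto)
    have hz: "(\<lambda>\<zeta>. F k (\<zeta>, w)) holomorphic_on cball z r" for k
      by (rule holomorphic2_on_slice(1)[OF F]) (use r in auto)
    have hw: "(\<lambda>\<omega>. F k (z, \<omega>)) holomorphic_on cball w r" for k
      by (rule holomorphic2_on_slice(2)[OF F]) (use r in auto)
    have "(\<lambda>\<zeta>. G (\<zeta>, w)) holomorphic_on ball z r"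
      using holomorphic_uniform_limit[OF always_eventually uz] hz
      by (meson ball_subset_cball holomorphic_on_imp_continuous_on holomorphic_on_subset trivial_limit_sequentially)
    moreover have "(\<lambda>\<omega>. G (z, \<omega>)) holomorphic_on ball w r"
      using holomorphic_uniform_limit[OF always_eventually uw] hw
      by (meson ball_subset_cball holomorphic_on_imp_continuous_on holomorphic_on_subset trivial_limit_sequentially)
    ultimately show ?thesis using 1 r by (auto simp: holomorphic_on_imp_differentiable_at)
  qed
  then have "separately_holomorphic_on G S" unfolding separately_holomorphic_on_def by auto
  then show G: "holomorphic2_on G S" by (simp add: holomorphic2_on_iff_separately S)
  show "(\<lambda>k. dz (dw (F k)) p) \<longlonglongrightarrow> dz (dw G) p" if p: "p \<in> S"
  proof -
    obtain z w where zw: "p = (z, w)" by (cases p)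
    obtain r where r: "r > 0" "cball z r \<times> cball w r \<subseteq> S" using box p zw by blast
    have cK: "compact (cball z r \<times> cball w r)" by (intro compact_Times compact_cball)
    note u = ul[OF cK r(2)]
    have hw: "(\<lambda>\<omega>. H (\<zeta>, \<omega>)) holomorphic_on cball w r"
      if "\<zeta> \<in> cball z r" "holomorphic2_on H S" for H \<zeta>
      by (rule holomorphic2_on_slice(2)[OF that(2)]) (use r that in auto)
    have dwd: "((\<lambda>\<omega>. H (\<zeta>, \<omega>)) has_field_derivative dw H (\<zeta>, w)) (at w)"
      if "\<zeta> \<in> cball z r" "holomorphic2_on H S" for H \<zeta>
      unfolding dw_def using holomorphic2_on_fst_snd(2)[OF that(2), of \<zeta> w] that(1) r
      by (simp add: field_differentiable_derivI subset_iff)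
    have "uniform_limit (ball z r) (\<lambda>k \<zeta>. dw (F k) (\<zeta>, w)) (\<lambda>\<zeta>. dw G (\<zeta>, w)) sequentially"
      unfolding uniform_limit_iff
    proof (intro allI impI)
      fix e :: real assume e: "e > 0"
      have "\<forall>\<^sub>F k in sequentially. \<forall>q\<in>cball z r \<times> cball w r. dist (F k q) (G q) < e * r / 2"
        using uniform_limitD[OF u, of "e * r / 2"] e r by simp
      then show "\<forall>\<^sub>F k in sequentially. \<forall>\<zeta>\<in>ball z r. dist (dw (F k) (\<zeta>, w)) (dw G (\<zeta>, w)) < e"
      proof eventually_elim
        case (elim k)
        show ?case
        proof
          fix \<zeta> assume zt: "\<zeta> \<in> ball z r"
          then have zt': "\<zeta> \<in> cball z r" by simp
          have hd: "(\<lambda>\<omega>. F k (\<zeta>, \<omega>) - G (\<zeta>, \<omega>)) holomorphic_on cball w r"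
            by (intro holomorphic_intros hw zt' F G)
          have "norm ((deriv ^^ 1) (\<lambda>\<omega>. F k (\<zeta>, \<omega>) - G (\<zeta>, \<omega>)) w) \<le> fact 1 * (e * r / 2) / r ^ 1"
          proof (rule Cauchy_inequality)
            show "(\<lambda>\<omega>. F k (\<zeta>, \<omega>) - G (\<zeta>, \<omega>)) holomorphic_on ball w r"
              using hd by (rule holomorphic_on_subset) auto
            show "continuous_on (cball w r) (\<lambda>\<omega>. F k (\<zeta>, \<omega>) - G (\<zeta>, \<omega>))"
              using hd by (rule holomorphic_on_imp_continuous_on)
            show "norm (F k (\<zeta>, x) - G (\<zeta>, x)) \<le> e * r / 2" if "norm (w - x) = r" for x
            proof -
              have "dist (F k (\<zeta>, x)) (G (\<zeta>, x)) < e * r / 2"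
                using elim zt' that by (auto simp: dist_norm)
              then show ?thesis by (simp add: dist_norm)
            qed
          qed (use r in auto)
          moreover have "deriv (\<lambda>\<omega>. F k (\<zeta>, \<omega>) - G (\<zeta>, \<omega>)) w = dw (F k) (\<zeta>, w) - dw G (\<zeta>, w)"
            by (intro DERIV_imp_deriv DERIV_diff dwd zt' F G)
          ultimately have "norm (dw (F k) (\<zeta>, w) - dw G (\<zeta>, w)) \<le> e / 2" using r by simp
          then show "dist (dw (F k) (\<zeta>, w)) (dw G (\<zeta>, w)) < e" using e by (simp add: dist_norm)
        qed
      qed
    qed
    then have "(\<lambda>k. deriv (\<lambda>\<zeta>. dw (F k) (\<zeta>, w)) z) \<longlonglongrightarrow> deriv (\<lambda>\<zeta>. dw G (\<zeta>, w)) z"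
    proof (rule deriv_complex_uniform_limit)
      have "(\<lambda>\<zeta>. dw (F k) (\<zeta>, w)) holomorphic_on ball z r" for k
        by (rule holomorphic2_on_slice(1)[OF holomorphic2_on_dw[OF F S]]) (use r in auto)
      then show "\<forall>\<^sub>F k in sequentially. (\<lambda>\<zeta>. dw (F k) (\<zeta>, w)) holomorphic_on ball z r" by simp
    qed (use r in auto)
    then show ?thesis by (simp add: zw dz_def)
  qed
qed

lemma open_bidisk: "open bidisk"
  unfolding bidisk_def by (intro open_Times open_ball)

lemma mem_bidisk: "(z, w) \<in> bidisk \<longleftrightarrow> norm z < 1 \<and> norm w < 1"
  by (simp add: bidisk_def)

lemma norm_mult_less_one: "(z, w) \<in> bidisk \<Longrightarrow> norm (z * w) < 1"
  unfolding mem_bidisk norm_mult by (metis mult_strict_mono mult_1 norm_ge_zero zero_less_one)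

lemma mem_eigenspace_iff:
  "F \<in> eigenspace lam \<longleftrightarrow> holomorphic2_on F bidisk \<and> (\<forall>p. p \<notin> bidisk \<longrightarrow> F p = 0) \<and>
    (\<forall>z w. (z, w) \<in> bidisk \<longrightarrow> 4 * (1 - z * w)\<^sup>2 * dz (dw F) (z, w) = lam * F (z, w))"
  unfolding eigenspace_def hol_space_def using Delta_zw_eq[of F] by auto

text \<open>The hypothesis on \<open>G\<close> off the bidisk supplies the normalisation in
  \<open>hol_space\<close>, about which convergence on compact subsets of the bidisk says
  nothing.\<close>

lemma eigenspace_limit:
  assumes F: "\<And>k. F k \<in> eigenspace lam"
    and ul: "\<And>K. compact K \<Longrightarrow> K \<subseteq> bidisk \<Longrightarrow> uniform_limit K F G sequentially"
    and G: "\<And>p. p \<notin> bidisk \<Longrightarrow> G p = 0"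
  shows "G \<in> eigenspace lam"
  unfolding mem_eigenspace_iff
proof (intro conjI allI impI)
  have hF: "holomorphic2_on (F k) bidisk" for k using F by (simp add: mem_eigenspace_iff)
  show "holomorphic2_on G bidisk"
    by (rule holomorphic2_on_uniform_limit(1)[OF open_bidisk hF ul])
  fix z w assume p: "(z, w) \<in> bidisk"
  have "(\<lambda>k. F k (z, w)) \<longlonglongrightarrow> G (z, w)"
    using tendsto_uniform_limitI[OF ul[of "{(z, w)}"], of "(z, w)"] p by simp
  then have 1: "(\<lambda>k. lam * F k (z, w)) \<longlonglongrightarrow> lam * G (z, w)" by (intro tendsto_intros)
  have "(\<lambda>k. dz (dw (F k)) (z, w)) \<longlonglongrightarrow> dz (dw G) (z, w)"
    by (rule holomorphic2_on_uniform_limit(2)[OF open_bidisk hF ul p])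
  then have 2: "(\<lambda>k. 4 * (1 - z * w)\<^sup>2 * dz (dw (F k)) (z, w)) \<longlonglongrightarrow> 4 * (1 - z * w)\<^sup>2 * dz (dw G) (z, w)"
    by (intro tendsto_intros)
  have "4 * (1 - z * w)\<^sup>2 * dz (dw (F k)) (z, w) = lam * F k (z, w)" for k
    using F p by (simp add: mem_eigenspace_iff)
  with 1 2 show "4 * (1 - z * w)\<^sup>2 * dz (dw G) (z, w) = lam * G (z, w)"
    using LIMSEQ_unique by simp
qed (use G in auto)

text \<open>The one-variable identity theorem twice: in the first variable for each small value of
  the second, then in the second variable for arbitrary z.\<close>

lemma bidisk_identity:
  assumes F: "holomorphic2_on F bidisk" and r: "r > 0" "r \<le> 1"
    and z: "\<And>z w. norm z < r \<Longrightarrow> norm w < r \<Longrightarrow> F (z, w) = 0"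
    and p: "(z, w) \<in> bidisk"
  shows "F (z, w) = 0"
proof -
  have 1: "F (x, y) = 0" if y: "norm y < r" and x: "norm x < 1" for x y
  proof (rule analytic_continuation_open[of "ball 0 r" "ball 0 1" "\<lambda>x. F (x, y)" "\<lambda>_. 0"])
    show "(\<lambda>x. F (x, y)) holomorphic_on ball 0 1"
      by (rule holomorphic2_on_slice(1)[OF F]) (use y r in \<open>auto simp: mem_bidisk\<close>)
  qed (use z r x y in auto)
  have "(\<lambda>y. F (z, y)) holomorphic_on ball 0 1"
    by (rule holomorphic2_on_slice(2)[OF F]) (use p in \<open>auto simp: mem_bidisk\<close>)
  then show ?thesis
    using analytic_continuation_open[of "ball 0 r" "ball 0 1" "\<lambda>y. F (z, y)" "\<lambda>_. 0" w] 1 r p subset_ball[OF r(2), of 0]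
    by (auto simp: mem_bidisk)
qed

text \<open>A function with vanishing characteristic data satisfies \<open>\<bar>F\<bar> \<le> c r\<^sup>2 sup \<bar>F\<bar>\<close> on the bidisk
  of radius \<open>r\<close> by integrating the equation twice, hence vanishes for small \<open>r\<close>.\<close>

lemma eigenspace_zero:
  assumes F: "F \<in> eigenspace lam"
    and Fz: "\<And>z. norm z < 1 \<Longrightarrow> F (z, 0) = 0" and Fw: "\<And>w. norm w < 1 \<Longrightarrow> F (0, w) = 0"
  shows "F = (\<lambda>_. 0)"
proof -
  have hF: "holomorphic2_on F bidisk"
    and eq: "\<And>z w. (z, w) \<in> bidisk \<Longrightarrow> 4 * (1 - z * w)\<^sup>2 * dz (dw F) (z, w) = lam * F (z, w)"
    using F by (auto simp: mem_eigenspace_iff)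
  define L where "L = norm lam"
  \<comment> \<open>\<open>L * r\<close> at most 1/2 makes the final estimate M \<le> L r M force M
    = 0; r at most 1/2 keeps |1 - zw| above 3/4, so that the factor 4 |1 - zw|^2 is at least
    1.\<close>
  define r where "r = 1 / (2 * (1 + L))"
  have L: "L \<ge> 0" by (simp add: L_def)
  have r: "r > 0" "r \<le> 1 / 2" "L * r \<le> 1/2" using L by (auto simp: r_def field_simps)
  let ?K = "cball (0::complex) r \<times> cball (0::complex) r"
  have sub: "?K \<subseteq> bidisk" using r by (auto simp: mem_bidisk)
  have "continuous_on ?K F"
    using holomorphic2_on_imp_continuous_on[OF hF] sub continuous_on_subset by blast
  then have "continuous_on ?K (\<lambda>p. norm (F p))" by (intro continuous_intros)
  moreover have "compact ?K" by (intro compact_Times compact_cball)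
  moreover have "?K \<noteq> {}" using r by auto
  ultimately obtain p where p: "p \<in> ?K" "\<And>q. q \<in> ?K \<Longrightarrow> norm (F q) \<le> norm (F p)"
    using continuous_attains_sup[of ?K "\<lambda>p. norm (F p)"] by blast
  define M where "M = norm (F p)"
  have M: "norm (F (z, w)) \<le> M" if "norm z \<le> r" "norm w \<le> r" for z w
    unfolding M_def by (rule p(2)) (use that in auto)
  have M0: "M \<ge> 0" by (simp add: M_def)
  have d2: "norm (dz (dw F) (z, w)) \<le> L * M" if zw: "norm z \<le> r" "norm w \<le> r" for z w
  proof -
    have b: "(z, w) \<in> bidisk" using zw r by (auto simp: mem_bidisk)
    have "norm (z * w) \<le> 1/2 * (1/2)" unfolding norm_mult by (intro mult_mono) (use zw r in auto)
    then have "3/4 \<le> norm (1 - z * w)" using norm_triangle_ineq2[of 1 "z * w"] by simp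
    then have "(3/4)\<^sup>2 \<le> norm (1 - z * w) ^ 2" by (intro power_mono) auto
    then have "1 \<le> 4 * norm (1 - z * w) ^ 2" by (simp add: power2_eq_square)
    then have "norm (dz (dw F) (z, w)) \<le> norm (dz (dw F) (z, w)) * (4 * norm (1 - z * w) ^ 2)"
      by (simp add: mult_le_cancel_left1)
    also have "\<dots> = norm (4 * (1 - z * w)\<^sup>2 * dz (dw F) (z, w))"
      by (simp add: norm_mult norm_power)
    also have "\<dots> = L * norm (F (z, w))" by (simp add: eq[OF b] norm_mult L_def)
    also have "\<dots> \<le> L * M" by (intro mult_left_mono M zw L)
    finally show ?thesis .
  qed
  have d1: "norm (dw F (z, w)) \<le> L * M" if zw: "norm z \<le> r" "norm w \<le> r" for z w
  proof -
    have "dw F (0, w) = deriv (\<lambda>_. 0) w"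
      unfolding dw_def prod.case
    proof (rule deriv_cong_ev)
      have "\<forall>\<^sub>F x in nhds w. x \<in> ball 0 1" using eventually_nhds_in_open[of "ball 0 1" w] zw r by auto
      then show "\<forall>\<^sub>F x in nhds w. F (0, x) = 0" by eventually_elim (use Fw in auto)
    qed simp
    then have 0: "dw F (0, w) = 0" by simp
    have "norm (dw F (z, w) - dw F (0, w)) \<le> (L * M) * norm (z - 0)"
    proof (rule field_differentiable_bound[of "cball 0 r"])
      fix x :: complex assume x: "x \<in> cball 0 r"
      have "(\<lambda>\<zeta>. dw F (\<zeta>, w)) field_differentiable at x"
        by (rule holomorphic2_on_fst_snd(1)[OF holomorphic2_on_dw[OF hF open_bidisk]])
          (use x zw r in \<open>auto simp: mem_bidisk\<close>)
      then show "((\<lambda>\<zeta>. dw F (\<zeta>, w)) has_field_derivative dz (dw F) (x, w)) (at x within cball 0 r)"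
        unfolding dz_def by (simp add: field_differentiable_derivI has_field_derivative_at_within)
      show "norm (dz (dw F) (x, w)) \<le> L * M" by (rule d2) (use x zw in auto)
    qed (use zw r in auto)
    \<comment> \<open>The length of the path in z is estimated by 1 only; the factor r gained from
      the integration in w is enough for the contraction.\<close>
    also have "\<dots> \<le> L * M * 1" using zw r L M0 by (intro mult_left_mono) auto
    finally show ?thesis by (simp add: 0)
  qed
  have "norm (F (z, w)) \<le> L * M * r" if zw: "norm z \<le> r" "norm w \<le> r" for z w
  proof -
    have "norm (F (z, w) - F (z, 0)) \<le> (L * M) * norm (w - 0)"
    proof (rule field_differentiable_bound[of "cball 0 r"])
      fix x :: complex assume x: "x \<in> cball 0 r"
      have "(\<lambda>\<omega>. F (z, \<omega>)) field_differentiable at x"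
        by (rule holomorphic2_on_fst_snd(2)[OF hF])
          (use x zw r in \<open>auto simp: mem_bidisk\<close>)
      then show "((\<lambda>\<omega>. F (z, \<omega>)) has_field_derivative dw F (z, x)) (at x within cball 0 r)"
        unfolding dw_def by (simp add: field_differentiable_derivI has_field_derivative_at_within)
      show "norm (dw F (z, x)) \<le> L * M" by (rule d1) (use x zw in auto)
    qed (use zw r in auto)
    also have "\<dots> \<le> L * M * r" using zw r L M0 by (intro mult_left_mono) auto
    finally show ?thesis using Fz[of z] zw r by simp
  qed
  from this[of "fst p" "snd p"] p(1) have "M \<le> (L * r) * M" by (auto simp: M_def algebra_simps)
  also have "\<dots> \<le> 1/2 * M" using r M0 by (intro mult_right_mono) auto
  finally have "M = 0" using M0 by simp
  then have "F (z, w) = 0" if "norm z < r" "norm w < r" for z w using M[of z w] that by simp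
  then have "F (z, w) = 0" if "(z, w) \<in> bidisk" for z w
    using bidisk_identity[OF hF r(1)] r that by simp
  moreover have "F p = 0" if "p \<notin> bidisk" for p using F that unfolding mem_eigenspace_iff by blast
  ultimately show ?thesis by (metis ext surj_pair)
qed

section \<open>Radial solutions and Frobenius' method\<close>

lemma holomorphic2_onD:
  assumes "holomorphic2_on F S" "p \<in> S"
  obtains a b where "(F has_derivative (\<lambda>h. a * fst h + b * snd h)) (at p)"
  using assms unfolding holomorphic2_on_def case_prod_unfold by blast

lemma holomorphic2_onI:
  assumes "\<And>p. p \<in> S \<Longrightarrow> \<exists>a b. (F has_derivative (\<lambda>h. a * fst h + b * snd h)) (at p)"
  shows "holomorphic2_on F S"
  using assms unfolding holomorphic2_on_def case_prod_unfold by blast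

lemma holomorphic2_on_const: "holomorphic2_on (\<lambda>_. c) S"
  by (rule holomorphic2_onI, rule exI[of _ 0], rule exI[of _ 0]) simp

lemma holomorphic2_on_fst: "holomorphic2_on fst S"
  by (rule holomorphic2_onI, rule exI[of _ 1], rule exI[of _ 0])
    (simp add: bounded_linear_fst bounded_linear_imp_has_derivative)

lemma holomorphic2_on_snd: "holomorphic2_on snd S"
  by (rule holomorphic2_onI, rule exI[of _ 0], rule exI[of _ 1])
    (simp add: bounded_linear_snd bounded_linear_imp_has_derivative)

lemma holomorphic2_on_add:
  assumes "holomorphic2_on F S" "holomorphic2_on G S"
  shows "holomorphic2_on (\<lambda>p. F p + G p) S"
proof (rule holomorphic2_onI)
  fix p assume p: "p \<in> S"
  obtain a b where F: "(F has_derivative (\<lambda>h. a * fst h + b * snd h)) (at p)"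
    using holomorphic2_onD[OF assms(1) p] .
  obtain c d where G: "(G has_derivative (\<lambda>h. c * fst h + d * snd h)) (at p)"
    using holomorphic2_onD[OF assms(2) p] .
  have "((\<lambda>p. F p + G p) has_derivative (\<lambda>h. (a + c) * fst h + (b + d) * snd h)) (at p)"
    using has_derivative_add[OF F G] by (simp add: algebra_simps)
  then show "\<exists>a b. ((\<lambda>p. F p + G p) has_derivative (\<lambda>h. a * fst h + b * snd h)) (at p)" by blast
qed

lemma holomorphic2_on_mult:
  assumes "holomorphic2_on F S" "holomorphic2_on G S"
  shows "holomorphic2_on (\<lambda>p. F p * G p) S"
proof (rule holomorphic2_onI)
  fix p assume p: "p \<in> S"
  obtain a b where F: "(F has_derivative (\<lambda>h. a * fst h + b * snd h)) (at p)"
    using holomorphic2_onD[OF assms(1) p] .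
  obtain c d where G: "(G has_derivative (\<lambda>h. c * fst h + d * snd h)) (at p)"
    using holomorphic2_onD[OF assms(2) p] .
  have "((\<lambda>p. F p * G p) has_derivative
      (\<lambda>h. (F p * c + a * G p) * fst h + (F p * d + b * G p) * snd h)) (at p)"
    using has_derivative_mult[OF F G] by (simp add: algebra_simps)
  then show "\<exists>a b. ((\<lambda>p. F p * G p) has_derivative (\<lambda>h. a * fst h + b * snd h)) (at p)" by blast
qed

lemma holomorphic2_on_compose:
  assumes "holomorphic2_on F S" "f holomorphic_on U" "open U" "\<And>p. p \<in> S \<Longrightarrow> F p \<in> U"
  shows "holomorphic2_on (\<lambda>p. f (F p)) S"
proof (rule holomorphic2_onI)
  fix p assume p: "p \<in> S"
  obtain a b where F: "(F has_derivative (\<lambda>h. a * fst h + b * snd h)) (at p)"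
    using holomorphic2_onD[OF assms(1) p] .
  have "(f has_field_derivative deriv f (F p)) (at (F p))"
    by (rule holomorphic_derivI[OF assms(2,3) assms(4)[OF p]])
  then have "(f has_derivative (*) (deriv f (F p))) (at (F p))" by (simp add: has_field_derivative_def)
  from has_derivative_compose[OF F this]
  have "((\<lambda>p. f (F p)) has_derivative (\<lambda>h. (deriv f (F p) * a) * fst h + (deriv f (F p) * b) * snd h)) (at p)"
    by (simp add: algebra_simps)
  then show "\<exists>a b. ((\<lambda>p. f (F p)) has_derivative (\<lambda>h. a * fst h + b * snd h)) (at p)" by blast
qed

lemma holomorphic2_on_cmult: "holomorphic2_on F S \<Longrightarrow> holomorphic2_on (\<lambda>p. c * F p) S"
  by (intro holomorphic2_on_mult holomorphic2_on_const)

lemma holomorphic2_on_power: "holomorphic2_on F S \<Longrightarrow> holomorphic2_on (\<lambda>p. F p ^ n) S"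
  by (rule holomorphic2_on_compose[of F S "\<lambda>x. x ^ n" UNIV]) (auto intro!: holomorphic_intros)

lemma holomorphic2_on_diff:
  "holomorphic2_on F S \<Longrightarrow> holomorphic2_on G S \<Longrightarrow> holomorphic2_on (\<lambda>p. F p - G p) S"
  using holomorphic2_on_add[of F S "\<lambda>p. (-1) * G p"] holomorphic2_on_cmult[of G S "-1"] by simp

lemma holomorphic2_on_divide:
  assumes "holomorphic2_on F S" "holomorphic2_on G S" "\<And>p. p \<in> S \<Longrightarrow> G p \<noteq> 0"
  shows "holomorphic2_on (\<lambda>p. F p / G p) S"
  unfolding divide_inverse
  by (intro holomorphic2_on_mult assms(1) holomorphic2_on_compose[OF assms(2), of inverse "- {0}"])
    (use assms(3) in \<open>auto intro!: holomorphic_intros\<close>)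

lemma holomorphic2_on_sum:
  "(\<And>i. i \<in> I \<Longrightarrow> holomorphic2_on (F i) S) \<Longrightarrow> holomorphic2_on (\<lambda>p. \<Sum>i\<in>I. F i p) S"
  by (induction I rule: infinite_finite_induct)
    (simp_all add: holomorphic2_on_const holomorphic2_on_add)

lemmas holomorphic2_intros = holomorphic2_on_const holomorphic2_on_fst holomorphic2_on_snd
  holomorphic2_on_add holomorphic2_on_diff holomorphic2_on_mult holomorphic2_on_power
  holomorphic2_on_divide holomorphic2_on_sum

lemma holomorphic2_on_subset: "holomorphic2_on F S \<Longrightarrow> T \<subseteq> S \<Longrightarrow> holomorphic2_on F T"
  unfolding holomorphic2_on_def by blast

text \<open>Derivatives look at full neighbourhoods, and \<open>S\<close> is not assumed open; so
  the agreement is demanded on an open \<open>U\<close> around it. This serves for the chart domains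
  of subsets of the sphere product.\<close>

lemma holomorphic2_on_cong_superset:
  assumes U: "open U" "S \<subseteq> U" and F: "holomorphic2_on F S" "\<And>p. p \<in> U \<Longrightarrow> F p = G p"
  shows "holomorphic2_on G S"
  unfolding holomorphic2_on_def
proof
  fix p assume p: "p \<in> S"
  obtain a b where "(F has_derivative (\<lambda>(h, k). a * h + b * k)) (at p)"
    using F p unfolding holomorphic2_on_def by blast
  then have "(G has_derivative (\<lambda>(h, k). a * h + b * k)) (at p)"
    by (rule has_derivative_transform_within_open[OF _ U(1)]) (use p U F in auto)
  then show "\<exists>a b. (G has_derivative (\<lambda>(h, k). a * h + b * k)) (at p)" by blast
qed

lemma holomorphic2_on_cong:
  "open S \<Longrightarrow> holomorphic2_on F S \<Longrightarrow> (\<And>p. p \<in> S \<Longrightarrow> F p = G p) \<Longrightarrow> holomorphic2_on G S"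
  using holomorphic2_on_cong_superset[OF _ subset_refl] .

lemma holomorphic2_on_map:
  assumes G: "holomorphic2_on G T" and ab: "holomorphic2_on a S" "holomorphic2_on b S"
    and T: "\<And>p. p \<in> S \<Longrightarrow> (a p, b p) \<in> T"
  shows "holomorphic2_on (\<lambda>p. G (a p, b p)) S"
proof (rule holomorphic2_onI)
  fix p assume p: "p \<in> S"
  obtain a1 a2 where A: "(a has_derivative (\<lambda>h. a1 * fst h + a2 * snd h)) (at p)"
    using holomorphic2_onD[OF ab(1) p] .
  obtain b1 b2 where B: "(b has_derivative (\<lambda>h. b1 * fst h + b2 * snd h)) (at p)"
    using holomorphic2_onD[OF ab(2) p] .
  obtain c d where C: "(G has_derivative (\<lambda>h. c * fst h + d * snd h)) (at (a p, b p))"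
    using holomorphic2_onD[OF G T[OF p]] .
  have "((\<lambda>p. G (a p, b p)) has_derivative
      (\<lambda>h. (c * a1 + d * b1) * fst h + (c * a2 + d * b2) * snd h)) (at p)"
    using has_derivative_compose[OF has_derivative_Pair[OF A B] C] by (simp add: algebra_simps)
  then show "\<exists>c d. ((\<lambda>p. G (a p, b p)) has_derivative (\<lambda>h. c * fst h + d * snd h)) (at p)" by blast
qed

section \<open>The radial equation and its power series solutions\<close>

definition radial_ode :: "complex \<Rightarrow> nat \<Rightarrow> (complex \<Rightarrow> complex) \<Rightarrow> complex set \<Rightarrow> bool"
  where "radial_ode mu n f S \<longleftrightarrow> f holomorphic_on S \<and>
    (\<forall>t\<in>S. (1 - t)\<^sup>2 * (t * deriv (deriv f) t + of_nat (Suc n) * deriv f t) = mu * f t)"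

definition weight_fun :: "nat \<Rightarrow> (complex \<Rightarrow> complex) \<Rightarrow> complex \<times> complex \<Rightarrow> complex"
  where "weight_fun n f = (\<lambda>(z, w). if (z, w) \<in> bidisk then z ^ n * f (z * w) else 0)"

text \<open>With t = zw, \<open>dw\<close> of z^n f(t) is z^(n+1) f'(t), and applying
  \<open>dz\<close> to this yields z^n (t f'' + (n+1) f'). The factor 4 of \<open>Delta_zw\<close>
  accounts for \<open>4 * mu\<close>.\<close>

lemma weight_fun_eigenspace:
  assumes f: "radial_ode mu n f (ball 0 1)"
  shows "weight_fun n f \<in> eigenspace (4 * mu)"
  unfolding mem_eigenspace_iff
proof (intro conjI allI impI)
  have hf: "f holomorphic_on ball 0 1" using f by (simp add: radial_ode_def)
  have in1: "z * w \<in> ball 0 1" if "(z, w) \<in> bidisk" for z w using norm_mult_less_one[OF that] by simp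
  have ball1: "norm z < 1" "norm w < 1" if "(z, w) \<in> bidisk" for z w using that by (auto simp: mem_bidisk)
  have "holomorphic2_on (\<lambda>p. fst p ^ n * f (fst p * snd p)) bidisk"
  proof (intro holomorphic2_intros holomorphic2_on_compose[of "\<lambda>p. fst p * snd p" _ f "ball 0 1"] hf)
    show "fst p * snd p \<in> ball 0 1" if "p \<in> bidisk" for p using in1[of "fst p" "snd p"] that by simp
  qed auto
  then show "holomorphic2_on (weight_fun n f) bidisk"
    by (rule holomorphic2_on_cong[OF open_bidisk]) (auto simp: weight_fun_def)
  have fd: "(f has_field_derivative deriv f t) (at t)" "(deriv f has_field_derivative deriv (deriv f) t) (at t)"
    if "t \<in> ball 0 1" for t
    using holomorphic_derivI[OF hf _ that] holomorphic_derivI[OF holomorphic_deriv[OF hf] _ that] by auto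
  have d1: "dw (weight_fun n f) (z, w) = z ^ Suc n * deriv f (z * w)" if p: "(z, w) \<in> bidisk" for z w
  proof -
    have "((\<lambda>\<omega>. z ^ n * f (z * \<omega>)) has_field_derivative z ^ Suc n * deriv f (z * w)) (at w)"
      using DERIV_cmult[OF DERIV_chain2[OF fd(1)[OF in1[OF p]] DERIV_cmult_Id], of "z ^ n"]
      by (simp add: mult_ac)
    then have "((\<lambda>\<omega>. weight_fun n f (z, \<omega>)) has_field_derivative z ^ Suc n * deriv f (z * w)) (at w)"
      by (rule has_field_derivative_transform_within_open[of _ _ _ "ball 0 1"])
        (use ball1[OF p] in \<open>auto simp: weight_fun_def mem_bidisk\<close>)
    then show ?thesis unfolding dw_def by (auto intro: DERIV_imp_deriv)
  qed
  fix z w assume p: "(z, w) \<in> bidisk"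
  define t where "t = z * w"
  have "((\<lambda>\<zeta>. \<zeta> ^ Suc n * deriv f (\<zeta> * w)) has_field_derivative
      (of_nat (Suc n) * z ^ n * deriv f t + z ^ Suc n * (deriv (deriv f) t * w))) (at z)"
  proof -
    have "((\<lambda>\<zeta>. \<zeta> ^ Suc n) has_field_derivative of_nat (Suc n) * z ^ n) (at z)"
      using DERIV_power_Suc[OF DERIV_ident, of n z UNIV] by (simp add: mult_ac)
    from DERIV_mult[OF this DERIV_chain2[OF fd(2)[OF in1[OF p]] DERIV_cmult_right[OF DERIV_ident]]]
    show ?thesis by (simp add: t_def mult_ac add_ac)
  qed
  then have "((\<lambda>\<zeta>. dw (weight_fun n f) (\<zeta>, w)) has_field_derivative
      (of_nat (Suc n) * z ^ n * deriv f t + z ^ Suc n * (deriv (deriv f) t * w))) (at z)"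
    by (rule has_field_derivative_transform_within_open[of _ _ _ "ball 0 1"])
      (use ball1[OF p] in \<open>auto simp: d1 mem_bidisk\<close>)
  then have "dz (dw (weight_fun n f)) (z, w) = of_nat (Suc n) * z ^ n * deriv f t + z ^ Suc n * (deriv (deriv f) t * w)"
    unfolding dz_def by (auto intro: DERIV_imp_deriv)
  also have "\<dots> = z ^ n * (t * deriv (deriv f) t + of_nat (Suc n) * deriv f t)"
    by (simp add: t_def algebra_simps)
  finally have "4 * (1 - z * w)\<^sup>2 * dz (dw (weight_fun n f)) (z, w)
      = 4 * z ^ n * ((1 - t)\<^sup>2 * (t * deriv (deriv f) t + of_nat (Suc n) * deriv f t))"
    by (simp add: t_def mult_ac)
  also have "\<dots> = 4 * z ^ n * (mu * f t)"
    using f in1[OF p] unfolding radial_ode_def t_def by auto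
  finally show "4 * (1 - z * w)\<^sup>2 * dz (dw (weight_fun n f)) (z, w) = 4 * mu * weight_fun n f (z, w)"
    using p by (simp add: weight_fun_def t_def)
qed (auto simp: weight_fun_def)

text \<open>Frobenius' method for \<open>x y'' + P y' = Q y\<close> with \<open>P 0 = n + 1\<close> and \<open>y 0 = 1\<close>.\<close>

fun frobenius :: "nat \<Rightarrow> (nat \<Rightarrow> complex) \<Rightarrow> (nat \<Rightarrow> complex) \<Rightarrow> nat \<Rightarrow> complex" where
  "frobenius n P Q 0 = 1"
| "frobenius n P Q (Suc k) =
    (\<Sum>j\<le>k. (Q (k - j) - of_nat j * P (Suc k - j)) * frobenius n P Q j) / (of_nat (Suc k) * of_nat (Suc k + n))"

declare frobenius.simps(2) [simp del]

text \<open>The quotient of consecutive values is 1 + L/(k+1), exactly the growth factor of the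
  partial sums in the majorant argument for the Frobenius coefficients.\<close>

lemma binomial_shift:
  "real (Suc k) * real ((Suc k + L) choose L) = real (Suc k + L) * real ((k + L) choose L)"
proof -
  have "Suc (k + L) * ((k + L) choose k) = (Suc (k + L) choose Suc k) * Suc k"
    by (rule Suc_times_binomial_eq)
  moreover have "(Suc (k + L)) choose (Suc k) = (Suc k + L) choose L"
    using binomial_symmetric[of "Suc k" "Suc k + L"] by simp
  moreover have "(k + L) choose k = (k + L) choose L"
    using binomial_symmetric[of k "k + L"] by simp
  ultimately have "Suc k * ((Suc k + L) choose L) = (Suc k + L) * ((k + L) choose L)"
    by (metis add_Suc mult.commute)
  then show ?thesis by (simp only: of_nat_mult[symmetric])
qed

text \<open>Partial sums are estimated instead of single coefficients: the recursion bounds the next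
  coefficient by L/(k+1) times the sum S of the norms of the previous ones, so S grows by at most
  the factor 1 + L/(k+1). The denominator k+1+n is only bounded below by k+1, which makes the bound
  independent of n for given A and B.\<close>

lemma frobenius_bound:
  assumes P: "\<And>i. i \<ge> 1 \<Longrightarrow> norm (P i) \<le> A" and Q: "\<And>i. norm (Q i) \<le> B * (real i + 1)"
    and AB: "A \<ge> 0" "B \<ge> 0" "A + B \<le> real L"
  shows "(\<Sum>j\<le>k. norm (frobenius n P Q j)) \<le> real ((k + L) choose L)"
proof (induction k)
  case (Suc k)
  let ?b = "frobenius n P Q"
  define S where "S = (\<Sum>j\<le>k. norm (?b j))"
  have S0: "S \<ge> 0" by (simp add: S_def sum_nonneg)
  have "norm (\<Sum>j\<le>k. (Q (k - j) - of_nat j * P (Suc k - j)) * ?b j) \<le> (\<Sum>j\<le>k. (real L * (real k + 1)) * norm (?b j))"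
  proof (intro order_trans[OF norm_sum] sum_mono)
    fix j assume j: "j \<in> {..k}"
    have "norm (Q (k - j) - of_nat j * P (Suc k - j)) \<le> norm (Q (k - j)) + norm (of_nat j * P (Suc k - j))"
      by (rule norm_triangle_ineq4)
    also have "\<dots> \<le> B * (real (k - j) + 1) + real j * A"
      unfolding norm_mult norm_of_nat by (intro add_mono Q mult_left_mono P) (use j in auto)
    also have "\<dots> \<le> B * (real k + 1) + (real k + 1) * A"
      by (intro add_mono mult_left_mono mult_right_mono) (use j AB in auto)
    also have "\<dots> = (A + B) * (real k + 1)" by (simp add: algebra_simps)
    also have "\<dots> \<le> real L * (real k + 1)" by (intro mult_right_mono AB) auto
    finally show "norm ((Q (k - j) - of_nat j * P (Suc k - j)) * ?b j) \<le> real L * (real k + 1) * norm (?b j)"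
      unfolding norm_mult by (rule mult_right_mono) auto
  qed
  also have "\<dots> = real L * (real k + 1) * S" by (simp add: S_def sum_distrib_left)
  finally have *: "norm (\<Sum>j\<le>k. (Q (k - j) - of_nat j * P (Suc k - j)) * ?b j) \<le> real L * (real k + 1) * S" .
  have "norm (?b (Suc k)) = norm (\<Sum>j\<le>k. (Q (k - j) - of_nat j * P (Suc k - j)) * ?b j) / (real (Suc k) * real (Suc k + n))"
    unfolding frobenius.simps norm_divide norm_mult norm_of_nat ..
  also have "\<dots> \<le> real L * (real k + 1) * S / (real (Suc k) * real (Suc k + n))"
    by (intro divide_right_mono *) auto
  also have "\<dots> = real L * S / real (Suc k + n)"
    by (simp add: mult.assoc mult.left_commute[of _ "real (Suc k)"] del: of_nat_add) (simp add: add.commute mult_ac)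
  also have "\<dots> \<le> real L * S / real (Suc k)" using S0 by (intro divide_left_mono) auto
  finally have b: "norm (?b (Suc k)) \<le> real L * S / real (Suc k)" .
  have "(\<Sum>j\<le>Suc k. norm (?b j)) \<le> S + real L * S / real (Suc k)" using b by (simp add: S_def)
  also have "\<dots> = S * (1 + real L / real (Suc k))" by (simp add: field_simps)
  also have "\<dots> \<le> real ((k + L) choose L) * (1 + real L / real (Suc k))"
    using Suc.IH by (intro mult_right_mono) (auto simp: S_def)
  also have "\<dots> = real ((Suc k + L) choose L)"
    using binomial_shift[of k L] by (simp add: field_simps del: binomial_Suc_Suc)
  finally show ?case .
qed simp

lemma summable_binomial_power:
  assumes "0 \<le> x" "x < 1"
  shows "summable (\<lambda>k. real ((k + L) choose L) * x ^ k)"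
proof -
  define c where "c = (1 + x) / 2"
  have c: "c < 1" "x < c" using assms by (auto simp: c_def)
  \<comment> \<open>From this N on, the ratio (1 + L/(k+1)) x of consecutive terms is at most c, the
    midpoint of x and 1.\<close>
  obtain N where N: "real N > real L * x / (c - x)" using reals_Archimedean2 by blast
  show ?thesis
  proof (rule summable_ratio_test[of c N])
    fix k assume k: "k \<ge> N"
    note e = binomial_shift[of k L]
    have "real L * x / (c - x) \<le> real (Suc k)" using N k by simp
    then have 1: "real (Suc k + L) * x \<le> c * real (Suc k)" using c by (simp add: field_simps)
    define a b where "a = real ((Suc k + L) choose L)" and "b = real ((k + L) choose L)"
    from 1 have "real (Suc k + L) * x * (b * x ^ k) \<le> c * real (Suc k) * (b * x ^ k)"
      using assms by (intro mult_right_mono) (auto simp: b_def)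
    moreover have "real (Suc k + L) * x * (b * x ^ k) = real (Suc k) * a * x ^ Suc k"
      unfolding e[folded a_def b_def] by simp
    ultimately have "real (Suc k) * (a * x ^ Suc k) \<le> real (Suc k) * (c * (b * x ^ k))"
      by (simp only: mult_ac)
    then have "a * x ^ Suc k \<le> c * (b * x ^ k)"
      by (rule mult_left_le_imp_le) simp
    moreover have "0 \<le> a * x ^ Suc k" "0 \<le> b * x ^ k" using assms by (auto simp: a_def b_def)
    ultimately have "norm (a * x ^ Suc k) \<le> c * norm (b * x ^ k)"
      by (simp only: real_norm_def abs_of_nonneg)
    then show "norm (real ((Suc k + L) choose L) * x ^ Suc k) \<le> c * norm (real ((k + L) choose L) * x ^ k)"
      unfolding a_def b_def .
  qed (rule c)
qed

lemma frobenius_fps: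
  assumes P: "\<And>i. i \<ge> 1 \<Longrightarrow> norm (P i) \<le> A" and Q: "\<And>i. norm (Q i) \<le> B * (real i + 1)"
    and AB: "A \<ge> 0" "B \<ge> 0" "A + B \<le> real L" and P0: "P 0 = of_nat (Suc n)"
  defines "F \<equiv> Abs_fps (frobenius n P Q)"
  shows "fps_conv_radius F \<ge> 1"
    and "fps_X * fps_deriv (fps_deriv F) + Abs_fps P * fps_deriv F = Abs_fps Q * F"
    and "norm t \<le> r \<Longrightarrow> r < 1 \<Longrightarrow> norm (eval_fps F t) \<le> (\<Sum>k. real ((k + L) choose L) * r ^ k)"
proof -
  let ?b = "frobenius n P Q"
  have b: "norm (?b k) \<le> real ((k + L) choose L)" for k
  proof -
    have "norm (?b k) \<le> (\<Sum>j\<le>k. norm (?b j))" by (rule member_le_sum) auto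
    also have "\<dots> \<le> real ((k + L) choose L)" by (rule frobenius_bound[OF P Q AB])
    finally show ?thesis .
  qed
  have sm: "summable (\<lambda>k. norm (?b k * t ^ k))" if "norm t < 1" for t :: complex
  proof (rule summable_comparison_test'[OF summable_binomial_power[of "norm t" L]])
    show "norm (norm (?b k * t ^ k)) \<le> real ((k + L) choose L) * norm t ^ k" for k
      using b[of k] by (simp add: norm_mult norm_power mult_right_mono)
  qed (use that in auto)
  show "fps_conv_radius F \<ge> 1"
    unfolding fps_conv_radius_def F_def fps_nth_Abs_fps
  proof (rule conv_radius_geI_ex')
    fix r :: real assume "0 < r" "ereal r < 1"
    then show "summable (\<lambda>n. ?b n * of_real r ^ n)"
      using sm[of "of_real r"] by (auto intro: summable_norm_cancel)
  qed
  show "norm (eval_fps F t) \<le> (\<Sum>k. real ((k + L) choose L) * r ^ k)" if t: "norm t \<le> r" "r < 1" for t r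
  proof -
    have r: "0 \<le> r" using t(1) norm_ge_zero order_trans by blast
    have "norm (\<Sum>k. ?b k * t ^ k) \<le> (\<Sum>k. norm (?b k * t ^ k))"
      by (rule summable_norm[OF sm]) (use t in simp)
    also have "\<dots> \<le> (\<Sum>k. real ((k + L) choose L) * r ^ k)"
    proof (rule suminf_le[OF _ sm summable_binomial_power])
      show "norm (?b k * t ^ k) \<le> real ((k + L) choose L) * r ^ k" for k
        unfolding norm_mult norm_power by (intro mult_mono b power_mono) (use t in auto)
    qed (use t r in auto)
    finally show ?thesis by (simp add: eval_fps_def F_def)
  qed
  show "fps_X * fps_deriv (fps_deriv F) + Abs_fps P * fps_deriv F = Abs_fps Q * F"
  proof (rule fps_ext)
    fix k
    have 1: "fps_nth (fps_X * fps_deriv (fps_deriv F)) k = of_nat k * (of_nat (Suc k) * ?b (Suc k))"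
      by (cases k) (simp_all add: F_def mult_ac)
    have "fps_nth (Abs_fps P * fps_deriv F) k = (\<Sum>i=0..k. P i * (of_nat (Suc (k - i)) * ?b (Suc (k - i))))"
      by (simp add: fps_mult_nth F_def)
    also have "\<dots> = (\<Sum>i=0..k. P (k - i) * (of_nat (Suc i) * ?b (Suc i)))"
      by (subst sum.atLeastAtMost_rev) (rule sum.cong, auto)
    also have "\<dots> = (\<Sum>i\<le>k. P (Suc k - Suc i) * (of_nat (Suc i) * ?b (Suc i)))"
      by (simp add: atLeast0AtMost)
    \<comment> \<open>The added term j = 0 is zero because of its factor j. Splitting off j = k+1,
      where P 0 = n+1, later combines with X F'' to the factor (k+1)(k+1+n).\<close>
    also have "\<dots> = (\<Sum>j\<le>Suc k. P (Suc k - j) * (of_nat j * ?b j))"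
      by (subst sum.atMost_Suc_shift) simp
    also have "\<dots> = (\<Sum>j\<le>k. P (Suc k - j) * (of_nat j * ?b j)) + of_nat (Suc n) * (of_nat (Suc k) * ?b (Suc k))"
      by (simp add: P0)
    finally have 2: "fps_nth (Abs_fps P * fps_deriv F) k
      = (\<Sum>j\<le>k. P (Suc k - j) * (of_nat j * ?b j)) + of_nat (Suc n) * (of_nat (Suc k) * ?b (Suc k))" .
    have "fps_nth (Abs_fps Q * F) k = (\<Sum>i=0..k. Q i * ?b (k - i))"
      by (simp add: fps_mult_nth F_def)
    also have "\<dots> = (\<Sum>i=0..k. Q (k - i) * ?b i)"
      by (subst sum.atLeastAtMost_rev) (rule sum.cong, auto)
    finally have 3: "fps_nth (Abs_fps Q * F) k = (\<Sum>j\<le>k. Q (k - j) * ?b j)"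
      by (simp add: atLeast0AtMost)
    have "(of_nat (Suc k) * of_nat (Suc k + n)) * ?b (Suc k) = (\<Sum>j\<le>k. (Q (k - j) - of_nat j * P (Suc k - j)) * ?b j)"
      unfolding frobenius.simps(2) by (simp del: of_nat_Suc of_nat_add)
    also have "\<dots> = (\<Sum>j\<le>k. Q (k - j) * ?b j) - (\<Sum>j\<le>k. P (Suc k - j) * (of_nat j * ?b j))"
      unfolding sum_subtractf[symmetric] by (rule sum.cong) (auto simp: algebra_simps)
    finally have 4: "of_nat k * (of_nat (Suc k) * ?b (Suc k)) + of_nat (Suc n) * (of_nat (Suc k) * ?b (Suc k))
       = (\<Sum>j\<le>k. Q (k - j) * ?b j) - (\<Sum>j\<le>k. P (Suc k - j) * (of_nat j * ?b j))"
      by (simp add: algebra_simps)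
    show "fps_nth (fps_X * fps_deriv (fps_deriv F) + Abs_fps P * fps_deriv F) k = fps_nth (Abs_fps Q * F) k"
      unfolding fps_add_nth 1 2 3 using 4 by (simp add: algebra_simps)
  qed
qed

lemma frobenius_ode:
  assumes P: "\<And>i. i \<ge> 1 \<Longrightarrow> norm (P i) \<le> A" and Q: "\<And>i. norm (Q i) \<le> B * (real i + 1)"
    and AB: "A \<ge> 0" "B \<ge> 0" "A + B \<le> real L" and P0: "P 0 = of_nat (Suc n)"
    and Ps: "\<And>t. norm t < 1 \<Longrightarrow> (\<lambda>i. P i * t ^ i) sums p t"
    and Qs: "\<And>t. norm t < 1 \<Longrightarrow> (\<lambda>i. Q i * t ^ i) sums q t"
  defines "f \<equiv> eval_fps (Abs_fps (frobenius n P Q))"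
  shows "f holomorphic_on ball 0 1" and "f 0 = 1"
    and "norm t < 1 \<Longrightarrow> t * deriv (deriv f) t + p t * deriv f t = q t * f t"
    and "norm t \<le> r \<Longrightarrow> r < 1 \<Longrightarrow> norm (f t) \<le> (\<Sum>k. real ((k + L) choose L) * r ^ k)"
proof -
  define F where "F = Abs_fps (frobenius n P Q)"
  note frobenius_fps[of P A Q B L n, OF P Q AB P0, folded F_def]
  note R = this(1) and E = this(2) and b = this(3)
  have f: "f = eval_fps F" by (simp add: f_def F_def)
  show "f 0 = 1" by (simp add: f F_def eval_fps_at_0)
  show "norm t \<le> r \<Longrightarrow> r < 1 \<Longrightarrow> norm (f t) \<le> (\<Sum>k. real ((k + L) choose L) * r ^ k)"
    unfolding f by (rule b)
  have lt: "ereal (norm t) < fps_conv_radius G" if "norm t < 1" "fps_conv_radius G \<ge> 1" for t :: complex and G :: "complex fps"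
    using that by (metis ereal_less(3) order_less_le_trans)
  show "f holomorphic_on ball 0 1" unfolding f
    by (rule holomorphic_on_eval_fps) (use lt[OF _ R] in \<open>auto simp: in_eball_iff\<close>)
  have R1: "fps_conv_radius (fps_deriv F) \<ge> 1" using R fps_conv_radius_deriv order_trans by blast
  have R2: "fps_conv_radius (fps_deriv (fps_deriv F)) \<ge> 1" using R1 fps_conv_radius_deriv order_trans by blast
  have d1: "deriv f t = eval_fps (fps_deriv F) t" if "norm t < 1" for t
    unfolding f by (rule DERIV_imp_deriv[OF has_field_derivative_eval_fps[OF lt[OF that R]]])
  have d2: "deriv (deriv f) t = eval_fps (fps_deriv (fps_deriv F)) t" if t: "norm t < 1" for t
  proof -
    have "\<forall>\<^sub>F x in nhds t. x \<in> ball 0 1" using eventually_nhds_in_open[of "ball 0 1" t] t by auto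
    then have "deriv (deriv f) t = deriv (eval_fps (fps_deriv F)) t"
      by (intro deriv_cong_ev) (auto elim!: eventually_mono simp: d1)
    also have "\<dots> = eval_fps (fps_deriv (fps_deriv F)) t"
      by (rule DERIV_imp_deriv[OF has_field_derivative_eval_fps[OF lt[OF t R1]]])
    finally show ?thesis .
  qed
  have rad: "fps_conv_radius (Abs_fps H) \<ge> 1" if "\<And>t. norm t < 1 \<Longrightarrow> (\<lambda>i. H i * t ^ i) sums h t" for H h
    unfolding fps_conv_radius_def fps_nth_Abs_fps
  proof (rule conv_radius_geI_ex')
    fix r :: real assume "0 < r" "ereal r < 1"
    then show "summable (\<lambda>n. H n * of_real r ^ n)"
      using that[of "of_real r"] by (auto simp: sums_iff)
  qed
  have ev: "eval_fps (Abs_fps H) t = h t"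
    if "\<And>t. norm t < 1 \<Longrightarrow> (\<lambda>i. H i * t ^ i) sums h t" "norm t < 1" for H h t
    using that(1)[OF that(2)] by (simp add: eval_fps_def sums_iff)
  show "t * deriv (deriv f) t + p t * deriv f t = q t * f t" if t: "norm t < 1"
  proof -
    note l = lt[OF t]
    have m: "fps_conv_radius (G * H) \<ge> 1" if "fps_conv_radius G \<ge> 1" "fps_conv_radius H \<ge> 1" for G H :: "complex fps"
      using fps_conv_radius_mult[of G H] that by (meson min.boundedI order_trans)
    have X: "fps_conv_radius (fps_X :: complex fps) \<ge> 1" by simp
    have "eval_fps (fps_X * fps_deriv (fps_deriv F) + Abs_fps P * fps_deriv F) t = eval_fps (Abs_fps Q * F) t"
      by (simp only: E)
    then show ?thesis
      using rad[OF Ps] rad[OF Qs] R R1 R2 X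
      by (simp add: eval_fps_add eval_fps_mult l m d1[OF t] d2[OF t] ev[OF Ps t] ev[OF Qs t])
        (simp add: f)
  qed
qed

lemma square_geometric_sums:
  fixes t :: complex
  assumes "norm t < 1"
  shows "(\<lambda>i. c * of_nat (Suc i) * t ^ i) sums (c / (1 - t)\<^sup>2)"
  using sums_mult[OF geometric_deriv_sums[OF assms], of c] by (simp add: mult_ac)

lemma constant_sums:
  fixes c t :: complex
  shows "(\<lambda>i. (if i = 0 then c else 0) * t ^ i) sums c"
proof -
  have "(\<lambda>i. (if i = 0 then c else 0) * t ^ i) = (\<lambda>i. if i = 0 then c * t ^ i else 0)"
    by auto
  then show ?thesis using sums_single[of 0 "\<lambda>i. c * t ^ i"] by simp
qed

text \<open>Frobenius data of the radial equation divided by (1 - t)^2: the first sequence is the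
  constant n + 1, and mu (i+1) are the Taylor coefficients of mu/(1 - t)^2.\<close>

definition radial :: "complex \<Rightarrow> nat \<Rightarrow> complex \<Rightarrow> complex"
  where "radial mu n = eval_fps (Abs_fps (frobenius n
    (\<lambda>i. if i = 0 then of_nat (Suc n) else 0) (\<lambda>i. mu * of_nat (Suc i))))"

text \<open>The Frobenius bound applies with A = 0 and B = |mu|, so \<open>L\<close> depends on mu
  alone. The resulting bound is the same for all n, as the convergence of the weight expansion
  requires.\<close>

lemma radial_ode: "radial_ode mu n (radial mu n) (ball 0 1)"
  and radial_0 [simp]: "radial mu n 0 = 1"
  and radial_bounded: "0 \<le> r \<Longrightarrow> r < 1 \<Longrightarrow> \<exists>C\<ge>0. \<forall>n t. norm t \<le> r \<longrightarrow> norm (radial mu n t) \<le> C"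
proof -
  obtain L :: nat where L: "norm mu \<le> real L" using real_arch_simple by blast
  let ?P = "\<lambda>n i. if i = (0::nat) then of_nat (Suc n) else (0::complex)"
  let ?Q = "\<lambda>i. mu * of_nat (Suc i)"
  have Q: "norm (?Q i) \<le> norm mu * (real i + 1)" for i
    by (simp add: norm_mult add.commute[of 1] del: of_nat_Suc) (simp add: add.commute)
  have Ps: "(\<lambda>i. ?P n i * t ^ i) sums of_nat (Suc n)" for n and t :: complex
    by (rule constant_sums)
  note fo = frobenius_ode[of "?P n" 0 ?Q "norm mu" L n "\<lambda>_. of_nat (Suc n)" "\<lambda>t. mu / (1 - t)\<^sup>2" for n,
    folded radial_def]
  have ho: "radial mu n holomorphic_on ball 0 1" for n
    by (rule fo(1)) (use L Q Ps square_geometric_sums in auto)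
  show "radial mu n 0 = 1"
    by (rule fo(2)) (use L Q Ps square_geometric_sums in auto)
  have "t * deriv (deriv (radial mu n)) t + of_nat (Suc n) * deriv (radial mu n) t = mu / (1 - t)\<^sup>2 * radial mu n t"
    if "norm t < 1" for t
    by (rule fo(3)) (use L Q Ps square_geometric_sums that in auto)
  moreover have "1 - t \<noteq> 0" if "norm t < 1" for t :: complex using that by auto
  ultimately show "radial_ode mu n (radial mu n) (ball 0 1)"
    unfolding radial_ode_def using ho by simp
  show "\<exists>C\<ge>0. \<forall>n t. norm t \<le> r \<longrightarrow> norm (radial mu n t) \<le> C" if r: "0 \<le> r" "r < 1" for r
  proof (intro exI[of _ "\<Sum>k. real ((k + L) choose L) * r ^ k"] conjI allI impI)
    show "0 \<le> (\<Sum>k. real ((k + L) choose L) * r ^ k)"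
      by (intro suminf_nonneg summable_binomial_power r) (use r in auto)
    show "norm (radial mu n t) \<le> (\<Sum>k. real ((k + L) choose L) * r ^ k)" if "norm t \<le> r" for n t
      by (rule fo(4)) (use L Q Ps square_geometric_sums that r in auto)
  qed
qed

text \<open>The radial equation at t = 0, where the second derivative drops out. This value enters
  the first order term of a translation.\<close>

lemma radial_deriv_0: "deriv (radial mu n) 0 = mu / of_nat (Suc n)"
proof -
  have "of_nat (Suc n) * deriv (radial mu n) 0 = mu"
    using radial_ode[of mu n] unfolding radial_ode_def by (auto dest!: bspec[of _ _ 0])
  then show ?thesis by (simp add: field_simps del: of_nat_Suc)
qed

section \<open>Continuation of the radial solutions to the slit plane\<close>

definition slit_plane :: "complex set"
  where "slit_plane = {t. t \<notin> complex_of_real ` {1..}}"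

lemma slit_plane_iff: "t \<in> slit_plane \<longleftrightarrow> 1 - t \<notin> \<real>\<^sub>\<le>\<^sub>0"
proof -
  have "t \<in> complex_of_real ` {1..} \<longleftrightarrow> 1 - t \<in> \<real>\<^sub>\<le>\<^sub>0"
    unfolding complex_nonpos_Reals_iff image_iff Bex_def
    by (auto simp: complex_eq_iff intro!: exI[of _ "Re t"])
  then show ?thesis by (simp add: slit_plane_def)
qed

lemma open_slit_plane: "open slit_plane"
proof -
  have "slit_plane = (\<lambda>t. 1 - t) -` (- \<real>\<^sub>\<le>\<^sub>0)" by (auto simp: slit_plane_iff)
  then show ?thesis
    using open_vimage[of "- \<real>\<^sub>\<le>\<^sub>0" "\<lambda>t::complex. 1 - t"] closed_nonpos_Reals_complex
    by (simp add: open_Compl continuous_on_diff)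
qed

lemma ball_subset_slit_plane: "ball 0 1 \<subseteq> slit_plane"
  by (auto simp: slit_plane_def)

text \<open>The chain rule computation for f(t) = phi(u) with s = sqrt(1 - t) and u = (1 - s)/(1 +
  s). The letters a, b, c stand for phi, phi', phi'' at u; 1/(s (1 + s)^2) is u' and (1 + 3 s)/(2
  s^3 (1 + s)^3) is u''. The hypothesis is the equation in u with its coefficients written in
  s.\<close>

lemma slit_plane_algebra:
  fixes s a b c lam N :: complex
  assumes s: "s \<noteq> 0" "1 + s \<noteq> 0"
    and ode: "((1 - s) / (1 + s)) * c + (1 / (2 * s) + 1 + N * s - s / 2) * b = lam * (1 + s)\<^sup>2 / (4 * s\<^sup>2) * a"
  shows "(s\<^sup>2)\<^sup>2 * ((1 - s\<^sup>2) * (c / (s * (1 + s)\<^sup>2)\<^sup>2 + b * ((1 + 3 * s) / (2 * s ^ 3 * (1 + s) ^ 3)))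
    + (N + 1) * (b / (s * (1 + s)\<^sup>2))) = lam / 4 * a"
proof -
  have "(s\<^sup>2)\<^sup>2 * ((1 - s\<^sup>2) * (c / (s * (1 + s)\<^sup>2)\<^sup>2)) = s\<^sup>2 / (1 + s)\<^sup>2 * (((1 - s) / (1 + s)) * c)"
    using s by (simp add: divide_simps) algebra
  moreover have "(s\<^sup>2)\<^sup>2 * ((1 - s\<^sup>2) * (b * ((1 + 3 * s) / (2 * s ^ 3 * (1 + s) ^ 3))) + (N + 1) * (b / (s * (1 + s)\<^sup>2)))
     = s\<^sup>2 / (1 + s)\<^sup>2 * ((1 / (2 * s) + 1 + N * s - s / 2) * b)"
    using s by (simp add: divide_simps) algebra
  ultimately have "(s\<^sup>2)\<^sup>2 * ((1 - s\<^sup>2) * (c / (s * (1 + s)\<^sup>2)\<^sup>2 + b * ((1 + 3 * s) / (2 * s ^ 3 * (1 + s) ^ 3)))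
    + (N + 1) * (b / (s * (1 + s)\<^sup>2))) = s\<^sup>2 / (1 + s)\<^sup>2 * (((1 - s) / (1 + s)) * c + (1 / (2 * s) + 1 + N * s - s / 2) * b)"
    by (simp only: distrib_left add.assoc)
  also have "\<dots> = lam / 4 * a" unfolding ode using s by (simp add: divide_simps)
  finally show ?thesis .
qed

text \<open>The substitution \<open>t = 4 u / (1 + u)\<^sup>2\<close> maps the unit disk onto the slit plane and moves the
  singular points \<open>1\<close> and \<open>\<infinity>\<close> to \<open>u = 1\<close> and \<open>u = -1\<close>, so that the Frobenius series in \<open>u\<close>
  converges on the whole slit plane.\<close>

lemma radial_ode_slit_plane:
  "\<exists>f. radial_ode mu n f slit_plane \<and> f 0 = 1"
proof -
  define lam where "lam = 4 * mu"
  obtain L :: nat where L: "(2 + 2 * real n) + norm lam \<le> real L" using real_arch_simple by blast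
  \<comment> \<open>Taylor coefficients of p(u) = 1/(1 - u) + (2n - 1)/(1 + u) + 1 - n, the
    coefficient of phi' in the transformed equation. Since p(0) = n + 1, the Frobenius recursion is
    run with the same n.\<close>
  define P :: "nat \<Rightarrow> complex"
    where "P = (\<lambda>i. 1 + (2 * of_nat n - 1) * (-1) ^ i + (if i = 0 then 1 - of_nat n else 0))"
  define p where "p = (\<lambda>u::complex. 1 / (1 - u) + (2 * of_nat n - 1) * (1 / (1 + u)) + (1 - of_nat n))"
  let ?Q = "\<lambda>i. lam * of_nat (Suc i)"
  have Q: "norm (?Q i) \<le> norm lam * (real i + 1)" for i
    by (simp add: norm_mult add.commute[of 1] del: of_nat_Suc) (simp add: add.commute)
  have PA: "norm (P i) \<le> 2 + 2 * real n" if "i \<ge> 1" for i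
  proof -
    have "norm (P i) \<le> 1 + norm ((2 * of_nat n - 1) * (-1) ^ i :: complex)"
      unfolding P_def using that norm_triangle_ineq[of 1 "(2 * of_nat n - 1) * (-1) ^ i :: complex"] by simp
    also have "norm ((2 * of_nat n - 1) * (-1) ^ i :: complex) = norm (2 * of_nat n - 1 :: complex)"
      by (simp add: norm_mult norm_power)
    also have "\<dots> \<le> norm (2 * of_nat n :: complex) + 1"
      using norm_triangle_ineq4[of "2 * of_nat n :: complex" 1] by simp
    finally show ?thesis by (simp add: norm_mult)
  qed
  have Ps: "(\<lambda>i. P i * u ^ i) sums p u" if "norm u < 1" for u
  proof -
    have g1: "(\<lambda>i. u ^ i) sums (1 / (1 - u))" using geometric_sums[OF that] .
    have g2: "(\<lambda>i. (2 * of_nat n - 1) * (- u) ^ i) sums ((2 * of_nat n - 1) * (1 / (1 + u)))"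
      using sums_mult[OF geometric_sums[of "- u"], of "2 * of_nat n - 1"] that by simp
    have g3: "(\<lambda>i. (if i = 0 then 1 - of_nat n else 0) * u ^ i) sums (1 - of_nat n)"
      by (rule constant_sums)
    show ?thesis
      using sums_add[OF sums_add[OF g1 g2] g3] unfolding p_def P_def
      by (simp add: distrib_right mult.assoc power_mult_distrib[symmetric])
  qed
  define \<phi> where "\<phi> = eval_fps (Abs_fps (frobenius n P ?Q))"
  note fo = frobenius_ode[of P "2 + 2 * real n" ?Q "norm lam" L n p "\<lambda>u. lam / (1 - u)\<^sup>2", folded \<phi>_def]
  have P0: "P 0 = of_nat (Suc n)" by (simp add: P_def)
  have hol: "\<phi> holomorphic_on ball 0 1"
    by (rule fo(1)) (use L Q Ps PA P0 square_geometric_sums in auto)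
  have \<phi>0: "\<phi> 0 = 1"
    by (rule fo(2)) (use L Q Ps PA P0 square_geometric_sums in auto)
  have ode: "u * deriv (deriv \<phi>) u + p u * deriv \<phi> u = lam / (1 - u)\<^sup>2 * \<phi> u" if "norm u < 1" for u
    by (rule fo(3)) (use L Q Ps PA P0 square_geometric_sums that in auto)
  \<comment> \<open>Inverse of the substitution, from 1 - t = ((1 - u)/(1 + u))^2. Off the slit the
    principal root has positive real part, hence |1 - s| < |1 + s| and \<open>U t\<close> lies in
    the unit disk.\<close>
  define s where "s = (\<lambda>t. csqrt (1 - t))"
  define U where "U = (\<lambda>t. (1 - s t) / (1 + s t))"
  define f where "f = (\<lambda>t. \<phi> (U t))"
  define g where "g = (\<lambda>t. 1 / (s t * (1 + s t)\<^sup>2))"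
  have s: "s t \<noteq> 0" "1 + s t \<noteq> 0" "norm (U t) < 1" "(s t)\<^sup>2 = 1 - t"
    "(s has_field_derivative - 1 / (2 * s t)) (at t)"
    "(U has_field_derivative g t) (at t)"
    "(g has_field_derivative (1 + 3 * s t) / (2 * s t ^ 3 * (1 + s t) ^ 3)) (at t)"
    if t: "t \<in> slit_plane" for t
  proof -
    have nt: "1 - t \<notin> \<real>\<^sub>\<le>\<^sub>0" using t by (simp add: slit_plane_iff)
    have re: "Re (s t) > 0"
    proof (rule ccontr)
      assume "\<not> 0 < Re (s t)"
      then have "Re (s t) = 0" using csqrt_principal[of "1 - t"] by (auto simp: s_def)
      then have "(s t)\<^sup>2 \<in> \<real>\<^sub>\<le>\<^sub>0" by (simp add: complex_nonpos_Reals_iff power2_eq_square)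
      then show False using nt by (simp add: s_def)
    qed
    show 0: "s t \<noteq> 0" "1 + s t \<noteq> 0" using re by (auto simp: complex_eq_iff)
    have "(norm (1 - s t))\<^sup>2 < (norm (1 + s t))\<^sup>2"
      unfolding cmod_power2 using re by (simp add: power2_eq_square algebra_simps)
    then have "norm (1 - s t) < norm (1 + s t)" by (rule power_less_imp_less_base) simp
    then show "norm (U t) < 1" using 0 by (simp add: U_def norm_divide)
    show "(s t)\<^sup>2 = 1 - t" by (simp add: s_def)
    show ds: "(s has_field_derivative - 1 / (2 * s t)) (at t)"
      unfolding s_def using nt by (auto intro!: derivative_eq_intros)
    show "(U has_field_derivative g t) (at t)"
      unfolding U_def g_def using 0
      by (auto intro!: derivative_eq_intros ds) (simp add: divide_simps, algebra)
    show "(g has_field_derivative (1 + 3 * s t) / (2 * s t ^ 3 * (1 + s t) ^ 3)) (at t)"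
      unfolding g_def using 0
      by (auto intro!: derivative_eq_intros ds) (simp add: divide_simps, algebra)
  qed
  have d\<phi>: "(\<phi> has_field_derivative deriv \<phi> u) (at u)" "(deriv \<phi> has_field_derivative deriv (deriv \<phi>) u) (at u)"
    if "norm u < 1" for u
    using holomorphic_derivI[OF hol open_ball, of u] 
      holomorphic_derivI[OF holomorphic_deriv[OF hol open_ball] open_ball, of u] that by auto
  have f1: "(f has_field_derivative deriv \<phi> (U t) * g t) (at t)" if "t \<in> slit_plane" for t
    unfolding f_def by (rule DERIV_chain2[OF d\<phi>(1) s(6)]) (use s that in auto)
  have d1: "deriv f t = deriv \<phi> (U t) * g t" if "t \<in> slit_plane" for t
    by (rule DERIV_imp_deriv[OF f1[OF that]])
  have d2: "deriv (deriv f) t = deriv (deriv \<phi>) (U t) * g t * g t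
      + deriv \<phi> (U t) * ((1 + 3 * s t) / (2 * s t ^ 3 * (1 + s t) ^ 3))" if t: "t \<in> slit_plane" for t
  proof -
    have "((\<lambda>t. deriv \<phi> (U t) * g t) has_field_derivative (deriv (deriv \<phi>) (U t) * g t) * g t
      + ((1 + 3 * s t) / (2 * s t ^ 3 * (1 + s t) ^ 3)) * deriv \<phi> (U t)) (at t)"
      by (intro DERIV_mult DERIV_chain2[OF d\<phi>(2)] s t)
    then have "(deriv f has_field_derivative (deriv (deriv \<phi>) (U t) * g t) * g t
      + ((1 + 3 * s t) / (2 * s t ^ 3 * (1 + s t) ^ 3)) * deriv \<phi> (U t)) (at t)"
      by (rule has_field_derivative_transform_within_open[OF _ open_slit_plane t]) (simp add: d1)
    then show ?thesis by (simp add: DERIV_imp_deriv mult_ac)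
  qed
  have "radial_ode mu n f slit_plane" unfolding radial_ode_def
  proof (intro conjI ballI)
    show "f holomorphic_on slit_plane"
      unfolding holomorphic_on_open[OF open_slit_plane] using f1 by blast
    fix t assume t: "t \<in> slit_plane"
    note s0 = s(1,2)[OF t]
    have u1: "1 - U t = 2 * s t / (1 + s t)" "1 + U t = 2 / (1 + s t)"
      using s0 by (auto simp: U_def divide_simps)
    have pU: "p (U t) = 1 / (2 * s t) + 1 + of_nat n * s t - s t / 2"
      unfolding p_def u1 using s0 by (simp add: divide_simps) algebra
    have qU: "lam / (1 - U t)\<^sup>2 = lam * (1 + s t)\<^sup>2 / (4 * (s t)\<^sup>2)"
      unfolding u1 by (simp add: power_divide power_mult_distrib)
    have "((1 - s t) / (1 + s t)) * deriv (deriv \<phi>) (U t) + (1 / (2 * s t) + 1 + of_nat n * s t - s t / 2) * deriv \<phi> (U t)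
        = lam * (1 + s t)\<^sup>2 / (4 * (s t)\<^sup>2) * \<phi> (U t)"
      using ode[OF s(3)[OF t]] unfolding pU qU by (simp add: U_def)
    from slit_plane_algebra[OF s0 this]
    have "(1 - t)\<^sup>2 * (t * (deriv (deriv \<phi>) (U t) / (s t * (1 + s t)\<^sup>2)\<^sup>2
        + deriv \<phi> (U t) * ((1 + 3 * s t) / (2 * s t ^ 3 * (1 + s t) ^ 3)))
        + (of_nat n + 1) * (deriv \<phi> (U t) / (s t * (1 + s t)\<^sup>2))) = lam / 4 * \<phi> (U t)"
      by (simp add: s(4)[OF t])
    then show "(1 - t)\<^sup>2 * (t * deriv (deriv f) t + of_nat (Suc n) * deriv f t) = mu * f t"
      unfolding d1[OF t] d2[OF t] by (simp add: f_def g_def lam_def power2_eq_square mult_ac add_ac)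
  qed
  moreover have "f 0 = 1" by (simp add: f_def U_def s_def \<phi>0)
  ultimately show ?thesis by blast
qed

section \<open>Expansion into weight functions\<close>

lemma eigenspace_holomorphic2: "F \<in> eigenspace lam \<Longrightarrow> holomorphic2_on F bidisk"
  by (simp add: mem_eigenspace_iff)

lemma eigenspace_outside: "F \<in> eigenspace lam \<Longrightarrow> p \<notin> bidisk \<Longrightarrow> F p = 0"
  by (cases p) (simp add: mem_eigenspace_iff)

lemma dz_dw_linear:
  assumes F: "holomorphic2_on F S" and G: "holomorphic2_on G S" and S: "open S" "p \<in> S"
  shows "dw (\<lambda>q. a * F q + b * G q) p = a * dw F p + b * dw G p"
    and "dz (\<lambda>q. a * F q + b * G q) p = a * dz F p + b * dz G p"
proof -
  obtain z w where p: "p = (z, w)" by (cases p)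
  have zw: "(z, w) \<in> S" using S p by simp
  note d = field_differentiable_derivI[OF holomorphic2_on_fst_snd(1)[OF F zw]]
    field_differentiable_derivI[OF holomorphic2_on_fst_snd(1)[OF G zw]]
    field_differentiable_derivI[OF holomorphic2_on_fst_snd(2)[OF F zw]]
    field_differentiable_derivI[OF holomorphic2_on_fst_snd(2)[OF G zw]]
  show "dz (\<lambda>q. a * F q + b * G q) p = a * dz F p + b * dz G p"
    unfolding dz_def p prod.case by (intro DERIV_imp_deriv DERIV_add DERIV_cmult d)
  show "dw (\<lambda>q. a * F q + b * G q) p = a * dw F p + b * dw G p"
    unfolding dw_def p prod.case by (intro DERIV_imp_deriv DERIV_add DERIV_cmult d)
qed

lemma dz_cong:
  assumes "open S" "p \<in> S" "\<And>q. q \<in> S \<Longrightarrow> F q = G q"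
  shows "dz F p = dz G p"
proof -
  obtain z w where p: "p = (z, w)" by (cases p)
  have "open ((\<lambda>\<zeta>. (\<zeta>, w)) -` S)"
    using assms(1) by (rule open_vimage) (intro continuous_intros)
  then have "\<forall>\<^sub>F x in nhds z. x \<in> (\<lambda>\<zeta>. (\<zeta>, w)) -` S"
    using assms(2) p by (intro eventually_nhds_in_open) auto
  then show ?thesis unfolding dz_def p prod.case
    by (intro deriv_cong_ev) (auto elim!: eventually_mono simp: assms(3))
qed

lemma eigenspace_linear:
  assumes F: "F \<in> eigenspace lam" and G: "G \<in> eigenspace lam"
  shows "(\<lambda>p. a * F p + b * G p) \<in> eigenspace lam"
  unfolding mem_eigenspace_iff
proof (intro conjI allI impI)
  note hF = eigenspace_holomorphic2[OF F] and hG = eigenspace_holomorphic2[OF G]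
  show "holomorphic2_on (\<lambda>p. a * F p + b * G p) bidisk"
    by (intro holomorphic2_intros hF hG)
  show "a * F p + b * G p = 0" if "p \<notin> bidisk" for p
    using eigenspace_outside[OF F that] eigenspace_outside[OF G that] by simp
  fix z w assume p: "(z, w) \<in> bidisk"
  have "dz (dw (\<lambda>p. a * F p + b * G p)) (z, w) = dz (\<lambda>p. a * dw F p + b * dw G p) (z, w)"
    by (rule dz_cong[OF open_bidisk p]) (rule dz_dw_linear[OF hF hG open_bidisk])
  also have "\<dots> = a * dz (dw F) (z, w) + b * dz (dw G) (z, w)"
    by (rule dz_dw_linear(2)[OF _ _ open_bidisk p]) (intro holomorphic2_on_dw open_bidisk hF hG)+
  finally have "4 * (1 - z * w)\<^sup>2 * dz (dw (\<lambda>p. a * F p + b * G p)) (z, w)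
      = a * (4 * (1 - z * w)\<^sup>2 * dz (dw F) (z, w)) + b * (4 * (1 - z * w)\<^sup>2 * dz (dw G) (z, w))"
    by (simp add: algebra_simps)
  also have "\<dots> = a * (lam * F (z, w)) + b * (lam * G (z, w))"
    using F G p by (simp add: mem_eigenspace_iff)
  finally show "4 * (1 - z * w)\<^sup>2 * dz (dw (\<lambda>p. a * F p + b * G p)) (z, w) = lam * (a * F (z, w) + b * G (z, w))"
    by (simp add: algebra_simps)
qed

lemma eigenspace_0: "(\<lambda>_. 0) \<in> eigenspace lam"
proof -
  have "weight_fun 0 (radial (lam / 4) 0) \<in> eigenspace (4 * (lam / 4))"
    by (rule weight_fun_eigenspace[OF radial_ode])
  from eigenspace_linear[OF this this, of 0 0] show ?thesis by simp
qed

lemma eigenspace_scale: "F \<in> eigenspace lam \<Longrightarrow> (\<lambda>p. c * F p) \<in> eigenspace lam"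
  using eigenspace_linear[of F lam F c 0] by simp

lemma eigenspace_add: "F \<in> eigenspace lam \<Longrightarrow> G \<in> eigenspace lam \<Longrightarrow> (\<lambda>p. F p + G p) \<in> eigenspace lam"
  using eigenspace_linear[of F lam G 1 1] by simp

lemma eigenspace_sum: "(\<And>i. i \<in> I \<Longrightarrow> F i \<in> eigenspace lam) \<Longrightarrow> (\<lambda>p. \<Sum>i\<in>I. F i p) \<in> eigenspace lam"
  by (induction I rule: infinite_finite_induct) (auto simp: eigenspace_0 intro: eigenspace_add)

lemma swap_bidisk [simp]: "prod.swap p \<in> bidisk \<longleftrightarrow> p \<in> bidisk"
  by (cases p) (auto simp: mem_bidisk)

text \<open>Swapping turns \<open>dz (dw F)\<close> into \<open>dw (dz F)\<close>, so this rests on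
  the symmetry of the mixed derivative.\<close>

lemma eigenspace_swap:
  assumes F: "F \<in> eigenspace lam"
  shows "F \<circ> prod.swap \<in> eigenspace lam"
  unfolding mem_eigenspace_iff
proof (intro conjI allI impI)
  note hF = eigenspace_holomorphic2[OF F]
  have "holomorphic2_on (\<lambda>p. F (snd p, fst p)) bidisk"
    by (rule holomorphic2_on_map[OF hF]) (auto intro: holomorphic2_intros simp: mem_bidisk)
  then show "holomorphic2_on (F \<circ> prod.swap) bidisk"
    by (simp add: prod.swap_def o_def)
  show "(F \<circ> prod.swap) p = 0" if "p \<notin> bidisk" for p
    using eigenspace_outside[OF F, of "prod.swap p"] that by simp
  fix z w assume p: "(z, w) \<in> bidisk"
  have "dz (dw (F \<circ> prod.swap)) (z, w) = dw (dz F) (w, z)"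
    by (simp add: dw_def dz_def)
  also have "\<dots> = dz (dw F) (w, z)"
    by (rule dw_dz_commute[OF hF open_bidisk]) (use p in \<open>auto simp: mem_bidisk\<close>)
  finally show "4 * (1 - z * w)\<^sup>2 * dz (dw (F \<circ> prod.swap)) (z, w) = lam * (F \<circ> prod.swap) (z, w)"
    using F p unfolding mem_eigenspace_iff by (auto simp: mem_bidisk mult.commute[of z w])
qed

definition weight :: "complex \<Rightarrow> nat \<Rightarrow> complex \<times> complex \<Rightarrow> complex"
  where "weight lam n = weight_fun n (radial (lam / 4) n)"

lemma weight_eigenspace: "weight lam n \<in> eigenspace lam"
  using weight_fun_eigenspace[OF radial_ode[of "lam / 4" n]] by (simp add: weight_def)

lemma weight_data:
  "norm z < 1 \<Longrightarrow> weight lam n (z, 0) = z ^ n"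
  "norm z < 1 \<Longrightarrow> weight lam n (0, z) = (if n = 0 then 1 else 0)"
  by (auto simp: weight_def weight_fun_def mem_bidisk)

text \<open>C does not depend on n, so the weights decay like r^n, and the expansion converges for
  the same coefficient sequences as power series on the disk.\<close>

lemma weight_bounded:
  assumes r: "0 \<le> r" "r < 1"
  shows "\<exists>C\<ge>0. \<forall>n z w. norm z \<le> r \<longrightarrow> norm w \<le> r \<longrightarrow> norm (weight lam n (z, w)) \<le> C * r ^ n"
proof -
  obtain C where C: "C \<ge> 0" "\<And>n t. norm t \<le> r \<Longrightarrow> norm (radial (lam / 4) n t) \<le> C"
    using radial_bounded[OF r] by blast
  have "norm (weight lam n (z, w)) \<le> C * r ^ n" if zw: "norm z \<le> r" "norm w \<le> r" for n z w
  proof -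
    have b: "(z, w) \<in> bidisk" using zw r by (simp add: mem_bidisk)
    have "norm (z * w) \<le> r * 1" unfolding norm_mult by (intro mult_mono) (use zw r in auto)
    then have "norm (radial (lam / 4) n (z * w)) \<le> C" by (intro C(2)) simp
    then have "norm (z ^ n * radial (lam / 4) n (z * w)) \<le> r ^ n * C"
      unfolding norm_mult norm_power by (intro mult_mono power_mono) (use zw r C in auto)
    then show ?thesis using b by (simp add: weight_def weight_fun_def mult.commute)
  qed
  with C(1) show ?thesis by blast
qed

lemma compact_bidisk_radius:
  assumes "compact K" "K \<subseteq> bidisk"
  obtains r where "0 < r" "r < 1" "\<And>z w. (z, w) \<in> K \<Longrightarrow> norm z \<le> r \<and> norm w \<le> r"
proof (cases "K = {}")
  case True
  then show ?thesis using that[of "1/2"] by auto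
next
  case False
  have "continuous_on K (\<lambda>p. max (norm (fst p)) (norm (snd p)))" by (intro continuous_intros)
  then obtain q where q: "q \<in> K" "\<And>p. p \<in> K \<Longrightarrow> max (norm (fst p)) (norm (snd p)) \<le> max (norm (fst q)) (norm (snd q))"
    using continuous_attains_sup[OF assms(1) False] by blast
  define r where "r = max (1/2) (max (norm (fst q)) (norm (snd q)))"
  have "r < 1" using q(1) assms(2) by (cases q) (auto simp: r_def mem_bidisk)
  moreover have "norm z \<le> r \<and> norm w \<le> r" if "(z, w) \<in> K" for z w
    using q(2)[OF that] by (auto simp: r_def)
  ultimately show ?thesis using that[of r] by (auto simp: r_def)
qed

definition weight_term :: "complex \<Rightarrow> (nat \<Rightarrow> complex) \<Rightarrow> (nat \<Rightarrow> complex) \<Rightarrow> nat \<Rightarrow> complex \<times> complex \<Rightarrow> complex"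
  where "weight_term lam p q n = (\<lambda>x. p n * weight lam n x + q n * weight lam n (prod.swap x))"

text \<open>Radius of convergence at least 1, phrased as the absolute summability that the majorants
  use.\<close>

definition disk_coeffs :: "(nat \<Rightarrow> complex) \<Rightarrow> bool"
  where "disk_coeffs p \<longleftrightarrow> (\<forall>r. 0 < r \<longrightarrow> r < 1 \<longrightarrow> summable (\<lambda>n. norm (p n) * r ^ n))"

lemma weight_term_eigenspace: "weight_term lam p q n \<in> eigenspace lam"
  unfolding weight_term_def
  using eigenspace_linear[OF weight_eigenspace[of lam n] eigenspace_swap[OF weight_eigenspace[of lam n]], of "p n" "q n"]
  by simp

text \<open>The two summands are bounded separately, not just their sum, since averaging over
  rotations multiplies them by different factors of modulus at most 1.\<close>

lemma weight_term_bound: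
  assumes pq: "disk_coeffs p" "disk_coeffs q" and r: "0 < r" "r < 1"
  obtains b where "summable b" "\<And>n. 0 \<le> b n"
    "\<And>n z w. norm z \<le> r \<Longrightarrow> norm w \<le> r \<Longrightarrow>
        norm (p n * weight lam n (z, w)) + norm (q n * weight lam n (w, z)) \<le> b n"
proof -
  obtain C where C: "C \<ge> 0" "\<And>n z w. norm z \<le> r \<Longrightarrow> norm w \<le> r \<Longrightarrow> norm (weight lam n (z, w)) \<le> C * r ^ n"
    using weight_bounded[of r lam] r by (meson less_imp_le)
  define b where "b = (\<lambda>n. C * (norm (p n) * r ^ n + norm (q n) * r ^ n))"
  show ?thesis
  proof (rule that[of b])
    show "summable b" unfolding b_def
      using pq r unfolding disk_coeffs_def by (intro summable_mult summable_add) auto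
    show "0 \<le> b n" for n using C r by (simp add: b_def)
    show "norm (p n * weight lam n (z, w)) + norm (q n * weight lam n (w, z)) \<le> b n"
      if "norm z \<le> r" "norm w \<le> r" for n z w
    proof -
      have "norm (p n * weight lam n (z, w)) \<le> norm (p n) * (C * r ^ n)"
        unfolding norm_mult by (intro mult_left_mono C that) auto
      moreover have "norm (q n * weight lam n (w, z)) \<le> norm (q n) * (C * r ^ n)"
        unfolding norm_mult by (intro mult_left_mono C that) auto
      ultimately show ?thesis by (simp add: b_def algebra_simps)
    qed
  qed
qed

definition weight_series :: "complex \<Rightarrow> (nat \<Rightarrow> complex) \<Rightarrow> (nat \<Rightarrow> complex) \<Rightarrow> complex \<times> complex \<Rightarrow> complex"
  where "weight_series lam p q = (\<lambda>x. \<Sum>n. weight_term lam p q n x)"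

lemma weight_series:
  assumes pq: "disk_coeffs p" "disk_coeffs q"
  shows "x \<in> bidisk \<Longrightarrow> (\<lambda>n. weight_term lam p q n x) sums weight_series lam p q x"
    and "compact K \<Longrightarrow> K \<subseteq> bidisk \<Longrightarrow>
      uniform_limit K (\<lambda>N x. \<Sum>n<N. weight_term lam p q n x) (weight_series lam p q) sequentially"
    and "weight_series lam p q \<in> eigenspace lam"
proof -
  show ul: "uniform_limit K (\<lambda>N x. \<Sum>n<N. weight_term lam p q n x) (weight_series lam p q) sequentially"
    if K: "compact K" "K \<subseteq> bidisk" for K
  proof -
    obtain r where r: "0 < r" "r < 1" "\<And>z w. (z, w) \<in> K \<Longrightarrow> norm z \<le> r \<and> norm w \<le> r"
      using compact_bidisk_radius[OF K] by metis
    obtain b where b: "summable b" "\<And>n z w. norm z \<le> r \<Longrightarrow> norm w \<le> r \<Longrightarrow>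
        norm (p n * weight lam n (z, w)) + norm (q n * weight lam n (w, z)) \<le> b n"
      using weight_term_bound[OF pq r(1,2)] by metis
    show ?thesis unfolding weight_series_def
    proof (rule Weierstrass_m_test[OF _ b(1)])
      fix n x assume x: "x \<in> K"
      obtain z w where zw: "x = (z, w)" by (cases x)
      have "norm (weight_term lam p q n x) \<le> norm (p n * weight lam n (z, w)) + norm (q n * weight lam n (w, z))"
        unfolding weight_term_def zw using norm_triangle_ineq by simp
      also have "\<dots> \<le> b n" by (rule b(2)) (use r x zw in auto)
      finally show "norm (weight_term lam p q n x) \<le> b n" .
    qed
  qed
  show "(\<lambda>n. weight_term lam p q n x) sums weight_series lam p q x" if "x \<in> bidisk" for x
    unfolding sums_def using tendsto_uniform_limitI[OF ul[of "{x}"], of x] that by simp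
  show "weight_series lam p q \<in> eigenspace lam"
  proof (rule eigenspace_limit[OF _ ul])
    show "(\<lambda>x. \<Sum>n<N. weight_term lam p q n x) \<in> eigenspace lam" for N
      by (intro eigenspace_sum weight_term_eigenspace)
    fix x assume "x \<notin> bidisk"
    then have "weight_term lam p q n x = 0" for n
      by (rule eigenspace_outside[OF weight_term_eigenspace])
    then show "weight_series lam p q x = 0" by (simp add: weight_series_def)
  qed
qed

definition coef :: "nat \<Rightarrow> (complex \<times> complex \<Rightarrow> complex) \<Rightarrow> complex"
  where "coef n F = (deriv ^^ n) (\<lambda>z. F (z, 0)) 0 / fact n"

text \<open>Weight 0 is symmetric under the swap and its coefficient is already
  \<open>coef 0 F\<close>; the value 0 at n = 0 avoids counting it twice.\<close>

definition swap_coef :: "nat \<Rightarrow> (complex \<times> complex \<Rightarrow> complex) \<Rightarrow> complex"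
  where "swap_coef n F = (if n = 0 then 0 else coef n (F \<circ> prod.swap))"

lemma holomorphic2_slice0:
  assumes "holomorphic2_on F bidisk"
  shows "(\<lambda>z. F (z, 0)) holomorphic_on ball 0 1"
  by (rule holomorphic2_on_slice(1)[OF assms]) (auto simp: mem_bidisk)

lemma coef_sums:
  assumes "holomorphic2_on F bidisk" "norm z < 1"
  shows "(\<lambda>n. coef n F * z ^ n) sums F (z, 0)"
  using holomorphic_power_series[OF holomorphic2_slice0[OF assms(1)], of z] assms(2)
  by (simp add: coef_def)

lemma coef_bound:
  assumes "holomorphic2_on F bidisk" "\<And>z. norm z = r \<Longrightarrow> norm (F (z, 0)) \<le> B" "0 < r" "r < 1"
  shows "norm (coef n F) \<le> B / r ^ n"
proof -
  have "cball 0 r \<subseteq> ball (0::complex) 1" using assms(4) by auto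
  then have h: "(\<lambda>z. F (z, 0)) holomorphic_on cball 0 r"
    using holomorphic2_slice0[OF assms(1)] holomorphic_on_subset by blast
  have "norm ((deriv ^^ n) (\<lambda>z. F (z, 0)) 0) \<le> fact n * B / r ^ n"
    by (rule Cauchy_inequality)
      (use assms h in \<open>auto intro: holomorphic_on_subset holomorphic_on_imp_continuous_on simp: norm_minus_commute\<close>)
  then show ?thesis by (simp add: coef_def norm_divide field_simps)
qed

lemma disk_coeffs_coef:
  assumes "holomorphic2_on F bidisk"
  shows "disk_coeffs (\<lambda>n. coef n F)"
  unfolding disk_coeffs_def
proof (intro allI impI)
  fix r :: real assume r: "0 < r" "r < 1"
  define s where "s = (1 + r) / 2"
  have s: "r < s" "s < 1" "0 < s" using r by (auto simp: s_def)
  have "summable (\<lambda>n. coef n F * of_real s ^ n)"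
    using coef_sums[OF assms, of "of_real s"] s by (simp add: sums_iff)
  from powser_insidea[OF this, of "of_real r"] show "summable (\<lambda>n. norm (coef n F) * r ^ n)"
    using s r by (simp add: norm_mult norm_power)
qed

lemma disk_coeffs_swap_coef:
  assumes "F \<in> eigenspace lam"
  shows "disk_coeffs (\<lambda>n. swap_coef n F)"
  unfolding disk_coeffs_def
proof (intro allI impI)
  fix r :: real assume r: "0 < r" "r < 1"
  have "summable (\<lambda>n. norm (coef n (F \<circ> prod.swap)) * r ^ n)"
    using disk_coeffs_coef[OF eigenspace_holomorphic2[OF eigenspace_swap[OF assms]]] r
    unfolding disk_coeffs_def by blast
  then show "summable (\<lambda>n. norm (swap_coef n F) * r ^ n)"
    by (rule summable_comparison_test') (use r in \<open>auto simp: swap_coef_def\<close>)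
qed

lemma coef_0: "coef 0 F = F (0, 0)"
  by (simp add: coef_def)

text \<open>On w = 0 and on z = 0 the weights reduce to powers, so the series has the same
  restrictions as \<open>F\<close>. The difference is an eigenfunction with zero Goursat data and
  vanishes by \<open>eigenspace_zero\<close>.\<close>

theorem eigenspace_expansion:
  assumes F: "F \<in> eigenspace lam"
  shows "F = weight_series lam (\<lambda>n. coef n F) (\<lambda>n. swap_coef n F)"
proof -
  note hF = eigenspace_holomorphic2[OF F]
  note hS = eigenspace_holomorphic2[OF eigenspace_swap[OF F]]
  define G where "G = weight_series lam (\<lambda>n. coef n F) (\<lambda>n. swap_coef n F)"
  note ws = weight_series[OF disk_coeffs_coef[OF hF] disk_coeffs_swap_coef[OF F], where lam = lam, folded G_def]
  have "(\<lambda>p. 1 * F p + (-1) * G p) = (\<lambda>_. 0)"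
  proof (rule eigenspace_zero)
    show "(\<lambda>p. 1 * F p + (-1) * G p) \<in> eigenspace lam"
      by (rule eigenspace_linear[OF F ws(3)])
    fix z :: complex assume z: "norm z < 1"
    have "(\<lambda>n. weight_term lam (\<lambda>n. coef n F) (\<lambda>n. swap_coef n F) n (z, 0)) = (\<lambda>n. coef n F * z ^ n)"
      by (auto simp: weight_term_def weight_data z swap_coef_def)
    then have "(\<lambda>n. coef n F * z ^ n) sums G (z, 0)"
      using ws(1)[of "(z, 0)"] z by (simp add: mem_bidisk)
    then show "1 * F (z, 0) + (-1) * G (z, 0) = 0"
      using sums_unique2[OF coef_sums[OF hF z]] by auto
    \<comment> \<open>On z = 0 the constant term comes from \<open>coef 0 F\<close>, as
      \<open>swap_coef 0 F\<close> is 0. It is the right one because \<open>coef 0 F\<close> and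
      \<open>coef 0 (F \<circ> prod.swap)\<close> both equal F(0,0).\<close>
    have "(\<lambda>n. weight_term lam (\<lambda>n. coef n F) (\<lambda>n. swap_coef n F) n (0, z))
        = (\<lambda>n. coef n (F \<circ> prod.swap) * z ^ n)"
      by (rule ext) (simp add: weight_term_def weight_data z swap_coef_def coef_0)
    then have "(\<lambda>n. coef n (F \<circ> prod.swap) * z ^ n) sums G (0, z)"
      using ws(1)[of "(0, z)"] z by (simp add: mem_bidisk)
    then show "1 * F (0, z) + (-1) * G (0, z) = 0"
      using sums_unique2[OF coef_sums[OF hS z]] by auto
  qed
  then show ?thesis by (auto simp: fun_eq_iff G_def)
qed

section \<open>Invariant subspaces\<close>

lemma invariant_subset: "moebius_invariant_subspace lam Y \<Longrightarrow> Y \<subseteq> eigenspace lam"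
  unfolding moebius_invariant_subspace_def by (metis closedin_subset topspace_subtopology le_inf_iff)

text \<open>\<open>Y\<close> is closed only relative to the eigenspace, so it is the intersection of
  the eigenspace with a closed C. Approximation yields membership in C; membership in the eigenspace
  has to be supplied.\<close>

lemma invariant_approx:
  assumes Y: "moebius_invariant_subspace lam Y" and F: "F \<in> eigenspace lam"
    and ap: "\<And>K e. compact K \<Longrightarrow> K \<subseteq> bidisk \<Longrightarrow> 0 < e \<Longrightarrow> \<exists>G\<in>Y. \<forall>p\<in>K. dist (G p) (F p) < e"
  shows "F \<in> Y"
proof -
  obtain C where C: "closedin (hol_topology bidisk) C" "Y = C \<inter> eigenspace lam"
    using Y unfolding moebius_invariant_subspace_def closedin_subtopology by blast
  have sub: "Y \<subseteq> hol_space bidisk" using invariant_subset[OF Y] by (auto simp: eigenspace_def)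
  have "F \<in> hol_topology bidisk closure_of Y"
    unfolding closure_of_hol_topology[OF sub] using F ap by (auto simp: eigenspace_def)
  moreover have "hol_topology bidisk closure_of Y \<subseteq> C"
    by (rule closure_of_minimal) (use C in auto)
  ultimately show ?thesis using C(2) F by blast
qed

lemma invariant_linear:
  assumes Y: "moebius_invariant_subspace lam Y"
  shows "F \<in> Y \<Longrightarrow> G \<in> Y \<Longrightarrow> (\<lambda>p. F p + G p) \<in> Y"
    and "F \<in> Y \<Longrightarrow> (\<lambda>p. c * F p) \<in> Y" and "(\<lambda>_. 0) \<in> Y"
proof -
  have s: "cfun.subspace Y" using Y by (simp add: moebius_invariant_subspace_def)
  show "F \<in> Y \<Longrightarrow> G \<in> Y \<Longrightarrow> (\<lambda>p. F p + G p) \<in> Y"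
    using cfun.subspace_add[OF s, of F G] by (simp add: plus_fun_def)
  show "F \<in> Y \<Longrightarrow> (\<lambda>p. c * F p) \<in> Y" by (rule cfun.subspace_scale[OF s])
  show "(\<lambda>_. 0) \<in> Y" using cfun.subspace_0[OF s] by (simp add: zero_fun_def)
qed

lemma invariant_sum:
  assumes Y: "moebius_invariant_subspace lam Y"
  shows "(\<And>i. i \<in> I \<Longrightarrow> F i \<in> Y) \<Longrightarrow> (\<lambda>p. \<Sum>i\<in>I. a i * F i p) \<in> Y"
  by (induction I rule: infinite_finite_induct) (auto intro!: invariant_linear[OF Y])

text \<open>\<open>Aut_bidisk\<close> speaks of \<open>inv_into bidisk T\<close>, which agrees with
  the explicit inverse T' on the bidisk. Since the bidisk is open, this transfers
  holomorphy.\<close>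

lemma moebius_group_bidiskI:
  assumes maps: "\<And>p. p \<in> bidisk \<Longrightarrow> T p \<in> bidisk" "\<And>p. p \<in> bidisk \<Longrightarrow> T' p \<in> bidisk"
    and inv: "\<And>p. p \<in> bidisk \<Longrightarrow> T' (T p) = p" "\<And>p. p \<in> bidisk \<Longrightarrow> T (T' p) = p"
    and hol: "holomorphic2_map_on T bidisk" "holomorphic2_map_on T' bidisk"
    and M: "M \<in> moebius_group"
      "\<And>z w. (z, w) \<in> bidisk \<Longrightarrow> M (Some z, Some w) = (Some (fst (T (z, w))), Some (snd (T (z, w))))"
  shows "T \<in> moebius_group_bidisk"
proof -
  have inj: "inj_on T bidisk" using inv(1) by (metis inj_onI)
  have "T ` bidisk = bidisk" using maps inv(2) by (metis image_eqI image_subset_iff subsetI subset_antisym)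
  then have "bij_betw T bidisk bidisk" using inj by (simp add: bij_betw_def)
  moreover have i: "inv_into bidisk T p = T' p" if "p \<in> bidisk" for p
    using inv_into_f_eq[OF inj maps(2)[OF that] inv(2)[OF that]] .
  have "holomorphic2_map_on (inv_into bidisk T) bidisk"
  proof -
    have "holomorphic2_on (fst \<circ> inv_into bidisk T) bidisk"
      by (rule holomorphic2_on_cong[OF open_bidisk, of "fst \<circ> T'"])
        (use hol(2) i in \<open>simp_all add: holomorphic2_map_on_def\<close>)
    moreover have "holomorphic2_on (snd \<circ> inv_into bidisk T) bidisk"
      by (rule holomorphic2_on_cong[OF open_bidisk, of "snd \<circ> T'"])
        (use hol(2) i in \<open>simp_all add: holomorphic2_map_on_def\<close>)
    ultimately show ?thesis by (simp add: holomorphic2_map_on_def)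
  qed
  ultimately have "T \<in> Aut_bidisk" using hol(1) by (simp add: Aut_bidisk_def)
  then show ?thesis unfolding moebius_group_bidisk_def using M by blast
qed

text \<open>The second family of the group with \<psi> the identity, since inverting twice is the
  identity on the whole sphere.\<close>

lemma swap_in_moebius_group: "prod.swap \<in> moebius_group_bidisk"
proof (rule moebius_group_bidiskI[where T' = prod.swap])
  have id: "moebius 1 0 0 1 = (\<lambda>x. x)"
  proof
    fix x show "moebius 1 0 0 1 x = x" by (cases x) auto
  qed
  have ii: "sphere_inverse (sphere_inverse x) = x" for x by (cases x) auto
  have mem: "moebius 1 0 0 1 \<in> moebius_maps" unfolding moebius_maps_def by force
  show "(\<lambda>(z, w). (moebius 1 0 0 1 w, sphere_inverse (moebius 1 0 0 1 (sphere_inverse z)))) \<in> moebius_group"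
    unfolding moebius_group_def using mem by blast
  show "(case (Some z, Some w) of (z, w) \<Rightarrow> (moebius 1 0 0 1 w, sphere_inverse (moebius 1 0 0 1 (sphere_inverse z))))
      = (Some (fst (prod.swap (z, w))), Some (snd (prod.swap (z, w))))" for z w
    unfolding id ii by simp
  have "(fst :: complex \<times> complex \<Rightarrow> _) \<circ> prod.swap = snd" "(snd :: complex \<times> complex \<Rightarrow> _) \<circ> prod.swap = fst"
    by auto
  then show "holomorphic2_map_on prod.swap bidisk" "holomorphic2_map_on prod.swap bidisk"
    unfolding holomorphic2_map_on_def by (auto simp: holomorphic2_on_fst holomorphic2_on_snd)
qed auto

lemma moebius_in_group:
  assumes "a * d - b * c \<noteq> 0"
  shows "(\<lambda>(z, w). (moebius a b c d z, sphere_inverse (moebius a b c d (sphere_inverse w)))) \<in> moebius_group"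
  unfolding moebius_group_def moebius_maps_def using assms by blast

text \<open>The member of the first family for \<psi>(z) = c z, as 1/(c/w) = w/c. It preserves zw,
  and so for |c| = 1 it multiplies weight n by c^n and the swap of weight n by c^(-n).\<close>

definition rotation :: "complex \<Rightarrow> complex \<times> complex \<Rightarrow> complex \<times> complex"
  where "rotation c = (\<lambda>(z, w). (c * z, w / c))"

lemma rotation_in_moebius_group:
  assumes c: "norm c = 1"
  shows "rotation c \<in> moebius_group_bidisk"
proof (rule moebius_group_bidiskI[where T' = "rotation (1 / c)"])
  have c0: "c \<noteq> 0" using c by auto
  show "(\<lambda>(z, w). (moebius c 0 0 1 z, sphere_inverse (moebius c 0 0 1 (sphere_inverse w)))) \<in> moebius_group"
    by (rule moebius_in_group) (use c0 in simp)
  have h: "holomorphic2_map_on (rotation d) bidisk" if "d \<noteq> 0" for d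
  proof -
    have "fst \<circ> rotation d = (\<lambda>p. d * fst p)" "snd \<circ> rotation d = (\<lambda>p. snd p / d)"
      by (auto simp: rotation_def)
    then show ?thesis unfolding holomorphic2_map_on_def
      using that by (auto intro!: holomorphic2_intros)
  qed
  show "holomorphic2_map_on (rotation c) bidisk" "holomorphic2_map_on (rotation (1 / c)) bidisk"
    using h c0 by auto
qed (use c in \<open>auto simp: rotation_def mem_bidisk norm_mult norm_divide\<close>)

text \<open>The hyperbolic translation \<psi>(z) = (z - a)/(1 - a z). For real a the companion map
  1/\<psi>(1/w) has the same formula.\<close>

definition boost :: "real \<Rightarrow> complex \<times> complex \<Rightarrow> complex \<times> complex"
  where "boost a = (\<lambda>(z, w). ((z - of_real a) / (1 - of_real a * z), (w - of_real a) / (1 - of_real a * w)))"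

lemma boost_in_moebius_group:
  assumes a: "\<bar>a\<bar> < 1"
  shows "boost a \<in> moebius_group_bidisk"
proof (rule moebius_group_bidiskI[where T' = "boost (- a)"])
  have bM: "boost b = (\<lambda>(z, w). (Moebius_function 0 (of_real b) z, Moebius_function 0 (of_real b) w))" for b
    by (auto simp: boost_def Moebius_function_simple)
  have na: "norm (of_real a :: complex) < 1" "norm (- of_real a :: complex) < 1" using a by auto
  show "boost a p \<in> bidisk" "boost (- a) p \<in> bidisk" if "p \<in> bidisk" for p
    using that Moebius_function_norm_lt_1 na by (cases p; auto simp: bM mem_bidisk)+
  show "boost (- a) (boost a p) = p" "boost a (boost (- a) p) = p" if "p \<in> bidisk" for p
    using that Moebius_function_compose[of "- of_real a" "of_real a"] Moebius_function_compose[of "of_real a" "- of_real a"] na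
    by (cases p; auto simp: bM mem_bidisk)+
  have nz: "1 - of_real b * z \<noteq> 0" if "\<bar>b\<bar> < 1" "norm z < 1" for b and z :: complex
  proof -
    have "norm (of_real b * z) \<le> \<bar>b\<bar> * 1" unfolding norm_mult by (intro mult_mono) (use that in auto)
    then show ?thesis using that by auto
  qed
  have h: "holomorphic2_map_on (boost b) bidisk" if "\<bar>b\<bar> < 1" for b
  proof -
    have "fst \<circ> boost b = (\<lambda>p. (fst p - of_real b) / (1 - of_real b * fst p))"
      "snd \<circ> boost b = (\<lambda>p. (snd p - of_real b) / (1 - of_real b * snd p))"
      by (auto simp: boost_def)
    moreover have "1 - of_real b * fst p \<noteq> 0" "1 - of_real b * snd p \<noteq> 0" if "p \<in> bidisk" for p
      using nz[OF \<open>\<bar>b\<bar> < 1\<close>] that by (cases p; auto simp: mem_bidisk)+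
    ultimately show ?thesis unfolding holomorphic2_map_on_def
      by (auto intro!: holomorphic2_intros)
  qed
  show "holomorphic2_map_on (boost a) bidisk" "holomorphic2_map_on (boost (- a)) bidisk"
    using h a by auto
  let ?a = "of_real a :: complex"
  have "?a * ?a \<noteq> 1"
  proof
    assume "?a * ?a = 1"
    then have "norm ?a * norm ?a = 1" by (metis norm_mult norm_one)
    moreover have "norm ?a * norm ?a < 1 * 1" by (intro mult_strict_mono) (use a in auto)
    ultimately show False by simp
  qed
  then show "(\<lambda>(z, w). (moebius 1 (- ?a) (- ?a) 1 z, sphere_inverse (moebius 1 (- ?a) (- ?a) 1 (sphere_inverse w)))) \<in> moebius_group"
    by (intro moebius_in_group) simp
  fix z w assume p: "(z, w) \<in> bidisk"
  have z: "1 - ?a * z \<noteq> 0" "1 - ?a * w \<noteq> 0" using nz[OF a] p by (auto simp: mem_bidisk)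
  \<comment> \<open>The points w = 0 and w = a are treated separately because there 1/w,
    respectively \<psi>(1/w), is infinite.\<close>
  have "sphere_inverse (moebius 1 (- ?a) (- ?a) 1 (sphere_inverse (Some w))) = Some ((w - ?a) / (1 - ?a * w))"
  proof (cases "w = 0")
    case True
    then show ?thesis by (cases "a = 0") (auto simp: field_simps)
  next
    case False
    show ?thesis
    proof (cases "w = ?a")
      case True
      then show ?thesis using False by simp
    next
      case wa: False
      have "- ?a * (1 / w) + 1 = (w - ?a) / w" "1 * (1 / w) + - ?a = (1 - ?a * w) / w"
        using False by (auto simp: field_simps)
      then show ?thesis using False wa z by (simp add: divide_simps)
    qed
  qed
  then show "(case (Some z, Some w) of (z, w) \<Rightarrow>
      (moebius 1 (- ?a) (- ?a) 1 z, sphere_inverse (moebius 1 (- ?a) (- ?a) 1 (sphere_inverse w))))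
      = (Some (fst (boost a (z, w))), Some (snd (boost a (z, w))))"
    using z by (simp add: boost_def)
qed

lemma invariant_compose:
  assumes "moebius_invariant_subspace lam Y" "F \<in> Y" "T \<in> moebius_group_bidisk"
  shows "(\<lambda>p. if p \<in> bidisk then F (T p) else 0) \<in> Y"
  using assms unfolding moebius_invariant_subspace_def by blast

lemma invariant_swap:
  assumes Y: "moebius_invariant_subspace lam Y" and F: "F \<in> Y"
  shows "F \<circ> prod.swap \<in> Y"
proof -
  have FX: "F \<in> eigenspace lam" using invariant_subset[OF Y] F by blast
  have "(\<lambda>p. if p \<in> bidisk then F (prod.swap p) else 0) = F \<circ> prod.swap"
    using eigenspace_outside[OF eigenspace_swap[OF FX]] by (auto simp: fun_eq_iff)
  then show ?thesis using invariant_compose[OF Y F swap_in_moebius_group] by simp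
qed

lemma weight_rotation:
  assumes "c \<noteq> 0" "(z, w) \<in> bidisk" "norm c = 1"
  shows "weight lam n (rotation c (z, w)) = c ^ n * weight lam n (z, w)"
    and "weight lam n (prod.swap (rotation c (z, w))) = weight lam n (w, z) / c ^ n"
  using assms
  by (auto simp: weight_def weight_fun_def rotation_def mem_bidisk norm_mult norm_divide power_mult_distrib power_divide mult.commute)

text \<open>Averaging over the rotations by \<open>N\<close>-th roots of unity kills all weights but those
  congruent to \<open>n\<close> modulo \<open>N\<close>.\<close>

lemma invariant_weight:
  assumes Y: "moebius_invariant_subspace lam Y" and F: "F \<in> Y" and nz: "coef n F \<noteq> 0"
  shows "weight lam n \<in> Y"
proof -
  have FX: "F \<in> eigenspace lam" using invariant_subset[OF Y] F by blast
  define p where "p = (\<lambda>n. coef n F)"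
  define q where "q = (\<lambda>n. swap_coef n F)"
  have pq: "disk_coeffs p" "disk_coeffs q"
    unfolding p_def q_def by (rule disk_coeffs_coef[OF eigenspace_holomorphic2[OF FX]], rule disk_coeffs_swap_coef[OF FX])
  have Fs: "(\<lambda>k. weight_term lam p q k x) sums F x" if "x \<in> bidisk" for x
    using weight_series(1)[OF pq that, of lam] eigenspace_expansion[OF FX] by (simp add: p_def q_def)
  have "(\<lambda>x. p n * weight lam n x) \<in> Y"
  proof (rule invariant_approx[OF Y])
    show "(\<lambda>x. p n * weight lam n x) \<in> eigenspace lam" by (intro eigenspace_scale weight_eigenspace)
    fix K and e :: real assume K: "compact K" "K \<subseteq> bidisk" and e: "0 < e"
    obtain r where r: "0 < r" "r < 1" "\<And>z w. (z, w) \<in> K \<Longrightarrow> norm z \<le> r \<and> norm w \<le> r"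
      using compact_bidisk_radius[OF K] by metis
    obtain b where b: "summable b" "\<And>k. 0 \<le> b k" "\<And>k z w. norm z \<le> r \<Longrightarrow> norm w \<le> r \<Longrightarrow>
        norm (p k * weight lam k (z, w)) + norm (q k * weight lam k (w, z)) \<le> b k"
      using weight_term_bound[OF pq r(1,2), of lam] by metis
    obtain M0 where M0: "\<And>M. M \<ge> M0 \<Longrightarrow> norm (\<Sum>k. b (k + M)) < e"
      using suminf_exist_split[OF e b(1)] by blast
    \<comment> \<open>M > n puts weight n into the head of the series, M \<ge> M0 makes the tail of
      the majorant smaller than e. With N = M + n, an index k < M is congruent to n modulo N only if
      k = n, and k + n is congruent to 0 only if k = n = 0.\<close>
    define M where "M = max M0 (Suc n)"
    define N where "N = M + n"
    have N: "N \<ge> 1" "n < N" "M \<le> N" by (auto simp: N_def M_def)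
    define \<omega> where "\<omega> = exp (2 * of_real pi * \<i> * of_nat 1 / of_nat N)"
    have \<omega>k: "\<omega> ^ k = exp (2 * of_real pi * \<i> * of_nat k / of_nat N)" for k
      unfolding \<omega>_def by (simp add: exp_of_nat_mult[symmetric] mult_ac)
    have \<omega>eq: "\<omega> ^ k = \<omega> ^ l \<longleftrightarrow> k mod N = l mod N" for k l
      unfolding \<omega>k by (rule complex_root_unity_eq[OF N(1)])
    have \<omega>N: "\<omega> ^ N = 1" using \<omega>eq[of N 0] by simp
    have nw: "norm \<omega> = 1" by (simp add: \<omega>_def)
    have w0: "\<omega> \<noteq> 0" by (simp add: \<omega>_def)
    \<comment> \<open>Mean of the powers of x: 1 at x = 1 and 0 at the other N-th roots of
      unity.\<close>
    define \<alpha> where "\<alpha> = (\<lambda>x::complex. (\<Sum>j<N. x ^ j) / of_nat N)"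
    have \<alpha>1: "\<alpha> 1 = 1" using N by (simp add: \<alpha>_def)
    have \<alpha>0: "\<alpha> x = 0" if "x ^ N = 1" "x \<noteq> 1" for x
      using geometric_sum[of x N] that by (simp add: \<alpha>_def)
    have \<alpha>b: "norm (\<alpha> x) \<le> 1" if "norm x = 1" for x
    proof -
      have "norm (\<Sum>j<N. x ^ j) \<le> (\<Sum>j<N. norm (x ^ j))" by (rule norm_sum)
      also have "\<dots> = real N" using that by (simp add: norm_power)
      finally show ?thesis using N by (simp add: \<alpha>_def norm_divide)
    qed
    \<comment> \<open>A discrete Fourier coefficient of F along the rotations. Being a finite sum it
      stays in \<open>Y\<close>, and closedness is used only for the passage to the limit.\<close>
    define A where "A = (\<lambda>x. \<Sum>j<N. (1 / (of_nat N * (\<omega> ^ j) ^ n)) * (if x \<in> bidisk then F (rotation (\<omega> ^ j) x) else 0))"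
    have "A \<in> Y" unfolding A_def
      by (intro invariant_sum[OF Y] invariant_compose[OF Y F] rotation_in_moebius_group) (simp add: norm_power nw)
    moreover have "dist (A x) (p n * weight lam n x) < e" if xK: "x \<in> K" for x
    proof -
      obtain z w where x: "x = (z, w)" by (cases x)
      have xb: "(z, w) \<in> bidisk" using xK K x by blast
      have rot: "rotation (\<omega> ^ j) (z, w) \<in> bidisk" for j
        using xb by (auto simp: rotation_def mem_bidisk norm_mult norm_divide norm_power nw)
      define a where "a = (\<lambda>k. \<alpha> (\<omega> ^ k / \<omega> ^ n) * (p k * weight lam k (z, w)) + \<alpha> (1 / (\<omega> ^ k * \<omega> ^ n)) * (q k * weight lam k (w, z)))"
      have "(\<lambda>k. \<Sum>j<N. (1 / (of_nat N * (\<omega> ^ j) ^ n)) * weight_term lam p q k (rotation (\<omega> ^ j) (z, w))) sums A (z, w)"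
      proof -
        have "A (z, w) = (\<Sum>j<N. (1 / (of_nat N * (\<omega> ^ j) ^ n)) * F (rotation (\<omega> ^ j) (z, w)))"
          using xb by (simp add: A_def)
        then show ?thesis by (simp only:) (intro sums_sum sums_mult Fs rot)
      qed
      moreover have "(\<Sum>j<N. (1 / (of_nat N * (\<omega> ^ j) ^ n)) * weight_term lam p q k (rotation (\<omega> ^ j) (z, w))) = a k" for k
      proof -
        have "(1 / (of_nat N * (\<omega> ^ j) ^ n)) * weight_term lam p q k (rotation (\<omega> ^ j) (z, w))
            = ((\<omega> ^ k / \<omega> ^ n) ^ j / of_nat N) * (p k * weight lam k (z, w))
              + ((1 / (\<omega> ^ k * \<omega> ^ n)) ^ j / of_nat N) * (q k * weight lam k (w, z))" for j
        proof -
          have "weight lam k (rotation (\<omega> ^ j) (z, w)) = (\<omega> ^ k) ^ j * weight lam k (z, w)"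
            "weight lam k (prod.swap (rotation (\<omega> ^ j) (z, w))) = weight lam k (w, z) / (\<omega> ^ k) ^ j"
            using weight_rotation[of "\<omega> ^ j" z w lam k] w0 xb nw
            by (simp_all add: norm_power power_commutes power_mult[symmetric] mult.commute)
          then show ?thesis
            using w0 N unfolding weight_term_def
            by (simp add: power_divide power_mult_distrib power_mult[symmetric] mult.commute[of n j] mult.commute[of k j] field_simps)
        qed
        then show ?thesis
          by (simp add: a_def \<alpha>_def sum.distrib sum_distrib_right sum_divide_distrib)
      qed
      ultimately have aA: "a sums A (z, w)" by simp
      have na: "norm (a k) \<le> b k" for k
      proof -
        have 1: "norm (\<alpha> (\<omega> ^ k / \<omega> ^ n)) \<le> 1" "norm (\<alpha> (1 / (\<omega> ^ k * \<omega> ^ n))) \<le> 1"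
          by (intro \<alpha>b; simp add: norm_divide norm_mult norm_power nw)+
        have "norm (a k) \<le> norm (\<alpha> (\<omega> ^ k / \<omega> ^ n)) * norm (p k * weight lam k (z, w))
            + norm (\<alpha> (1 / (\<omega> ^ k * \<omega> ^ n))) * norm (q k * weight lam k (w, z))"
          unfolding a_def by (metis norm_triangle_ineq norm_mult)
        also have "\<dots> \<le> 1 * norm (p k * weight lam k (z, w)) + 1 * norm (q k * weight lam k (w, z))"
          by (intro add_mono mult_right_mono 1) auto
        also have "\<dots> \<le> b k" using b(3)[of z w k] r(3)[of z w] xK x by simp
        finally show ?thesis .
      qed
      have ak: "a k = (if k = n then p n * weight lam n (z, w) else 0)" if "k < M" for k
      proof -
        have kN: "k < N" using that N by simp
        have P: "\<alpha> (\<omega> ^ k / \<omega> ^ n) = (if k = n then 1 else 0)"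
        proof (cases "k = n")
          case True
          then show ?thesis using w0 by (simp add: \<alpha>1)
        next
          case False
          then have "\<omega> ^ k \<noteq> \<omega> ^ n" using \<omega>eq kN N by simp
          then have "\<omega> ^ k / \<omega> ^ n \<noteq> 1" using w0 by simp
          moreover have "(\<omega> ^ k / \<omega> ^ n) ^ N = 1"
            by (simp add: power_divide power_mult[symmetric] mult.commute[of _ N]) (simp add: power_mult \<omega>N w0)
          ultimately show ?thesis using False \<alpha>0 by simp
        qed
        \<comment> \<open>For k = n = 0 the factor \<alpha> is 1, and the term vanishes because q 0
          = 0.\<close>
        have Q: "\<alpha> (1 / (\<omega> ^ k * \<omega> ^ n)) * (q k * weight lam k (w, z)) = 0"
        proof (cases "k = 0")
          case True
          then show ?thesis by (simp add: q_def swap_coef_def)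
        next
          case False
          then have "\<omega> ^ (k + n) \<noteq> \<omega> ^ 0" using \<omega>eq[of "k + n" 0] that by (simp add: N_def)
          then have "1 / (\<omega> ^ k * \<omega> ^ n) \<noteq> 1" by (simp add: power_add)
          moreover have "(1 / (\<omega> ^ k * \<omega> ^ n)) ^ N = 1"
            by (simp add: power_divide power_mult_distrib power_mult[symmetric] mult.commute[of _ N]) (simp add: power_mult \<omega>N w0)
          ultimately show ?thesis using \<alpha>0 by simp
        qed
        show ?thesis unfolding a_def P Q by simp
      qed
      have sa: "summable a" using aA sums_summable by blast
      have nM: "n < M" by (simp add: M_def)
      have "(\<Sum>k<M. a k) = (\<Sum>k<M. if k = n then p n * weight lam n (z, w) else 0)"
        by (rule sum.cong) (auto simp: ak)
      also have "\<dots> = p n * weight lam n (z, w)" using nM by simp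
      finally have "A (z, w) - p n * weight lam n (z, w) = (\<Sum>k. a (k + M))"
        using suminf_minus_initial_segment[OF sa, of M] sums_unique[OF aA] by simp
      also have "norm \<dots> \<le> (\<Sum>k. b (k + M))"
      proof (rule norm_suminf_le)
        show "norm (a (k + M)) \<le> b (k + M)" for k by (rule na)
        show "summable (\<lambda>k. b (k + M))" using b(1) by (simp add: summable_iff_shift)
      qed
      also have "\<dots> < e" using M0[of M] by (simp add: M_def abs_less_iff)
      finally show ?thesis by (simp add: x dist_norm)
    qed
    ultimately show "\<exists>G\<in>Y. \<forall>x\<in>K. dist (G x) (p n * weight lam n x) < e" by blast
  qed
  from invariant_linear(2)[OF Y this, of "1 / p n"] nz show ?thesis by (simp add: p_def)
qed

section \<open>First order effect of a hyperbolic translation\<close>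

lemma dz_power_eq: "(dz ^^ k) F = (\<lambda>(z, w). (deriv ^^ k) (\<lambda>\<zeta>. F (\<zeta>, w)) z)"
  by (induction k) (auto simp: fun_eq_iff dz_def)

text \<open>Allows the derivative of the k-th Taylor coefficient in z with respect to the second
  variable, the translation parameter, to be computed by differentiating the function first.\<close>

lemma dz_power_holomorphic2:
  assumes F: "holomorphic2_on F S" and S: "open S"
  shows "holomorphic2_on ((dz ^^ k) F) S"
    and "p \<in> S \<Longrightarrow> dw ((dz ^^ k) F) p = (dz ^^ k) (dw F) p"
proof -
  show h: "holomorphic2_on ((dz ^^ k) F) S" for k
    by (induction k) (auto intro: F holomorphic2_on_dz[OF _ S])
  show "p \<in> S \<Longrightarrow> dw ((dz ^^ k) F) p = (dz ^^ k) (dw F) p"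
  proof (induction k arbitrary: p)
    case (Suc k)
    have "dw ((dz ^^ Suc k) F) p = dz (dw ((dz ^^ k) F)) p"
      using dw_dz_commute[OF h S Suc.prems] by simp
    also have "\<dots> = dz ((dz ^^ k) (dw F)) p"
      by (rule dz_cong[OF S Suc.prems Suc.IH])
    finally show ?case by simp
  qed simp
qed

lemma higher_deriv_power_0: "(deriv ^^ k) (\<lambda>z. z ^ m) (0::complex) = (if k = m then fact k else 0)"
proof -
  have "(deriv ^^ k) (\<lambda>z. (z - 0) ^ m) (0::complex) = pochhammer (of_nat (Suc m - k)) k * (0 - 0) ^ (m - k)"
    by (rule higher_deriv_power)
  moreover have "Suc m - m = 1" by simp
  ultimately show ?thesis
    by (cases k m rule: linorder_cases) (auto simp: pochhammer_fact[symmetric] pochhammer_0_left)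
qed

text \<open>The weight composed with \<open>boost a\<close> on the line w = 0, where the second
  coordinate of \<open>boost a\<close> is -a. The real parameter is replaced by a complex one so
  that the two-variable calculus applies to (z, a).\<close>

definition boosted_weight :: "complex \<Rightarrow> nat \<Rightarrow> complex \<times> complex \<Rightarrow> complex"
  where "boosted_weight lam n = (\<lambda>(z, a). ((z - a) / (1 - a * z)) ^ n *
    radial (lam / 4) n (((z - a) / (1 - a * z)) * - a))"

text \<open>At a = 0 the quotient (z - a)/(1 - a z) has derivative z^2 - 1 in a, and the argument of
  the radial function has derivative -z, to be multiplied by \<open>radial_deriv_0\<close>. For |a|
  < 1/4 one has |z - a| |a| \<le> 5/16 and |1 - a z| \<ge> 3/4, so that argument stays in the unit
  disk.\<close>

lemma boosted_weight:
  shows "holomorphic2_on (boosted_weight lam n) (ball 0 1 \<times> ball 0 (1/4))"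
    and "norm z < 1 \<Longrightarrow> dw (boosted_weight lam n) (z, 0)
      = (of_nat n - lam / (4 * of_nat (Suc n))) * z ^ Suc n - of_nat n * z ^ (n - 1)"
proof -
  let ?f = "radial (lam / 4) n"
  have hf: "?f holomorphic_on ball 0 1" using radial_ode[of "lam / 4" n] by (simp add: radial_ode_def)
  have nz: "1 - a * z \<noteq> 0" and small: "((z - a) / (1 - a * z)) * - a \<in> ball 0 1"
    if "norm z < 1" "norm a < 1/4" for z a :: complex
  proof -
    have az: "norm (a * z) \<le> 1/4 * 1" unfolding norm_mult by (intro mult_mono) (use that in auto)
    then have n1: "norm (1 - a * z) \<ge> 3/4" using norm_triangle_ineq2[of 1 "a * z"] by simp
    then show nz: "1 - a * z \<noteq> 0" by auto
    have "norm (z - a) \<le> 5/4" using norm_triangle_ineq4[of z a] that by simp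
    then have "norm (z - a) * norm a \<le> 5/4 * (1/4)" by (intro mult_mono) (use that in auto)
    then have "norm (z - a) * norm a < norm (1 - a * z)" using n1 by simp
    then show "((z - a) / (1 - a * z)) * - a \<in> ball 0 1"
      using nz by (simp add: norm_mult norm_divide)
  qed
  have "holomorphic2_on (\<lambda>p. ((fst p - snd p) / (1 - snd p * fst p)) ^ n *
      ?f (((fst p - snd p) / (1 - snd p * fst p)) * ((-1) * snd p))) (ball 0 1 \<times> ball 0 (1/4))"
  proof (intro holomorphic2_intros holomorphic2_on_compose[OF _ hf open_ball])
    fix p :: "complex \<times> complex" assume p: "p \<in> ball 0 1 \<times> ball 0 (1/4)"
    show "1 - snd p * fst p \<noteq> 0" using nz p by auto
    then show "1 - snd p * fst p \<noteq> 0" .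
    show "(fst p - snd p) / (1 - snd p * fst p) * (- 1 * snd p) \<in> ball 0 1"
      using small[of "fst p" "snd p"] p by auto
  qed
  then show "holomorphic2_on (boosted_weight lam n) (ball 0 1 \<times> ball 0 (1/4))"
    by (simp add: boosted_weight_def case_prod_unfold)
  assume z: "norm z < 1"
  have df: "(?f has_field_derivative lam / 4 / of_nat (Suc n)) (at 0)"
    using holomorphic_derivI[OF hf open_ball, of 0 UNIV] by (simp add: radial_deriv_0)
  have B: "((\<lambda>a. (z - a) / (1 - a * z)) has_field_derivative z\<^sup>2 - 1) (at 0)"
    by (auto intro!: derivative_eq_intros simp: power2_eq_square)
  have c: "((\<lambda>a. ((z - a) / (1 - a * z)) * - a) has_field_derivative - z) (at 0)"
    by (auto intro!: derivative_eq_intros)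
  have fc: "((\<lambda>a. ?f (((z - a) / (1 - a * z)) * - a)) has_field_derivative lam / 4 / of_nat (Suc n) * - z) (at 0)"
    by (rule DERIV_chain2[where f = ?f and x = 0, OF _ c]) (use df in simp)
  have Bn: "((\<lambda>a. ((z - a) / (1 - a * z)) ^ n) has_field_derivative of_nat n * z ^ (n - 1) * (z\<^sup>2 - 1)) (at 0)"
    using DERIV_power[OF B, of n] by (simp add: mult_ac)
  have "((\<lambda>a. boosted_weight lam n (z, a)) has_field_derivative
      of_nat n * z ^ (n - 1) * (z\<^sup>2 - 1) + lam / 4 / of_nat (Suc n) * - z * z ^ n) (at 0)"
    using DERIV_mult[OF Bn fc] by (simp add: boosted_weight_def)
  then have "dw (boosted_weight lam n) (z, 0) = of_nat n * z ^ (n - 1) * (z\<^sup>2 - 1) + lam / 4 / of_nat (Suc n) * - z * z ^ n"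
    unfolding dw_def by (simp add: DERIV_imp_deriv)
  also have "of_nat n * z ^ (n - 1) * (z\<^sup>2 - 1) = of_nat n * z ^ Suc n - of_nat n * z ^ (n - 1)"
    by (cases n) (auto simp: algebra_simps power2_eq_square)
  finally show "dw (boosted_weight lam n) (z, 0)
      = (of_nat n - lam / (4 * of_nat (Suc n))) * z ^ Suc n - of_nat n * z ^ (n - 1)"
    by (simp add: algebra_simps del: of_nat_Suc)
qed

text \<open>The first order term in \<open>a\<close> of the coefficients of a boosted weight function decides which
  neighbouring weights an invariant subspace contains.\<close>

lemma invariant_step:
  assumes Y: "moebius_invariant_subspace lam Y" and n: "weight lam n \<in> Y"
    and nz: "(k = Suc n \<and> lam \<noteq> 4 * of_nat n * (of_nat n + 1)) \<or> n = Suc k"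
  shows "weight lam k \<in> Y"
proof (rule ccontr)
  assume "weight lam k \<notin> Y"
  \<comment> \<open>By \<open>invariant_weight\<close>, a missing weight k means that coefficient k
    vanishes on all of \<open>Y\<close>, in particular on every boost of weight n. Hence \<gamma>,
    the k-th z-derivative at 0 as a function of a, vanishes for small real a, and so does its
    derivative at 0.\<close>
  then have c0: "coef k F = 0" if "F \<in> Y" for F using invariant_weight[OF Y that] by blast
  let ?G = "boosted_weight lam n"
  let ?S = "ball (0::complex) 1 \<times> ball (0::complex) (1/4)"
  have S: "open ?S" by (intro open_Times open_ball)
  note hG = boosted_weight(1)[of lam n]
  define \<gamma> where "\<gamma> = (\<lambda>a. (dz ^^ k) ?G (0, a))"
  have \<gamma>0: "\<gamma> (of_real a) = 0" if a: "\<bar>a\<bar> < 1/4" for a :: real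
  proof -
    define F where "F = (\<lambda>p. if p \<in> bidisk then weight lam n (boost a p) else 0)"
    have "F \<in> Y" unfolding F_def
      by (rule invariant_compose[OF Y n boost_in_moebius_group]) (use a in simp)
    then have "(deriv ^^ k) (\<lambda>z. F (z, 0)) 0 = 0" using c0[of F] by (simp add: coef_def)
    moreover have "(deriv ^^ k) (\<lambda>z. F (z, 0)) 0 = (deriv ^^ k) (\<lambda>z. ?G (z, of_real a)) 0"
    proof (rule higher_deriv_cong_ev)
      have "\<forall>\<^sub>F z in nhds (0::complex). z \<in> ball 0 1" by (rule eventually_nhds_in_open) auto
      then show "\<forall>\<^sub>F z in nhds 0. F (z, 0) = ?G (z, of_real a)"
      proof eventually_elim
        case (elim z)
        have b: "(z, 0) \<in> bidisk" using elim by (simp add: mem_bidisk)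
        have "boost a (z, 0) \<in> bidisk"
          using boost_in_moebius_group[of a] a b
          unfolding moebius_group_bidisk_def Aut_bidisk_def bij_betw_def by auto
        then show ?case using b
          by (simp add: F_def boost_def boosted_weight_def weight_def weight_fun_def)
      qed
    qed simp
    ultimately show ?thesis by (simp add: \<gamma>_def dz_power_eq)
  qed
  have "(\<lambda>a. (dz ^^ k) ?G (0, a)) field_differentiable at 0"
    by (rule holomorphic2_on_fst_snd(2)[OF dz_power_holomorphic2(1)[OF hG S]]) auto
  then have "(\<gamma> has_field_derivative dw ((dz ^^ k) ?G) (0, 0)) (at 0)"
    unfolding \<gamma>_def dw_def by (simp add: field_differentiable_derivI)
  then have lim: "((\<lambda>h. (\<gamma> (0 + h) - \<gamma> 0) / h) \<longlongrightarrow> dw ((dz ^^ k) ?G) (0, 0)) (at 0)"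
    unfolding DERIV_def .
  \<comment> \<open>Only real parameters are translations, so the derivative of \<gamma> is computed
    along the real sequence 1/(j+6), which stays below 1/4.\<close>
  define h :: "nat \<Rightarrow> complex" where "h = (\<lambda>j. of_real (inverse (real (Suc j + 5))))"
  have "(\<lambda>j. inverse (real (Suc (j + 5)))) \<longlonglongrightarrow> 0"
    by (rule LIMSEQ_ignore_initial_segment[OF LIMSEQ_inverse_real_of_nat])
  then have "h \<longlonglongrightarrow> of_real 0" unfolding h_def by (intro tendsto_of_real) simp
  moreover have "h j \<noteq> 0" for j unfolding h_def of_real_eq_0_iff by simp
  ultimately have "filterlim h (at 0) sequentially"
    unfolding filterlim_at by simp
  from filterlim_compose[OF lim this]
  have "(\<lambda>j. (\<gamma> (0 + h j) - \<gamma> 0) / h j) \<longlonglongrightarrow> dw ((dz ^^ k) ?G) (0, 0)" .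
  moreover have "(\<gamma> (0 + h j) - \<gamma> 0) / h j = 0" for j
  proof -
    have "inverse (real (Suc j + 5)) < 1/4" by (simp add: field_simps)
    then have "\<gamma> (h j) = 0" unfolding h_def by (intro \<gamma>0) simp
    moreover have "\<gamma> 0 = 0" using \<gamma>0[of 0] by simp
    ultimately show ?thesis by simp
  qed
  ultimately have "(\<lambda>_::nat. 0) \<longlonglongrightarrow> dw ((dz ^^ k) ?G) (0, 0)" by (simp only:)
  then have "dw ((dz ^^ k) ?G) (0, 0) = 0" by (simp only: LIMSEQ_const_iff)
  then have "(dz ^^ k) (dw ?G) (0, 0) = 0"
    using dz_power_holomorphic2(2)[OF hG S, of "(0, 0)"] by simp
  then have 0: "(deriv ^^ k) (\<lambda>z. dw ?G (z, 0)) 0 = 0" by (simp add: dz_power_eq)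
  define A where "A = of_nat n - lam / (4 * of_nat (Suc n))"
  have "(deriv ^^ k) (\<lambda>z. dw ?G (z, 0)) 0 = (deriv ^^ k) (\<lambda>z. A * z ^ Suc n - of_nat n * z ^ (n - 1)) 0"
  proof (rule higher_deriv_cong_ev)
    have "\<forall>\<^sub>F z in nhds (0::complex). z \<in> ball 0 1" by (rule eventually_nhds_in_open) auto
    then show "\<forall>\<^sub>F z in nhds 0. dw ?G (z, 0) = A * z ^ Suc n - of_nat n * z ^ (n - 1)"
      by eventually_elim (simp add: boosted_weight(2) A_def)
  qed simp
  also have "\<dots> = (deriv ^^ k) (\<lambda>z. A * z ^ Suc n) 0 - (deriv ^^ k) (\<lambda>z. of_nat n * z ^ (n - 1)) 0"
    by (rule higher_deriv_diff[of _ UNIV]) (auto intro!: holomorphic_intros)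
  also have "\<dots> = A * (deriv ^^ k) (\<lambda>z. z ^ Suc n) 0 - of_nat n * (deriv ^^ k) (\<lambda>z. z ^ (n - 1)) 0"
    by (intro arg_cong2[of _ _ _ _ minus] higher_deriv_cmult[of _ UNIV]) (auto intro!: holomorphic_intros)
  finally have e: "A * (if k = Suc n then fact k else 0) - of_nat n * (if k = n - 1 then fact k else 0) = 0"
    unfolding higher_deriv_power_0 0 by simp
  \<comment> \<open>k = n + 1 isolates A, which vanishes exactly for lam = 4n(n+1); n = k + 1
    isolates the coefficient -n, which is then nonzero.\<close>
  from nz show False
  proof
    assume k: "k = Suc n \<and> lam \<noteq> 4 * of_nat n * (of_nat n + 1)"
    then have "A * fact k = 0" using e by (simp split: if_splits)
    then have "A = 0" by simp
    then have "lam = 4 * of_nat n * (of_nat n + 1)"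
      by (simp add: A_def field_simps del: of_nat_Suc) (simp add: algebra_simps)
    then show False using k by blast
  next
    assume "n = Suc k"
    then show False using e by (simp del: of_nat_Suc)
  qed
qed

text \<open>Defined by vanishing coefficients so that one inclusion is immediate once the missing
  weights of an invariant subspace are known; the finite expansion gives the other.\<close>

definition weight_space :: "complex \<Rightarrow> nat \<Rightarrow> (complex \<times> complex \<Rightarrow> complex) set"
  where "weight_space lam m = {F \<in> eigenspace lam. \<forall>k>m. coef k F = 0 \<and> swap_coef k F = 0}"

lemma invariant_weight_term:
  assumes Y: "moebius_invariant_subspace lam Y" and n: "weight lam n \<in> Y"
  shows "weight_term lam p q n \<in> Y"
proof -
  have "(\<lambda>x. p n * weight lam n x + q n * (weight lam n \<circ> prod.swap) x) \<in> Y"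
    by (intro invariant_linear[OF Y] n invariant_swap[OF Y n])
  then show ?thesis by (simp add: weight_term_def)
qed

lemma weight_space_expansion:
  assumes F: "F \<in> weight_space lam m"
  shows "F = (\<lambda>x. \<Sum>k\<le>m. weight_term lam (\<lambda>n. coef n F) (\<lambda>n. swap_coef n F) k x)"
proof
  fix x
  have "(\<lambda>k. weight_term lam (\<lambda>n. coef n F) (\<lambda>n. swap_coef n F) k x) sums
      (\<Sum>k\<le>m. weight_term lam (\<lambda>n. coef n F) (\<lambda>n. swap_coef n F) k x)"
    by (rule sums_finite) (use F in \<open>auto simp: weight_term_def weight_space_def\<close>)
  moreover have "F x = weight_series lam (\<lambda>n. coef n F) (\<lambda>n. swap_coef n F) x"
    using eigenspace_expansion[of F lam] F by (simp add: weight_space_def)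
  ultimately show "F x = (\<Sum>k\<le>m. weight_term lam (\<lambda>n. coef n F) (\<lambda>n. swap_coef n F) k x)"
    by (simp add: weight_series_def sums_iff)
qed

text \<open>Downward steps are never blocked, so the n with \<open>weight lam n\<close> in
  \<open>Y\<close> form an initial segment containing 0. If it is everything, expansion and
  closedness give the full eigenspace; if it ends at m, the blocked step to m + 1 forces lam =
  4m(m+1).\<close>

theorem invariant_classification:
  assumes Y: "moebius_invariant_subspace lam Y" and Y0: "Y \<noteq> {0}"
  shows "Y = eigenspace lam \<or> (\<exists>m::nat. lam = 4 * of_nat m * (of_nat m + 1) \<and> Y = weight_space lam m)"
proof -
  have YX: "Y \<subseteq> eigenspace lam" by (rule invariant_subset[OF Y])
  have swapc: "weight lam k \<in> Y" if "F \<in> Y" "swap_coef k F \<noteq> 0" for F k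
    using invariant_weight[OF Y invariant_swap[OF Y that(1)], of k] that(2)
    by (auto simp: swap_coef_def split: if_splits)
  have "\<exists>n. weight lam n \<in> Y"
  proof -
    obtain F where F: "F \<in> Y" "F \<noteq> (\<lambda>_. 0)"
      using Y0 invariant_linear(3)[OF Y] by (auto simp: zero_fun_def)
    have "\<exists>n. coef n F \<noteq> 0 \<or> swap_coef n F \<noteq> 0"
    proof (rule ccontr)
      assume "\<not> ?thesis"
      then have "F \<in> weight_space lam 0" "coef 0 F = 0" "swap_coef 0 F = 0"
        using F(1) YX by (auto simp: weight_space_def)
      from weight_space_expansion[OF this(1)] this(2,3) have "F = (\<lambda>_. 0)"
        by (simp add: weight_term_def)
      then show False using F(2) by blast
    qed
    then show ?thesis using invariant_weight[OF Y F(1)] swapc[OF F(1)] by blast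
  qed
  then obtain n0 where n0: "weight lam n0 \<in> Y" by blast
  have down: "weight lam i \<in> Y" if "i \<le> j" "weight lam j \<in> Y" for i j
    using that by (induction rule: inc_induct) (auto intro: invariant_step[OF Y])
  have w0: "weight lam 0 \<in> Y" by (rule down[OF _ n0]) simp
  show ?thesis
  proof (cases "\<forall>n. weight lam n \<in> Y")
    case True
    have "F \<in> Y" if F: "F \<in> eigenspace lam" for F
    proof (rule invariant_approx[OF Y F])
      fix K and e :: real assume K: "compact K" "K \<subseteq> bidisk" and e: "0 < e"
      let ?p = "\<lambda>n. coef n F" and ?q = "\<lambda>n. swap_coef n F"
      have "uniform_limit K (\<lambda>N x. \<Sum>n<N. weight_term lam ?p ?q n x) F sequentially"
        using weight_series(2)[OF disk_coeffs_coef[OF eigenspace_holomorphic2[OF F]] disk_coeffs_swap_coef[OF F] K, of lam]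
          eigenspace_expansion[OF F] by simp
      then have "\<forall>\<^sub>F N in sequentially. \<forall>x\<in>K. dist (\<Sum>n<N. weight_term lam ?p ?q n x) (F x) < e"
        using e by (rule uniform_limitD)
      then obtain N where N: "\<forall>x\<in>K. dist (\<Sum>n<N. weight_term lam ?p ?q n x) (F x) < e"
        unfolding eventually_sequentially by blast
      have "(\<lambda>x. \<Sum>n<N. 1 * weight_term lam ?p ?q n x) \<in> Y"
        by (intro invariant_sum[OF Y] invariant_weight_term[OF Y]) (use True in auto)
      with N show "\<exists>G\<in>Y. \<forall>x\<in>K. dist (G x) (F x) < e"
        by (intro bexI[of _ "\<lambda>x. \<Sum>n<N. weight_term lam ?p ?q n x"]) auto
    qed
    then show ?thesis using YX by blast
  next
    case False
    define N where "N = (LEAST n. weight lam n \<notin> Y)"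
    have "\<exists>n. weight lam n \<notin> Y" using False by blast
    then have N: "weight lam N \<notin> Y" unfolding N_def by (rule LeastI_ex)
    have less: "weight lam n \<in> Y" if "n < N" for n using that not_less_Least unfolding N_def by blast
    obtain m where m: "N = Suc m" using N w0 by (cases N) auto
    have lam: "lam = 4 * of_nat m * (of_nat m + 1)"
      using invariant_step[OF Y less[of m], of N] N m by auto
    have above: "weight lam k \<notin> Y" if "k > m" for k
      using down[of N k] N m that by auto
    have "Y = weight_space lam m"
    proof
      show "Y \<subseteq> weight_space lam m"
        using YX above invariant_weight[OF Y] swapc by (fastforce simp: weight_space_def)
      show "weight_space lam m \<subseteq> Y"
      proof
        fix F assume F: "F \<in> weight_space lam m"
        have "(\<lambda>x. \<Sum>k\<le>m. 1 * weight_term lam (\<lambda>n. coef n F) (\<lambda>n. swap_coef n F) k x) \<in> Y"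
          by (intro invariant_sum[OF Y] invariant_weight_term[OF Y] less) (use m in auto)
        then show "F \<in> Y" using weight_space_expansion[OF F] by simp
      qed
    qed
    then show ?thesis using lam by blast
  qed
qed

section \<open>Extension to \<open>Omega_plus\<close>\<close>

lemma holomorphic2_on_Un:
  "holomorphic2_on F S \<Longrightarrow> holomorphic2_on F T \<Longrightarrow> holomorphic2_on F (S \<union> T)"
  unfolding holomorphic2_on_def by blast

text \<open>In the coordinates \<open>v = z w / (1 - z w)\<close> and \<open>w\<close> the set \<open>Omega_plus\<close> without the line
  \<open>w = 0\<close> becomes \<open>\<complex> \<times> (\<complex> - {0})\<close>; the points with \<open>z = \<infinity>\<close> correspond to \<open>v = -1\<close>.\<close>

definition cone_fun :: "(sphere \<times> sphere \<Rightarrow> complex) \<Rightarrow> complex \<times> complex \<Rightarrow> complex"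
  where "cone_fun G = (\<lambda>(v, w). if v = 0 then G (Some 0, Some w)
    else G (sphere_inverse (Some (w * (1 + v) / v)), Some w))"

lemma cone_fun_finite:
  assumes "w \<noteq> 0" "v \<noteq> - 1"
  shows "cone_fun G (v, w) = G (Some (v / ((1 + v) * w)), Some w)"
proof -
  have "1 + v \<noteq> 0" using assms(2) by (metis add.commute eq_neg_iff_add_eq_0)
  then show ?thesis using assms
    by (cases "v = 0") (simp_all add: cone_fun_def mult.commute del: distrib_left_numeral)
qed

text \<open>Two charts cover the domain: for v \<noteq> -1 the point z = v/((1+v) w) is finite and
  zw = v/(1+v) differs from 1; for v \<noteq> 0 the coordinate 1/z = w (1+v)/v is finite, with z
  infinite at v = -1.\<close>

lemma cone_fun_holomorphic:
  assumes G: "sphere_holomorphic2_on G Omega_plus"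
  shows "holomorphic2_on (cone_fun G) (UNIV \<times> (- {0}))"
proof -
  have SS: "holomorphic2_on (\<lambda>p. G (Some (fst p), Some (snd p))) {(z, w). (Some z, Some w) \<in> Omega_plus}"
    and IS: "holomorphic2_on (\<lambda>p. G (sphere_inverse (Some (fst p)), Some (snd p)))
      {(z, w). (sphere_inverse (Some z), Some w) \<in> Omega_plus}"
    using G unfolding sphere_holomorphic2_on_def sphere_params_def by (auto simp: case_prod_unfold)
  let ?A = "(- {-1}) \<times> (- {0}) :: (complex \<times> complex) set"
  let ?B = "(- {0}) \<times> (- {0}) :: (complex \<times> complex) set"
  have v1: "1 + v \<noteq> 0" if "v \<noteq> - 1" for v :: complex
    using that by (metis add.commute eq_neg_iff_add_eq_0)
  have O1: "(Some (v / ((1 + v) * w)), Some w) \<in> Omega_plus" if "v \<noteq> - 1" "w \<noteq> 0" for v w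
  proof -
    have "v / ((1 + v) * w) * w = v / (1 + v)" using that by simp
    moreover have "v / (1 + v) \<noteq> 1" using v1[OF that(1)] by (simp add: divide_eq_1_iff)
    ultimately show ?thesis by (simp add: Omega_plus_def Omega_def)
  qed
  have O2: "(sphere_inverse (Some (w * (1 + v) / v)), Some w) \<in> Omega_plus" if "v \<noteq> 0" "w \<noteq> 0" for v w
  proof (cases "v = - 1")
    case True
    then show ?thesis using that by (simp add: Omega_plus_def Omega_def)
  next
    case False
    then have "sphere_inverse (Some (w * (1 + v) / v)) = Some (v / ((1 + v) * w))"
      using v1[OF False] that by (simp add: mult.commute)
    then show ?thesis using O1[OF False that(2)] by simp
  qed
  have "holomorphic2_on (\<lambda>p. G (Some (fst p / ((1 + fst p) * snd p)), Some (snd p))) ?A"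
    by (rule holomorphic2_on_map[OF SS, unfolded fst_conv snd_conv])
      (use v1 in \<open>auto intro!: holomorphic2_intros O1\<close>)
  then have A: "holomorphic2_on (cone_fun G) ?A"
  proof (rule holomorphic2_on_cong[rotated])
    show "G (Some (fst p / ((1 + fst p) * snd p)), Some (snd p)) = cone_fun G p" if "p \<in> ?A" for p
      using that by (cases p) (simp add: cone_fun_finite)
  qed (auto intro!: open_Times)
  have "holomorphic2_on (\<lambda>p. G (sphere_inverse (Some (snd p * (1 + fst p) / fst p)), Some (snd p))) ?B"
    by (rule holomorphic2_on_map[OF IS, unfolded fst_conv snd_conv])
      (auto intro!: holomorphic2_intros O2 simp del: sphere_inverse.simps)
  then have B: "holomorphic2_on (cone_fun G) ?B"
    by (rule holomorphic2_on_cong[rotated]) (auto simp: cone_fun_def intro!: open_Times)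
  have "?A \<union> ?B = UNIV \<times> (- {0})" by auto
  then show ?thesis using holomorphic2_on_Un[OF A B] by simp
qed

section \<open>Rotation averages of an extension to \<open>Omega_plus\<close>\<close>

lemma circle_integral:
  "integral {0..2 * pi} (\<lambda>\<theta>. exp (\<i> * of_real \<theta>) ^ n / exp (\<i> * of_real \<theta>) ^ k) = (if n = k then 2 * pi else 0)"
proof (cases "n = k")
  case True
  then show ?thesis by (simp add: scaleR_conv_of_real)
next
  case False
  define j :: complex where "j = of_nat n - of_nat k"
  have j: "j \<noteq> 0" using False by (simp add: j_def)
  have e: "exp (\<i> * of_real \<theta>) ^ n / exp (\<i> * of_real \<theta>) ^ k = exp (\<i> * j * of_real \<theta>)" for \<theta>
    unfolding exp_of_nat_mult[symmetric] exp_diff[symmetric] j_def by (simp add: algebra_simps)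
  have "((\<lambda>\<theta>. exp (\<i> * j * of_real \<theta>)) has_integral
      (exp (\<i> * j * of_real (2 * pi)) / (\<i> * j) - exp (\<i> * j * of_real 0) / (\<i> * j))) {0..2 * pi}"
  proof (rule fundamental_theorem_of_calculus)
    fix x assume "x \<in> {0..2 * pi}"
    have "((\<lambda>\<theta>. exp (\<i> * j * \<theta>) / (\<i> * j)) has_field_derivative exp (\<i> * j * of_real x)) (at (of_real x))"
      using j by (auto intro!: derivative_eq_intros)
    then show "((\<lambda>\<theta>. exp (\<i> * j * of_real \<theta>) / (\<i> * j)) has_vector_derivative exp (\<i> * j * of_real x)) (at x within {0..2 * pi})"
      using has_vector_derivative_real_field has_vector_derivative_at_within by blast
  qed simp
  moreover have "exp (\<i> * j * of_real (2 * pi)) = 1"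
  proof -
    have "exp (complex_of_real (2 * (real n - real k) * pi) * \<i>) = 1" by (rule exp_integer_2pi) simp
    moreover have "complex_of_real (2 * (real n - real k) * pi) * \<i> = \<i> * j * of_real (2 * pi)"
      by (simp add: j_def)
    ultimately show ?thesis by (simp only:)
  qed
  ultimately have "((\<lambda>\<theta>. exp (\<i> * j * of_real \<theta>)) has_integral 0) {0..2 * pi}" by simp
  then show ?thesis using False unfolding e by (simp add: integral_unique)
qed

text \<open>In these coordinates weight n is t^n f_n(t) w^(-n) with t = v/(1+v), so multiplying by
  w^n and integrating over the circle |w| = 1/2 extracts it up to the factor 2 pi. On this circle
  small v give points of the bidisk.\<close>

definition cone_average :: "(sphere \<times> sphere \<Rightarrow> complex) \<Rightarrow> nat \<Rightarrow> complex \<Rightarrow> complex"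
  where "cone_average G n v = integral {0..2 * pi}
    (\<lambda>\<theta>. cone_fun G (v, exp (\<i> * of_real \<theta>) / 2) * (exp (\<i> * of_real \<theta>) / 2) ^ n)"

text \<open>Differentiation under the integral: for every w on the circle, \<open>cone_fun G\<close>
  is holomorphic in v on the whole plane.\<close>

lemma cone_average_entire:
  assumes G: "sphere_holomorphic2_on G Omega_plus"
  shows "cone_average G n holomorphic_on UNIV"
proof -
  let ?D = "UNIV \<times> (- {0}) :: (complex \<times> complex) set"
  note hG = cone_fun_holomorphic[OF G]
  have oD: "open ?D" by (intro open_Times) auto
  let ?w = "\<lambda>\<theta>::real. exp (\<i> * of_real \<theta>) / 2 :: complex"
  have cw: "continuous_on A ?w" for A by (auto intro!: continuous_intros)
  have c1: "continuous_on A (\<lambda>p. H (fst p, ?w (snd p)) * ?w (snd p) ^ n)" if "holomorphic2_on H ?D" for H A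
  proof -
    have "continuous_on A (\<lambda>p. H (fst p, ?w (snd p)))"
      by (rule continuous_on_compose2[OF holomorphic2_on_imp_continuous_on[OF that]])
        (auto intro!: continuous_intros)
    then show ?thesis by (auto intro!: continuous_intros)
  qed
  have "(\<lambda>v. integral (cbox 0 (2 * pi)) (\<lambda>\<theta>. cone_fun G (v, ?w \<theta>) * ?w \<theta> ^ n)) holomorphic_on UNIV"
  proof (rule leibniz_rule_holomorphic)
    fix v :: complex and \<theta> :: real
    have "((\<lambda>v. cone_fun G (v, ?w \<theta>)) has_field_derivative dz (cone_fun G) (v, ?w \<theta>)) (at v)"
      unfolding dz_def prod.case
      by (rule field_differentiable_derivI[OF holomorphic2_on_fst_snd(1)[OF hG]]) auto
    from DERIV_cmult_right[OF this, of "?w \<theta> ^ n"]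
    show "((\<lambda>v. cone_fun G (v, ?w \<theta>) * ?w \<theta> ^ n) has_field_derivative dz (cone_fun G) (v, ?w \<theta>) * ?w \<theta> ^ n) (at v within UNIV)"
      by simp
  next
    fix v :: complex
    have "continuous_on (cbox 0 (2 * pi)) ((\<lambda>p. cone_fun G (fst p, ?w (snd p)) * ?w (snd p) ^ n) \<circ> (\<lambda>\<theta>. (v, \<theta>)))"
      by (rule continuous_on_compose[OF _ c1[OF hG]]) (intro continuous_intros)
    then show "(\<lambda>\<theta>. cone_fun G (v, ?w \<theta>) * ?w \<theta> ^ n) integrable_on cbox 0 (2 * pi)"
      by (intro integrable_continuous) (simp add: o_def)
  next
    show "continuous_on (UNIV \<times> cbox 0 (2 * pi)) (\<lambda>(v, \<theta>). dz (cone_fun G) (v, ?w \<theta>) * ?w \<theta> ^ n)"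
      unfolding case_prod_unfold by (rule c1[OF holomorphic2_on_dz[OF hG oD]])
  qed simp
  then show ?thesis by (simp add: cone_average_def[abs_def])
qed

text \<open>|v| < 1/8 gives |t| \<le> 1/7 and |z| = |t/w| \<le> 2/7 for |w| = 1/2, so the path of
  integration lies in the bidisk and the weight expansion may be integrated term by term.\<close>

lemma cone_average_eq:
  assumes F: "F \<in> eigenspace lam"
    and G: "\<And>z w. (z, w) \<in> bidisk \<Longrightarrow> G (Some z, Some w) = F (z, w)" and v: "norm v < 1/8"
  shows "cone_average G n v = 2 * pi * (coef n F * (v / (1 + v)) ^ n * radial (lam / 4) n (v / (1 + v)))"
proof -
  define t where "t = v / (1 + v)"
  have v1: "norm (1 + v) \<ge> 7/8" using norm_triangle_ineq2[of 1 "- v"] v by simp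
  then have v1': "1 + v \<noteq> 0" by auto
  have t: "norm t \<le> 1/7"
  proof -
    have "norm v \<le> 1/7 * norm (1 + v)" using v v1 by linarith
    then show ?thesis using v1 v1' by (simp add: t_def norm_divide divide_simps)
  qed
  let ?e = "\<lambda>\<theta>::real. exp (\<i> * of_real \<theta>) :: complex"
  let ?w = "\<lambda>\<theta>. ?e \<theta> / 2"
  let ?p = "\<lambda>n. coef n F" and ?q = "\<lambda>n. swap_coef n F" and ?f = "\<lambda>k. radial (lam / 4) k t"
  let ?T = "\<lambda>k \<theta>. weight_term lam ?p ?q k (t / ?w \<theta>, ?w \<theta>)"
  let ?S = "\<lambda>N \<theta>. (\<Sum>k<N. ?T k \<theta>) * ?w \<theta> ^ n"
  let ?F = "\<lambda>\<theta>. F (t / ?w \<theta>, ?w \<theta>)"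
  have nw: "norm (?w \<theta>) = 1/2" for \<theta> by (simp add: norm_divide)
  have nz: "norm (t / ?w \<theta>) \<le> 2/7" for \<theta> using t by (simp add: norm_divide)
  have b: "(t / ?w \<theta>, ?w \<theta>) \<in> bidisk" for \<theta>
    unfolding mem_bidisk using nz[of \<theta>] nw[of \<theta>] by linarith
  define K where "K = (\<lambda>\<theta>. (t / ?w \<theta>, ?w \<theta>)) ` {0..2 * pi}"
  have K: "compact K" "K \<subseteq> bidisk"
  proof -
    show "compact K" unfolding K_def by (intro compact_continuous_image continuous_intros) auto
    show "K \<subseteq> bidisk" unfolding K_def using b by auto
  qed
  have "uniform_limit K (\<lambda>N x. \<Sum>k<N. weight_term lam ?p ?q k x) F sequentially"
    using weight_series(2)[OF disk_coeffs_coef[OF eigenspace_holomorphic2[OF F]] disk_coeffs_swap_coef[OF F] K, of lam]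
      eigenspace_expansion[OF F] by simp
  then have "uniform_limit {0..2 * pi} (\<lambda>N \<theta>. \<Sum>k<N. ?T k \<theta>) (\<lambda>\<theta>. ?F \<theta>) sequentially"
    by (rule uniform_limit_compose'[where h = "\<lambda>\<theta>. (t / ?w \<theta>, ?w \<theta>)"]) (auto simp: K_def)
  then have ul: "uniform_limit {0..2 * pi} ?S
      (\<lambda>\<theta>. ?F \<theta> * ?w \<theta> ^ n) sequentially"
  proof (rule uniform_lim_mult[OF _ uniform_limit_const])
    have "norm (?F \<theta>) \<le> B" if "\<And>x. x \<in> F ` K \<Longrightarrow> norm x \<le> B" "\<theta> \<in> {0..2 * pi}" for B \<theta>
      using that(2) by (intro that(1)) (simp only: K_def, blast)
    moreover have "bounded (F ` K)"
      using holomorphic2_on_imp_continuous_on[OF eigenspace_holomorphic2[OF F]] K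
      by (meson compact_continuous_image compact_imp_bounded continuous_on_subset)
    ultimately show "bounded ((\<lambda>\<theta>. ?F \<theta>) ` {0..2 * pi})"
      unfolding bounded_iff by (metis (no_types, lifting) imageE)
    show "bounded ((\<lambda>\<theta>. ?w \<theta> ^ n) ` {0..2 * pi})"
      unfolding bounded_iff using nw by (intro exI[of _ "(1/2) ^ n"]) (auto simp: norm_power)
  qed
  \<comment> \<open>The frequency is n - k for weight k and n + k for its swap. The first integral
    survives only for k = n, the second only for n = k = 0, where \<open>swap_coef 0 F\<close> is
    0.\<close>
  have term_eq: "?T k \<theta> * ?w \<theta> ^ n
      = ?p k * t ^ k * ?f k * (2 ^ k / 2 ^ n) * (?e \<theta> ^ n / ?e \<theta> ^ k) + ?q k * ?f k * (1 / 2 ^ (k + n)) * (?e \<theta> ^ (n + k) / ?e \<theta> ^ 0)" for k \<theta>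
  proof -
    have sw: "(?w \<theta>, t / ?w \<theta>) \<in> bidisk" using b[of \<theta>] by (auto simp: mem_bidisk)
    have W: "weight lam k (t / ?w \<theta>, ?w \<theta>) = (t / ?w \<theta>) ^ k * ?f k"
      "weight lam k (?w \<theta>, t / ?w \<theta>) = ?w \<theta> ^ k * ?f k"
      using b[of \<theta>] sw by (simp_all add: weight_def weight_fun_def)
    show ?thesis
      unfolding weight_term_def prod.swap_def fst_conv snd_conv W
      by (simp add: power_divide power_mult_distrib power_add field_simps)
  qed
  have cont: "continuous_on {0..2 * pi} (\<lambda>\<theta>. ?T k \<theta> * ?w \<theta> ^ n)" for k
    unfolding term_eq by (intro continuous_intros) auto
  have int: "(\<lambda>\<theta>. ?T k \<theta> * ?w \<theta> ^ n) integrable_on {0..2 * pi}" for k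
    by (intro integrable_continuous_real cont)
  have ik: "integral {0..2 * pi} (\<lambda>\<theta>. ?T k \<theta> * ?w \<theta> ^ n)
      = (if k = n then 2 * pi * (?p n * t ^ n * ?f n) else 0)" for k
  proof -
    have i1: "(\<lambda>\<theta>. ?e \<theta> ^ a / ?e \<theta> ^ b) integrable_on {0..2 * pi}" for a b :: nat
      by (intro integrable_continuous_real continuous_intros) auto
    have "integral {0..2 * pi} (\<lambda>\<theta>. ?T k \<theta> * ?w \<theta> ^ n)
      = ?p k * t ^ k * ?f k * (2 ^ k / 2 ^ n) * integral {0..2 * pi} (\<lambda>\<theta>. ?e \<theta> ^ n / ?e \<theta> ^ k)
        + ?q k * ?f k * (1 / 2 ^ (k + n)) * integral {0..2 * pi} (\<lambda>\<theta>. ?e \<theta> ^ (n + k) / ?e \<theta> ^ 0)"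
      unfolding term_eq
      by (subst integral_add) (auto intro!: integrable_on_mult_right i1 simp only: integral_mult_right)
    also have "\<dots> = (if k = n then 2 * pi * (?p n * t ^ n * ?f n) else 0)"
      unfolding circle_integral by (auto simp: swap_coef_def)
    finally show ?thesis .
  qed
  have "(\<lambda>N. integral {0..2 * pi} (?S N))
      \<longlonglongrightarrow> integral {0..2 * pi} (\<lambda>\<theta>. ?F \<theta> * ?w \<theta> ^ n)"
  proof -
    have "continuous_on {0..2 * pi} (?S N)" for N
      unfolding sum_distrib_right by (intro continuous_on_sum cont)
    then obtain I J where IJ: "\<And>N. ((?S N) has_integral I N) {0..2 * pi}"
      "((\<lambda>\<theta>. ?F \<theta> * ?w \<theta> ^ n) has_integral J) {0..2 * pi}" "(I \<longlongrightarrow> J) sequentially"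
      using uniform_limit_integral[OF ul] by auto
    have "integral {0..2 * pi} (?S N) = I N" for N
      using IJ(1) by (rule integral_unique)
    moreover have "integral {0..2 * pi} (\<lambda>\<theta>. ?F \<theta> * ?w \<theta> ^ n) = J"
      using IJ(2) by (rule integral_unique)
    ultimately show ?thesis using IJ(3) by simp
  qed
  moreover have "integral {0..2 * pi} (?S N)
      = 2 * pi * (?p n * t ^ n * ?f n)" if "N > n" for N
  proof -
    have "integral {0..2 * pi} (?S N)
      = (\<Sum>k<N. integral {0..2 * pi} (\<lambda>\<theta>. ?T k \<theta> * ?w \<theta> ^ n))"
      unfolding sum_distrib_right by (rule integral_sum) (simp, rule int)
    also have "\<dots> = 2 * pi * (?p n * t ^ n * ?f n)" unfolding ik using that by simp
    finally show ?thesis .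
  qed
  then have "(\<lambda>N. integral {0..2 * pi} (?S N))
      \<longlonglongrightarrow> 2 * pi * (?p n * t ^ n * ?f n)"
    by (intro tendsto_eventually eventually_sequentiallyI[of "Suc n"]) auto
  ultimately have I: "integral {0..2 * pi} (\<lambda>\<theta>. ?F \<theta> * ?w \<theta> ^ n) = 2 * pi * (?p n * t ^ n * ?f n)"
    by (rule LIMSEQ_unique)
  have "v \<noteq> - 1" using v by auto
  then have "cone_fun G (v, ?w \<theta>) = ?F \<theta>" for \<theta>
    using b[of \<theta>] G by (simp add: cone_fun_finite t_def)
  then show ?thesis using I by (simp add: cone_average_def t_def)
qed

text \<open>The radial equation for g(t) = t^n f_n(t), rewritten with 1 - t = 1/(1+v) and dt/dv = (1
  - t)^2; the singular point t = 1 moves to v = \<infinity>. The equation near v = 0 yields the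
  recursion for the Taylor coefficients.\<close>

lemma cone_average_ode:
  fixes n :: nat
  assumes F: "F \<in> eigenspace lam"
    and G: "\<And>z w. (z, w) \<in> bidisk \<Longrightarrow> G (Some z, Some w) = F (z, w)" and v: "norm v < 1/8"
  defines "h \<equiv> cone_average G n"
  shows "v * (1 + v) * deriv (deriv h) v - (of_nat n - 1 - 2 * v) * deriv h v - lam / 4 * h v = 0"
proof -
  let ?f = "radial (lam / 4) n"
  let ?D = "ball (0::complex) (1/8)"
  define c where "c = 2 * pi * coef n F"
  define t where "t = (\<lambda>v::complex. v / (1 + v))"
  have h: "h v = c * (t v ^ n * ?f (t v))" if "v \<in> ?D" for v
    using cone_average_eq[OF F G, of v n] that by (simp add: h_def c_def t_def)
  have ode: "?f holomorphic_on ball 0 1"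
    "\<And>t. t \<in> ball 0 1 \<Longrightarrow> (1 - t)\<^sup>2 * (t * deriv (deriv ?f) t + of_nat (Suc n) * deriv ?f t) = lam / 4 * ?f t"
    using radial_ode[of "lam / 4" n] by (auto simp: radial_ode_def)
  have v1: "1 + v \<noteq> 0" "1 - t v \<noteq> 0" "1 / (1 + v) = 1 - t v" "t v \<in> ball 0 1" if "v \<in> ?D" for v
  proof -
    have a: "norm (1 + v) \<ge> 7/8" using norm_triangle_ineq2[of 1 "- v"] that by simp
    then show b: "1 + v \<noteq> 0" by auto
    then show c: "1 / (1 + v) = 1 - t v" by (simp add: t_def field_simps)
    show "1 - t v \<noteq> 0" using b by (simp add: c[symmetric])
    show "t v \<in> ball 0 1" using a b that by (simp add: t_def norm_divide divide_simps)
  qed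
  have dt: "(t has_field_derivative (1 - t v)\<^sup>2) (at v)" if "v \<in> ?D" for v
  proof -
    have "(t has_field_derivative (1 / (1 + v))\<^sup>2) (at v)"
      unfolding t_def using v1(1)[OF that] by (auto intro!: derivative_eq_intros simp: power2_eq_square)
    then show ?thesis by (simp only: v1(3)[OF that])
  qed
  define g where "g = (\<lambda>t. t ^ n * ?f t)"
  have hg: "g holomorphic_on ball 0 1" unfolding g_def by (intro holomorphic_intros ode)
  have dg: "(g has_field_derivative deriv g t) (at t)" "(deriv g has_field_derivative deriv (deriv g) t) (at t)"
    if "t \<in> ball 0 1" for t
    using holomorphic_derivI[OF hg open_ball that] holomorphic_derivI[OF holomorphic_deriv[OF hg open_ball] open_ball that]
    by auto
  have df: "(?f has_field_derivative deriv ?f t) (at t)" "(deriv ?f has_field_derivative deriv (deriv ?f) t) (at t)"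
    if "t \<in> ball 0 1" for t
    using holomorphic_derivI[OF ode(1) open_ball that] holomorphic_derivI[OF holomorphic_deriv[OF ode(1) open_ball] open_ball that]
    by auto
  have power_d: "((\<lambda>t. t ^ k) has_field_derivative of_nat k * t ^ (k - 1)) (at t)" for k and t :: complex
    using DERIV_power[OF DERIV_ident, where n = k] by simp
  have g1: "deriv g t = of_nat n * t ^ (n - 1) * ?f t + t ^ n * deriv ?f t" if "t \<in> ball 0 1" for t
    unfolding g_def using DERIV_mult[OF power_d df(1)[OF that], of n]
    by (intro DERIV_imp_deriv) (simp add: mult_ac add_ac)
  have g2: "deriv (deriv g) t = of_nat n * (of_nat (n - 1) * t ^ (n - 1 - 1)) * ?f t
      + 2 * (of_nat n * t ^ (n - 1)) * deriv ?f t + t ^ n * deriv (deriv ?f) t" if t: "t \<in> ball 0 1" for t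
  proof -
    have "((\<lambda>t. of_nat n * t ^ (n - 1) * ?f t + t ^ n * deriv ?f t) has_field_derivative
        of_nat n * (of_nat (n - 1) * t ^ (n - 1 - 1)) * ?f t + deriv ?f t * (of_nat n * t ^ (n - 1))
        + (of_nat n * t ^ (n - 1) * deriv ?f t + deriv (deriv ?f) t * t ^ n)) (at t)"
      by (intro DERIV_add DERIV_mult DERIV_cmult power_d df that)
    then have "(deriv g has_field_derivative
        of_nat n * (of_nat (n - 1) * t ^ (n - 1 - 1)) * ?f t + deriv ?f t * (of_nat n * t ^ (n - 1))
        + (of_nat n * t ^ (n - 1) * deriv ?f t + deriv (deriv ?f) t * t ^ n)) (at t)"
      by (rule has_field_derivative_transform_within_open[OF _ open_ball t]) (simp add: g1)
    then show ?thesis by (simp add: DERIV_imp_deriv algebra_simps)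
  qed
  have gode: "(1 - t)\<^sup>2 * (t * deriv (deriv g) t - (of_nat n - 1) * deriv g t) = lam / 4 * g t" if t: "t \<in> ball 0 1" for t
  proof -
    \<comment> \<open>For n = 0 and n = 1 the exponents are truncated, but there the numerical
      factors make both sides 0.\<close>
    have e1: "t * (of_nat n * (of_nat (n - 1) * t ^ (n - 1 - 1))) = (of_nat n - 1) * (of_nat n * t ^ (n - 1))"
      by (cases n; cases "n - 1") (auto simp: algebra_simps)
    have e2: "t * (of_nat n * t ^ (n - 1)) = of_nat n * t ^ n" by (cases n) auto
    have "t * deriv (deriv g) t - (of_nat n - 1) * deriv g t
      = (t * (of_nat n * (of_nat (n - 1) * t ^ (n - 1 - 1)))) * ?f t + 2 * (t * (of_nat n * t ^ (n - 1))) * deriv ?f t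
        + t ^ n * (t * deriv (deriv ?f) t)
        - ((of_nat n - 1) * (of_nat n * t ^ (n - 1))) * ?f t - (of_nat n - 1) * t ^ n * deriv ?f t"
      unfolding g1[OF t] g2[OF t] by (simp add: algebra_simps)
    also have "\<dots> = t ^ n * (t * deriv (deriv ?f) t + of_nat (Suc n) * deriv ?f t)"
      unfolding e1 e2 by (simp add: algebra_simps)
    finally have "(1 - t)\<^sup>2 * (t * deriv (deriv g) t - (of_nat n - 1) * deriv g t)
      = t ^ n * ((1 - t)\<^sup>2 * (t * deriv (deriv ?f) t + of_nat (Suc n) * deriv ?f t))"
      by (simp only: mult_ac)
    then show ?thesis unfolding ode(2)[OF t] by (simp add: g_def)
  qed
  have h1: "(h has_field_derivative c * (deriv g (t v) * (1 - t v)\<^sup>2)) (at v)" if v: "v \<in> ?D" for v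
  proof -
    have "((\<lambda>v. c * g (t v)) has_field_derivative c * (deriv g (t v) * (1 - t v)\<^sup>2)) (at v)"
      by (intro DERIV_cmult DERIV_chain2[OF dg(1) dt] v1 v)
    then show ?thesis
      by (rule has_field_derivative_transform_within_open[OF _ open_ball v]) (simp add: h g_def)
  qed
  have h2: "(deriv h has_field_derivative
      c * (deriv (deriv g) (t v) * (1 - t v) ^ 4 - 2 * (1 - t v) ^ 3 * deriv g (t v))) (at v)" if v: "v \<in> ?D" for v
  proof -
    have s: "((\<lambda>v. (1 - t v)\<^sup>2) has_field_derivative - (2 * (1 - t v) ^ 3)) (at v)"
      by (auto intro!: derivative_eq_intros dt[OF v] simp: power2_eq_square power3_eq_cube)
    have "((\<lambda>v. c * (deriv g (t v) * (1 - t v)\<^sup>2)) has_field_derivative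
      c * (deriv (deriv g) (t v) * (1 - t v)\<^sup>2 * (1 - t v)\<^sup>2 + - (2 * (1 - t v) ^ 3) * deriv g (t v))) (at v)"
      by (intro DERIV_cmult DERIV_mult DERIV_chain2[OF dg(2) dt] v1 v s)
    then have "((\<lambda>v. c * (deriv g (t v) * (1 - t v)\<^sup>2)) has_field_derivative
      c * (deriv (deriv g) (t v) * (1 - t v) ^ 4 - 2 * (1 - t v) ^ 3 * deriv g (t v))) (at v)"
      by (simp add: algebra_simps power2_eq_square power4_eq_xxxx)
    then show ?thesis
      by (rule has_field_derivative_transform_within_open[OF _ open_ball v])
        (simp add: DERIV_imp_deriv[OF h1])
  qed
  have vD: "v \<in> ?D" using v by simp
  have alg: "v * (1 + v) * (c * (g2 * s ^ 4 - 2 * s ^ 3 * g1)) - (N - 1 - 2 * v) * (c * (g1 * s\<^sup>2))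
      = c * (s\<^sup>2 * (T * g2 - (N - 1) * g1))"
    if "(1 + v) * s = 1" "v * s = T" for g1 g2 s T N :: complex
    using that by algebra
  have "v * (1 + v) * deriv (deriv h) v - (of_nat n - 1 - 2 * v) * deriv h v
      = c * ((1 - t v)\<^sup>2 * (t v * deriv (deriv g) (t v) - (of_nat n - 1) * deriv g (t v)))"
    unfolding DERIV_imp_deriv[OF h1[OF vD]] DERIV_imp_deriv[OF h2[OF vD]]
  proof (rule alg)
    show "(1 + v) * (1 - t v) = 1" using v1(1)[OF vD] unfolding v1(3)[OF vD, symmetric] by simp
    show "v * (1 - t v) = t v" unfolding v1(3)[OF vD, symmetric] by (simp add: t_def)
  qed
  also have "\<dots> = lam / 4 * h v"
    unfolding gode[OF v1(4)[OF vD]] h[OF vD] by (simp add: g_def)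
  finally show ?thesis by simp
qed

text \<open>The recursion for the Taylor coefficients of \<open>cone_average\<close> at \<open>0\<close> forces radius of
  convergence \<open>1\<close> unless it terminates or starts with \<open>0\<close>.\<close>

lemma eigenspace_ext_plus_coef:
  assumes F: "F \<in> eigenspace_ext lam Omega_plus" and n: "n \<ge> 1"
    and lam: "\<And>k::nat. k \<ge> n \<Longrightarrow> lam \<noteq> 4 * of_nat k * (of_nat k + 1)"
  shows "coef n F = 0"
proof (rule ccontr)
  assume c0: "coef n F \<noteq> 0"
  obtain G where FX: "F \<in> eigenspace lam" and G: "sphere_holomorphic2_on G Omega_plus"
    and GF: "\<And>z w. (z, w) \<in> bidisk \<Longrightarrow> G (Some z, Some w) = F (z, w)"
    using F unfolding eigenspace_ext_def by auto
  define h where "h = cone_average G n"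
  define B where "B = fps_expansion h 0"
  define \<beta> where "\<beta> = fps_nth B"
  have hh: "h holomorphic_on UNIV" unfolding h_def by (rule cone_average_entire[OF G])
  have hB: "h has_fps_expansion B" unfolding B_def by (rule has_fps_expansion_fps_expansion[OF open_UNIV _ hh]) simp
  have "fps_conv_radius B \<ge> \<infinity>"
    unfolding B_def by (rule conv_radius_fps_expansion) (use hh holomorphic_on_subset in blast)
  \<comment> \<open>For an entire function \<beta> k 2^k tends to 0, whereas the recursion makes
    |\<beta> k| 2^k nondecreasing and nonzero from some index on.\<close>
  then have "summable (\<lambda>k. \<beta> k * 2 ^ k)"
    unfolding \<beta>_def by (intro summable_fps) simp
  then have tend: "(\<lambda>k. norm (\<beta> k * 2 ^ k)) \<longlonglongrightarrow> 0"
    using summable_LIMSEQ_zero tendsto_norm_zero by blast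
  have dB: "deriv h has_fps_expansion fps_deriv B" "deriv (deriv h) has_fps_expansion fps_deriv (fps_deriv B)"
    by (intro has_fps_expansion_deriv hB)+
  have "(\<lambda>v. v * (1 + v) * deriv (deriv h) v - (of_nat n - 1 - 2 * v) * deriv h v - lam / 4 * h v) has_fps_expansion
      fps_X * (1 + fps_X) * fps_deriv (fps_deriv B) - (fps_const (of_nat n - 1) - fps_const 2 * fps_X) * fps_deriv B - fps_const (lam / 4) * B"
    by (intro fps_expansion_intros hB dB)
  moreover have "\<forall>\<^sub>F v in nhds 0. v * (1 + v) * deriv (deriv h) v - (of_nat n - 1 - 2 * v) * deriv h v - lam / 4 * h v = 0"
  proof -
    have "\<forall>\<^sub>F v in nhds (0::complex). v \<in> ball 0 (1/8)" by (rule eventually_nhds_in_open) auto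
    then show ?thesis
      by eventually_elim (use cone_average_ode[OF FX GF] in \<open>simp add: h_def\<close>)
  qed
  ultimately have "(\<lambda>v. 0) has_fps_expansion
      fps_X * (1 + fps_X) * fps_deriv (fps_deriv B) - (fps_const (of_nat n - 1) - fps_const 2 * fps_X) * fps_deriv B - fps_const (lam / 4) * B"
    by (subst (asm) has_fps_expansion_cong[OF _ refl]) auto
  then have "fps_X * (1 + fps_X) * fps_deriv (fps_deriv B) - (fps_const (of_nat n - 1) - fps_const 2 * fps_X) * fps_deriv B - fps_const (lam / 4) * B = 0"
    using fps_expansion_unique_complex has_fps_expansion_0 by blast
  then have eq0: "fps_nth (fps_X * (fps_deriv (fps_deriv B)) + fps_X * (fps_X * fps_deriv (fps_deriv B))
      - fps_const (of_nat n - 1) * fps_deriv B + fps_const 2 * (fps_X * fps_deriv B) - fps_const (lam / 4) * B) k = 0" for k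
    by (simp add: algebra_simps)
  \<comment> \<open>At k = n - 1 the left factor vanishes, so the recursion leaves \<beta> n free;
    for k \<ge> n the factor on the right is nonzero by the assumption on lam.\<close>
  have rec: "of_nat (Suc k) * (of_nat k - (of_nat n - 1)) * \<beta> (Suc k) = (lam / 4 - of_nat k * (of_nat k + 1)) * \<beta> k" for k
  proof -
    have x1: "fps_nth (fps_X * fps_deriv (fps_deriv B)) k = of_nat k * (of_nat (Suc k) * \<beta> (Suc k))"
      by (cases k) (simp_all add: \<beta>_def mult_ac)
    have x2: "fps_nth (fps_X * (fps_X * fps_deriv (fps_deriv B))) k = of_nat k * (of_nat k - 1) * \<beta> k"
      by (cases k; cases "k - 1") (simp_all add: \<beta>_def algebra_simps)
    have x3: "fps_nth (fps_X * fps_deriv B) k = of_nat k * \<beta> k"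
      by (cases k) (simp_all add: \<beta>_def)
    have x4: "fps_nth (fps_deriv B) k = of_nat (Suc k) * \<beta> (Suc k)" by (simp add: \<beta>_def)
    have "of_nat k * (of_nat (Suc k) * \<beta> (Suc k)) + of_nat k * (of_nat k - 1) * \<beta> k
      - (of_nat n - 1) * (of_nat (Suc k) * \<beta> (Suc k)) + 2 * (of_nat k * \<beta> k) - lam / 4 * \<beta> k = 0"
      using eq0[of k] unfolding fps_sub_nth fps_add_nth fps_mult_left_const_nth x1 x2 x3 x4 by (simp add: \<beta>_def)
    then show ?thesis by (simp add: algebra_simps del: of_nat_Suc)
  qed
  \<comment> \<open>By \<open>cone_average_eq\<close>, h is near 0 the product of v^n and a function
    with value 2 pi \<open>coef n F\<close> at 0.\<close>
  have \<beta>n: "\<beta> n \<noteq> 0"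
  proof -
    define t where "t = (\<lambda>v::complex. v / (1 + v))"
    define K where "K = (\<lambda>v. 2 * pi * coef n F * (1 / (1 + v)) ^ n * radial (lam / 4) n (t v))"
    have hK: "K holomorphic_on ball 0 (1/8)"
    proof -
      have "1 + v \<noteq> 0 \<and> t v \<in> ball 0 1" if "v \<in> ball 0 (1/8)" for v
      proof -
        have a: "norm (1 + v) \<ge> 7/8" using norm_triangle_ineq2[of 1 "- v"] that by simp
        then have b: "1 + v \<noteq> 0" by auto
        then show ?thesis using a that by (simp add: t_def norm_divide divide_simps)
      qed
      moreover have "radial (lam / 4) n holomorphic_on ball 0 1"
        using radial_ode[of "lam / 4" n] by (simp add: radial_ode_def)
      then have "(radial (lam / 4) n \<circ> t) holomorphic_on ball 0 (1/8)"
        by (rule holomorphic_on_compose_gen[rotated]) (use calculation in \<open>auto simp: t_def intro!: holomorphic_intros\<close>)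
      ultimately show ?thesis unfolding K_def by (auto intro!: holomorphic_intros simp: o_def)
    qed
    have KB: "K has_fps_expansion fps_expansion K 0"
      by (rule has_fps_expansion_fps_expansion[OF open_ball _ hK]) simp
    have "(\<lambda>v. v ^ n * K v) has_fps_expansion fps_X ^ n * fps_expansion K 0"
      by (intro fps_expansion_intros KB)
    moreover have "\<forall>\<^sub>F v in nhds 0. v ^ n * K v = h v"
    proof -
      have "\<forall>\<^sub>F v in nhds (0::complex). v \<in> ball 0 (1/8)" by (rule eventually_nhds_in_open) auto
      then show ?thesis
        by eventually_elim
          (use cone_average_eq[OF FX GF] in \<open>simp add: h_def K_def t_def power_divide mult_ac\<close>)
    qed
    ultimately have "h has_fps_expansion fps_X ^ n * fps_expansion K 0"
      by (subst (asm) has_fps_expansion_cong[OF _ refl]) auto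
    then have "B = fps_X ^ n * fps_expansion K 0" by (rule fps_expansion_unique_complex[OF hB])
    then have "\<beta> n = fps_nth (fps_expansion K 0) 0" by (simp add: \<beta>_def fps_X_power_mult_nth)
    also have "\<dots> = K 0" using has_fps_expansion_imp_0_eq_fps_nth_0[OF KB] by simp
    also have "\<dots> = 2 * pi * coef n F" by (simp add: K_def t_def)
    finally show ?thesis using c0 by simp
  qed
  have \<beta>k: "\<beta> k \<noteq> 0" if "k \<ge> n" for k
    using that
  proof (induction rule: dec_induct)
    case (step k)
    have "lam / 4 - of_nat k * (of_nat k + 1) \<noteq> 0" using lam[OF step.hyps(1)] by auto
    then show ?case using rec[of k] step.IH by auto
  qed (rule \<beta>n)
  \<comment> \<open>For k \<ge> |lam|/2 the number k(k+1) is at least 2 |lam/4|, hence k(k+1) \<le>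
    2 |lam/4 - k(k+1)|. Together with k + 1 - n \<le> k this gives |\<beta> k| \<le> 2 |\<beta>
    (k+1)|.\<close>
  obtain K0 :: nat where K0: "norm lam / 2 \<le> real K0" using real_arch_simple by blast
  define K1 where "K1 = max K0 n"
  have mono: "norm (\<beta> k * 2 ^ k) \<le> norm (\<beta> (Suc k) * 2 ^ Suc k)" if "k \<ge> K1" for k
  proof -
    have kn: "k \<ge> n" "real k \<ge> norm lam / 2" using that K0 by (auto simp: K1_def)
    have e: "complex_of_nat k - (of_nat n - 1) = of_nat (Suc k - n)"
      using kn by (simp add: of_nat_diff)
    have "norm (complex_of_nat k * (of_nat k + 1)) = real k * real (Suc k)"
      by (metis norm_mult norm_of_nat of_nat_Suc add.commute)
    then have "real k * real (Suc k) - norm (lam / 4) \<le> norm (lam / 4 - of_nat k * (of_nat k + 1))"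
      using norm_triangle_ineq2[of "complex_of_nat k * (of_nat k + 1)" "lam / 4"] by (simp add: norm_minus_commute)
    moreover have "2 * norm (lam / 4) \<le> real k * 1" using kn by (simp add: norm_divide)
    moreover have "real k * 1 \<le> real k * real (Suc k)" by (intro mult_left_mono) auto
    ultimately have l: "real k * real (Suc k) \<le> 2 * norm (lam / 4 - of_nat k * (of_nat k + 1))" by linarith
    have r: "real (Suc k) * real (Suc k - n) \<le> real k * real (Suc k)"
      using n by (simp add: mult.commute mult_left_mono)
    have "norm (\<beta> k) * (real (Suc k) * real (Suc k - n)) \<le> norm (\<beta> k) * (2 * norm (lam / 4 - of_nat k * (of_nat k + 1)))"
      by (intro mult_left_mono order_trans[OF r l]) auto
    also have "\<dots> = 2 * norm (of_nat (Suc k) * of_nat (Suc k - n) * \<beta> (Suc k))"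
      using rec[of k] unfolding e by (simp add: norm_mult mult_ac)
    also have "\<dots> = 2 * norm (\<beta> (Suc k)) * (real (Suc k) * real (Suc k - n))"
      by (simp only: norm_mult norm_of_nat mult_ac)
    finally have "norm (\<beta> k) \<le> 2 * norm (\<beta> (Suc k))"
      by (rule mult_right_le_imp_le) (use kn in auto)
    then show ?thesis by (simp add: norm_mult norm_power)
  qed
  have "norm (\<beta> K1 * 2 ^ K1) \<le> norm (\<beta> k * 2 ^ k)" if "k \<ge> K1" for k
    using that by (induction rule: dec_induct) (use mono order_trans in \<open>blast+\<close>)
  then have "norm (\<beta> K1 * 2 ^ K1) \<le> 0"
    by (intro tendsto_lowerbound[OF tend] eventually_sequentiallyI[of K1]) auto
  then show False using \<beta>k[of K1] by (simp add: K1_def)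
qed

section \<open>Extension of the weight functions\<close>

lemma eigenspace_ext_iff:
  "F \<in> eigenspace_ext lam V \<longleftrightarrow> F \<in> eigenspace lam \<and>
    (\<exists>G. sphere_holomorphic2_on G V \<and> (\<forall>z w. (z, w) \<in> bidisk \<longrightarrow> G (Some z, Some w) = F (z, w)))"
  by (simp add: eigenspace_ext_def Ball_def split_paired_All)

lemma eigenspace_ext_linear:
  assumes "F \<in> eigenspace_ext lam V" "H \<in> eigenspace_ext lam V"
  shows "(\<lambda>p. a * F p + b * H p) \<in> eigenspace_ext lam V"
proof -
  obtain G1 G2 where G: "sphere_holomorphic2_on G1 V" "\<And>z w. (z, w) \<in> bidisk \<Longrightarrow> G1 (Some z, Some w) = F (z, w)"
    "sphere_holomorphic2_on G2 V" "\<And>z w. (z, w) \<in> bidisk \<Longrightarrow> G2 (Some z, Some w) = H (z, w)"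
    using assms unfolding eigenspace_ext_iff by blast
  have "sphere_holomorphic2_on (\<lambda>p. a * G1 p + b * G2 p) V"
    using G(1,3) unfolding sphere_holomorphic2_on_def case_prod_unfold
    by (auto intro!: holomorphic2_intros)
  moreover have "(\<lambda>p. a * F p + b * H p) \<in> eigenspace lam"
    using assms by (intro eigenspace_linear) (auto simp: eigenspace_ext_iff)
  ultimately show ?thesis unfolding eigenspace_ext_iff
    by (intro conjI exI[of _ "\<lambda>p. a * G1 p + b * G2 p"]) (simp_all add: G(2,4))
qed

lemma eigenspace_ext_0: "(\<lambda>_. 0) \<in> eigenspace_ext lam V"
  unfolding eigenspace_ext_def
  by (auto simp: eigenspace_0 sphere_holomorphic2_on_def case_prod_unfold intro!: exI[of _ "\<lambda>_. 0"] holomorphic2_intros)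

lemma eigenspace_ext_sum:
  assumes "\<And>i. i \<in> I \<Longrightarrow> F i \<in> eigenspace_ext lam V"
  shows "(\<lambda>p. \<Sum>i\<in>I. F i p) \<in> eigenspace_ext lam V"
  using assms
proof (induction I rule: infinite_finite_induct)
  case (insert i I)
  have "(\<lambda>p. 1 * F i p + 1 * (\<Sum>i\<in>I. F i p)) \<in> eigenspace_ext lam V"
    by (rule eigenspace_ext_linear) (use insert in auto)
  then show ?case using insert by simp
qed (simp_all add: eigenspace_ext_0)

lemma eigenspace_ext_mono:
  assumes "V \<subseteq> W"
  shows "eigenspace_ext lam W \<subseteq> eigenspace_ext lam V"
proof
  fix F assume "F \<in> eigenspace_ext lam W"
  then obtain G where F: "F \<in> eigenspace lam" and G: "sphere_holomorphic2_on G W"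
    "\<forall>(z, w)\<in>bidisk. G (Some z, Some w) = F (z, w)"
    unfolding eigenspace_ext_def by blast
  have "sphere_holomorphic2_on G V" unfolding sphere_holomorphic2_on_def
  proof (intro ballI)
    fix \<sigma> \<tau> assume st: "\<sigma> \<in> sphere_params" "\<tau> \<in> sphere_params"
    have "holomorphic2_on (\<lambda>(z, w). G (\<sigma> z, \<tau> w)) {(z, w). (\<sigma> z, \<tau> w) \<in> W}"
      using G(1) st unfolding sphere_holomorphic2_on_def by blast
    then show "holomorphic2_on (\<lambda>(z, w). G (\<sigma> z, \<tau> w)) {(z, w). (\<sigma> z, \<tau> w) \<in> V}"
      by (rule holomorphic2_on_subset) (use assms in auto)
  qed
  then show "F \<in> eigenspace_ext lam V" using F G(2) unfolding eigenspace_ext_def by blast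
qed

lemma eigenspace_ext_swap:
  assumes "F \<in> eigenspace_ext lam V" and W: "\<And>z w. (z, w) \<in> W \<Longrightarrow> (w, z) \<in> V"
  shows "F \<circ> prod.swap \<in> eigenspace_ext lam W"
proof -
  obtain G where F: "F \<in> eigenspace lam" and G: "sphere_holomorphic2_on G V"
    "\<And>z w. (z, w) \<in> bidisk \<Longrightarrow> G (Some z, Some w) = F (z, w)"
    using assms unfolding eigenspace_ext_iff by blast
  have "sphere_holomorphic2_on (G \<circ> prod.swap) W" unfolding sphere_holomorphic2_on_def
  proof (intro ballI)
    fix \<sigma> \<tau> assume st: "\<sigma> \<in> sphere_params" "\<tau> \<in> sphere_params"
    have h: "holomorphic2_on (\<lambda>(z, w). G (\<tau> z, \<sigma> w)) {(z, w). (\<tau> z, \<sigma> w) \<in> V}"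
      using G(1) st unfolding sphere_holomorphic2_on_def by blast
    have "holomorphic2_on (\<lambda>p. (\<lambda>(z, w). G (\<tau> z, \<sigma> w)) (snd p, fst p)) {(z, w). (\<sigma> z, \<tau> w) \<in> W}"
      by (rule holomorphic2_on_map[OF h]) (auto intro: holomorphic2_intros W)
    then show "holomorphic2_on (\<lambda>(z, w). (G \<circ> prod.swap) (\<sigma> z, \<tau> w)) {(z, w). (\<sigma> z, \<tau> w) \<in> W}"
      by (simp add: case_prod_unfold)
  qed
  moreover have "\<forall>z w. (z, w) \<in> bidisk \<longrightarrow> (G \<circ> prod.swap) (Some z, Some w) = (F \<circ> prod.swap) (z, w)"
    using G(2) by (auto simp: mem_bidisk)
  ultimately show ?thesis using eigenspace_swap[OF F] unfolding eigenspace_ext_iff by blast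
qed

text \<open>As V has no points with z = \<infinity>, the chart at infinity only reparametrises
  finite points by 1/z, and holomorphy is inherited from the finite chart.\<close>

lemma chart_inverse_fst:
  assumes h: "holomorphic2_on (\<lambda>p. G (Some (fst p), \<tau> (snd p))) {(z, w). (Some z, \<tau> w) \<in> V}"
    and V: "\<And>w. (None, w) \<notin> V"
  shows "holomorphic2_on (\<lambda>p. G (sphere_inverse (Some (fst p)), \<tau> (snd p)))
    {(z, w). (sphere_inverse (Some z), \<tau> w) \<in> V}"
proof -
  let ?S = "{(z, w). (sphere_inverse (Some z), \<tau> w) \<in> V}"
  have nz: "fst p \<noteq> 0" if "p \<in> ?S" for p using that V by (auto split: if_splits)
  have inv: "sphere_inverse (Some z) = Some (1 / z)" if "z \<noteq> 0" for z using that by simp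
  have "holomorphic2_on (\<lambda>p. G (Some (1 / fst p), \<tau> (snd p))) ?S"
  proof (rule holomorphic2_on_map[OF h, unfolded fst_conv snd_conv])
    show "holomorphic2_on (\<lambda>p. 1 / fst p) ?S" by (intro holomorphic2_intros nz)
    show "holomorphic2_on snd ?S" by (intro holomorphic2_intros)
    show "(1 / fst p, snd p) \<in> {(z, w). (Some z, \<tau> w) \<in> V}" if "p \<in> ?S" for p
      using that inv[OF nz[OF that]] by (auto simp del: sphere_inverse.simps)
  qed
  then show ?thesis
    by (rule holomorphic2_on_cong_superset[of "(- {0}) \<times> UNIV", rotated 2])
      (use V in \<open>auto intro!: open_Times\<close>)
qed

lemma chart_inverse_snd:
  assumes h: "holomorphic2_on (\<lambda>p. G (\<sigma> (fst p), Some (snd p))) {(z, w). (\<sigma> z, Some w) \<in> V}"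
    and V: "\<And>z. (z, None) \<notin> V"
  shows "holomorphic2_on (\<lambda>p. G (\<sigma> (fst p), sphere_inverse (Some (snd p))))
    {(z, w). (\<sigma> z, sphere_inverse (Some w)) \<in> V}"
proof -
  let ?S = "{(z, w). (\<sigma> z, sphere_inverse (Some w)) \<in> V}"
  have nz: "snd p \<noteq> 0" if "p \<in> ?S" for p using that V by (auto split: if_splits)
  have inv: "sphere_inverse (Some z) = Some (1 / z)" if "z \<noteq> 0" for z using that by simp
  have "holomorphic2_on (\<lambda>p. G (\<sigma> (fst p), Some (1 / snd p))) ?S"
  proof (rule holomorphic2_on_map[OF h, unfolded fst_conv snd_conv])
    show "holomorphic2_on (\<lambda>p. 1 / snd p) ?S" by (intro holomorphic2_intros nz)
    show "holomorphic2_on fst ?S" by (intro holomorphic2_intros)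
    show "(fst p, 1 / snd p) \<in> {(z, w). (\<sigma> z, Some w) \<in> V}" if "p \<in> ?S" for p
      using that inv[OF nz[OF that]] by (auto simp del: sphere_inverse.simps)
  qed
  then show ?thesis
    by (rule holomorphic2_on_cong_superset[of "UNIV \<times> (- {0})", rotated 2])
      (use V in \<open>auto intro!: open_Times\<close>)
qed

text \<open>The normalisation f(0) = 1 fixes the restrictions to both axes. This identifies the disk
  series with the solutions found by other means, on the slit plane and in rational form.\<close>

lemma weight_unique:
  assumes f: "radial_ode (lam / 4) n f (ball 0 1)" "f 0 = 1"
  shows "weight_fun n f = weight lam n"
proof -
  have fX: "weight_fun n f \<in> eigenspace lam" using weight_fun_eigenspace[OF f(1)] by simp
  have "(\<lambda>p. 1 * weight_fun n f p + (-1) * weight lam n p) = (\<lambda>_. 0)"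
    by (rule eigenspace_zero[OF eigenspace_linear[OF fX weight_eigenspace]])
      (auto simp: weight_def weight_fun_def f(2))
  then show ?thesis by (auto simp: fun_eq_iff)
qed

lemma radial_ode_subset: "radial_ode mu n f S \<Longrightarrow> T \<subseteq> S \<Longrightarrow> radial_ode mu n f T"
  unfolding radial_ode_def using holomorphic_on_subset by blast

lemma weight_ext_star: "weight lam n \<in> eigenspace_ext lam Omega_star"
proof -
  obtain f where f: "radial_ode (lam / 4) n f slit_plane" "f 0 = 1"
    using radial_ode_slit_plane by blast
  have wf: "weight lam n = weight_fun n f"
    using weight_unique[OF radial_ode_subset[OF f(1) ball_subset_slit_plane] f(2)] ..
  define G :: "sphere \<times> sphere \<Rightarrow> complex"
    where "G = (\<lambda>(x, y). case (x, y) of (Some z, Some w) \<Rightarrow> z ^ n * f (z * w) | _ \<Rightarrow> 0)"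
  have hf: "f holomorphic_on slit_plane" using f(1) by (simp add: radial_ode_def)
  have O: "(Some z, Some w) \<in> Omega_star \<longleftrightarrow> z * w \<in> slit_plane" for z w
    by (simp add: Omega_star_def slit_plane_def)
  have N: "(None, w) \<notin> Omega_star" "(z, None) \<notin> Omega_star" for z w
    by (auto simp: Omega_star_def)
  have SS: "holomorphic2_on (\<lambda>p. G (Some (fst p), Some (snd p))) {(z, w). (Some z, Some w) \<in> Omega_star}"
    unfolding G_def by (auto intro!: holomorphic2_intros holomorphic2_on_compose[OF _ hf open_slit_plane] simp: O)
  have SI: "holomorphic2_on (\<lambda>p. G (Some (fst p), sphere_inverse (Some (snd p)))) {(z, w). (Some z, sphere_inverse (Some w)) \<in> Omega_star}"
    by (rule chart_inverse_snd[OF SS N(2)])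
  have "sphere_holomorphic2_on G Omega_star"
    unfolding sphere_holomorphic2_on_def sphere_params_def case_prod_unfold
    using SS SI chart_inverse_fst[OF SS N(1)]
      chart_inverse_fst[where \<tau> = "\<lambda>w. sphere_inverse (Some w)", OF SI N(1)]
    by (simp add: case_prod_unfold del: sphere_inverse.simps)
  moreover have "\<forall>z w. (z, w) \<in> bidisk \<longrightarrow> G (Some z, Some w) = weight lam n (z, w)"
    by (auto simp: G_def wf weight_fun_def)
  ultimately show ?thesis using weight_eigenspace unfolding eigenspace_ext_iff by blast
qed

text \<open>For \<open>lam = 4 m (m + 1)\<close> the radial functions are rational:
  \<open>radial n t = (1 - t)\<^sup>-\<^sup>m \<^sub>2F\<^sub>1(- m, n - m; n + 1; t)\<close>.\<close>

definition hyp_coeff :: "nat \<Rightarrow> nat \<Rightarrow> nat \<Rightarrow> complex"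
  where "hyp_coeff m n k = (\<Prod>i<k. (of_nat i - of_nat m) * (of_nat i + of_nat n - of_nat m)
    / (of_nat (Suc i) * of_nat (Suc i + n)))"

lemma hyp_coeff_0 [simp]: "hyp_coeff m n 0 = 1"
  by (simp add: hyp_coeff_def)

lemma hyp_coeff_Suc:
  "of_nat (Suc k) * of_nat (Suc k + n) * hyp_coeff m n (Suc k)
    = (of_nat k - of_nat m) * (of_nat k + of_nat n - of_nat m) * hyp_coeff m n k"
  unfolding hyp_coeff_def prod.lessThan_Suc by (simp del: of_nat_Suc of_nat_add)

text \<open>The factor i = m of the product vanishes, and for n \<le> m already the factor i = m -
  n. The second fact keeps the z-degree n + k at most m, so that no pole arises at z =
  \<infinity>.\<close>

lemma hyp_coeff_eq_0:
  "m < k \<Longrightarrow> hyp_coeff m n k = 0"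
  "n \<le> m \<Longrightarrow> m < n + k \<Longrightarrow> hyp_coeff m n k = 0"
proof -
  show "m < k \<Longrightarrow> hyp_coeff m n k = 0"
    unfolding hyp_coeff_def by (intro prod_zero bexI[of _ m]) auto
  assume "n \<le> m" "m < n + k"
  then show "hyp_coeff m n k = 0"
    unfolding hyp_coeff_def by (intro prod_zero bexI[of _ "m - n"]) (auto simp: of_nat_diff)
qed

definition hyp_poly :: "nat \<Rightarrow> nat \<Rightarrow> complex poly"
  where "hyp_poly m n = (\<Sum>k\<le>m. monom (hyp_coeff m n k) k)"

lemma coeff_hyp_poly: "coeff (hyp_poly m n) k = hyp_coeff m n k"
  by (simp add: hyp_poly_def coeff_sum hyp_coeff_eq_0)

lemma poly_hyp_poly: "poly (hyp_poly m n) t = (\<Sum>k\<le>m. hyp_coeff m n k * t ^ k)"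
  by (simp add: hyp_poly_def poly_sum poly_monom)

text \<open>The hypergeometric equation t(1-t) p'' + (c - (a+b+1) t) p' - a b p = 0 with a = -m, b =
  n - m, c = n + 1.\<close>

lemma hyp_poly_ode:
  fixes t :: complex and m n :: nat
  defines "p \<equiv> hyp_poly m n"
  shows "t * (1 - t) * poly (pderiv (pderiv p)) t
    + (of_nat n + 1 - (of_nat n - 2 * of_nat m + 1) * t) * poly (pderiv p) t
    - of_nat m * (of_nat m - of_nat n) * poly p t = 0"
proof -
  let ?c = "hyp_coeff m n"
  have c: "coeff p k = ?c k" for k by (simp add: p_def coeff_hyp_poly)
  have "pCons 0 (pderiv (pderiv p)) - pCons 0 (pCons 0 (pderiv (pderiv p)))
      + smult (of_nat n + 1) (pderiv p) - smult (of_nat n - 2 * of_nat m + 1) (pCons 0 (pderiv p))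
      - smult (of_nat m * (of_nat m - of_nat n)) p = 0" (is "?L = 0")
  proof (rule poly_eqI)
    fix k
    have x1: "coeff (pCons 0 (pderiv (pderiv p))) k = of_nat k * (of_nat (Suc k) * ?c (Suc k))"
      by (cases k) (simp_all add: coeff_pderiv c mult_ac)
    have x2: "coeff (pCons 0 (pCons 0 (pderiv (pderiv p)))) k = of_nat k * (of_nat k - 1) * ?c k"
      by (cases k; cases "k - 1") (simp_all add: coeff_pderiv c algebra_simps)
    have x3: "coeff (pCons 0 (pderiv p)) k = of_nat k * ?c k"
      by (cases k) (simp_all add: coeff_pderiv c)
    have x4: "coeff (pderiv p) k = of_nat (Suc k) * ?c (Suc k)" by (simp add: coeff_pderiv c)
    have "coeff ?L k = of_nat (Suc k) * of_nat (Suc k + n) * ?c (Suc k)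
        - (of_nat k - of_nat m) * (of_nat k + of_nat n - of_nat m) * ?c k"
      unfolding coeff_diff coeff_add coeff_smult x1 x2 x3 x4 c by (simp add: algebra_simps)
    then show "coeff ?L k = coeff 0 k" by (simp only: hyp_coeff_Suc) simp
  qed
  then have "poly ?L t = 0" by simp
  then show ?thesis by (simp add: algebra_simps)
qed

text \<open>The exponents of the radial equation at t = 1 solve \<rho>(\<rho> - 1) = m(m+1), so -m
  is one of them; splitting off (1 - t)^(-m) leaves the hypergeometric equation.\<close>

lemma hyp_radial_ode:
  assumes "mu = of_nat m * (of_nat m + 1)"
  shows "radial_ode mu n (\<lambda>t. poly (hyp_poly m n) t / (1 - t) ^ m) (ball 0 1)"
  unfolding radial_ode_def
proof (intro conjI ballI)
  let ?p = "hyp_poly m n"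
  have nz: "1 - t \<noteq> 0" if "t \<in> ball 0 1" for t :: complex using that by auto
  show "(\<lambda>t. poly ?p t / (1 - t) ^ m) holomorphic_on ball 0 1"
    by (intro holomorphic_intros) (use nz in auto)
  define q where "q = (\<lambda>t::complex. 1 / (1 - t))"
  define f where "f = (\<lambda>t. poly ?p t * q t ^ m)"
  have ff: "(\<lambda>t. poly ?p t / (1 - t) ^ m) = f"
    by (auto simp: f_def q_def power_divide)
  have dq: "(q has_field_derivative q t ^ 2) (at t)" if "t \<in> ball 0 1" for t
    unfolding q_def using nz[OF that] by (auto intro!: derivative_eq_intros simp: power2_eq_square)
  have dqk: "((\<lambda>t. q t ^ k) has_field_derivative of_nat k * q t ^ Suc k) (at t)" if "t \<in> ball 0 1" for t k
    using DERIV_power[OF dq[OF that], of k] by (cases k) (auto simp: power2_eq_square algebra_simps)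
  have dp: "((\<lambda>t. poly r t) has_field_derivative poly (pderiv r) t) (at t)" for r :: "complex poly" and t
    by (rule poly_DERIV)
  have f1: "deriv f t = poly (pderiv ?p) t * q t ^ m + of_nat m * (poly ?p t * q t ^ Suc m)" if "t \<in> ball 0 1" for t
    unfolding f_def using DERIV_mult[OF dp dqk[OF that], of ?p m]
    by (intro DERIV_imp_deriv) (simp add: mult_ac add_ac)
  have f2: "deriv (deriv f) t = poly (pderiv (pderiv ?p)) t * q t ^ m + 2 * of_nat m * (poly (pderiv ?p) t * q t ^ Suc m)
      + of_nat m * of_nat (Suc m) * (poly ?p t * q t ^ Suc (Suc m))" if t: "t \<in> ball 0 1" for t
  proof -
    have "((\<lambda>t. poly (pderiv ?p) t * q t ^ m + of_nat m * (poly ?p t * q t ^ Suc m)) has_field_derivative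
       (poly (pderiv (pderiv ?p)) t * q t ^ m + of_nat m * q t ^ Suc m * poly (pderiv ?p) t)
       + of_nat m * (poly (pderiv ?p) t * q t ^ Suc m + of_nat (Suc m) * q t ^ Suc (Suc m) * poly ?p t)) (at t)"
      by (intro DERIV_add DERIV_mult DERIV_cmult dp dqk t)
    then have "(deriv f has_field_derivative
       (poly (pderiv (pderiv ?p)) t * q t ^ m + of_nat m * q t ^ Suc m * poly (pderiv ?p) t)
       + of_nat m * (poly (pderiv ?p) t * q t ^ Suc m + of_nat (Suc m) * q t ^ Suc (Suc m) * poly ?p t)) (at t)"
      by (rule has_field_derivative_transform_within_open[OF _ open_ball t]) (simp add: f1)
    then show ?thesis by (simp add: DERIV_imp_deriv algebra_simps)
  qed
  have alg: "(1 - t)\<^sup>2 * (t * (p2 * Q + 2 * M * (p1 * (Q * s)) + M * (M + 1) * (p0 * (Q * s * s)))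
      + (N + 1) * (p1 * Q + M * (p0 * (Q * s)))) = M * (M + 1) * (p0 * Q)"
    if s: "(1 - t) * s = 1"
      and ode: "t * (1 - t) * p2 + (N + 1 - (N - 2 * M + 1) * t) * p1 - M * (M - N) * p0 = 0"
    for t p0 p1 p2 Q M N s :: complex
  proof -
    have "(1 - t)\<^sup>2 * (t * (p2 * Q + 2 * M * (p1 * (Q * s)) + M * (M + 1) * (p0 * (Q * s * s)))
      + (N + 1) * (p1 * Q + M * (p0 * (Q * s))))
      = Q * (t * ((1 - t)\<^sup>2 * p2 + 2 * M * (1 - t) * p1 * ((1 - t) * s) + M * (M + 1) * p0 * ((1 - t) * s)\<^sup>2)
        + (N + 1) * ((1 - t)\<^sup>2 * p1 + M * (1 - t) * p0 * ((1 - t) * s)))"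
      by (simp add: algebra_simps power2_eq_square)
    also have "\<dots> = Q * (t * ((1 - t)\<^sup>2 * p2 + 2 * M * (1 - t) * p1 + M * (M + 1) * p0)
        + (N + 1) * ((1 - t)\<^sup>2 * p1 + M * (1 - t) * p0))"
      unfolding s by simp
    also have "\<dots> = Q * ((1 - t) * (t * (1 - t) * p2 + (N + 1 - (N - 2 * M + 1) * t) * p1 - M * (M - N) * p0))
        + M * (M + 1) * (p0 * Q)"
      by (simp add: algebra_simps power2_eq_square)
    finally show ?thesis unfolding ode by simp
  qed
  fix t :: complex assume t: "t \<in> ball 0 1"
  have s: "(1 - t) * q t = 1" using nz[OF t] by (simp add: q_def)
  have "(1 - t)\<^sup>2 * (t * (poly (pderiv (pderiv ?p)) t * q t ^ m + 2 * of_nat m * (poly (pderiv ?p) t * (q t ^ m * q t))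
      + of_nat m * (of_nat m + 1) * (poly ?p t * (q t ^ m * q t * q t)))
      + (of_nat n + 1) * (poly (pderiv ?p) t * q t ^ m + of_nat m * (poly ?p t * (q t ^ m * q t))))
      = of_nat m * (of_nat m + 1) * (poly ?p t * q t ^ m)"
    by (rule alg[OF s hyp_poly_ode])
  then show "(1 - t)\<^sup>2 * (t * deriv (deriv (\<lambda>t. poly ?p t / (1 - t) ^ m)) t
      + of_nat (Suc n) * deriv (\<lambda>t. poly ?p t / (1 - t) ^ m) t) = mu * (poly ?p t / (1 - t) ^ m)"
    unfolding ff f1[OF t] f2[OF t] assms
    by (simp add: f_def q_def power_divide mult_ac add_ac)
qed

text \<open>The values at infinity are those of the expressions in 1/z and 1/w at the origin after
  cancelling against the denominator; 0^(m - k) keeps only k = m. The subtraction in m - (n + k) is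
  truncated for n + k > m, where for n \<le> m the coefficient is 0.\<close>

fun rational_ext :: "nat \<Rightarrow> nat \<Rightarrow> sphere \<times> sphere \<Rightarrow> complex" where
  "rational_ext m n (Some z, Some w) = (\<Sum>k\<le>m. hyp_coeff m n k * (z ^ (n + k) * w ^ k / (1 - z * w) ^ m))"
| "rational_ext m n (Some z, None) = (\<Sum>k\<le>m. hyp_coeff m n k * (z ^ (n + k) * 0 ^ (m - k) / (- z) ^ m))"
| "rational_ext m n (None, Some w) = (\<Sum>k\<le>m. hyp_coeff m n k * (0 ^ (m - (n + k)) * w ^ k / (- w) ^ m))"
| "rational_ext m n (None, None) = (\<Sum>k\<le>m. hyp_coeff m n k * (0 ^ (m - (n + k)) * 0 ^ (m - k) / (- 1) ^ m))"

text \<open>Valid for every n because the w-degree k never exceeds m, the exponent of the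
  denominator. Hence all weights extend to \<open>Omega_minus\<close>.\<close>

lemma rational_ext_SI:
  "rational_ext m n (Some z, sphere_inverse (Some w))
    = (\<Sum>k\<le>m. hyp_coeff m n k * (z ^ (n + k) * w ^ (m - k) / (w - z) ^ m))"
proof (cases "w = 0")
  case False
  have "z ^ (n + k) * (1 / w) ^ k / (1 - z * (1 / w)) ^ m = z ^ (n + k) * w ^ (m - k) / (w - z) ^ m" if "k \<le> m" for k
  proof -
    have 1: "1 - z * (1 / w) = (w - z) / w" using False by (simp add: field_simps)
    have "w ^ m = w ^ (m - k) * w ^ k" using that by (simp add: power_add[symmetric])
    then show ?thesis unfolding 1 using False by (simp add: power_divide)
  qed
  then show ?thesis using False by (simp del: mult_cancel_left)
qed simp

text \<open>The z-degree n + k may exceed m, but for n \<le> m exactly these terms have coefficient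
  0; here the restriction on n enters.\<close>

lemma rational_ext_IS:
  assumes "n \<le> m"
  shows "rational_ext m n (sphere_inverse (Some z), Some w)
    = (\<Sum>k\<le>m. hyp_coeff m n k * (z ^ (m - (n + k)) * w ^ k / (z - w) ^ m))"
proof (cases "z = 0")
  case False
  have "hyp_coeff m n k * ((1 / z) ^ (n + k) * w ^ k / (1 - 1 / z * w) ^ m)
      = hyp_coeff m n k * (z ^ (m - (n + k)) * w ^ k / (z - w) ^ m)" for k
  proof (cases "n + k \<le> m")
    case True
    have 1: "1 - 1 / z * w = (z - w) / z" using False by (simp add: field_simps)
    have "z ^ m = z ^ (m - (n + k)) * z ^ (n + k)" using True by (simp add: power_add[symmetric])
    then show ?thesis unfolding 1 using False by (simp add: power_divide)
  next
    case False
    then show ?thesis using hyp_coeff_eq_0(2)[OF assms] by simp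
  qed
  then show ?thesis using False by (simp del: mult_cancel_left)
qed simp

lemma rational_ext_II:
  assumes "n \<le> m"
  shows "rational_ext m n (sphere_inverse (Some z), sphere_inverse (Some w))
    = (\<Sum>k\<le>m. hyp_coeff m n k * (z ^ (m - (n + k)) * w ^ (m - k) / (z * w - 1) ^ m))"
proof (cases "w = 0")
  case False
  have "hyp_coeff m n k * (z ^ (m - (n + k)) * (1 / w) ^ k / (z - 1 / w) ^ m)
      = hyp_coeff m n k * (z ^ (m - (n + k)) * w ^ (m - k) / (z * w - 1) ^ m)" if "k \<le> m" for k
  proof -
    have 1: "z - 1 / w = (z * w - 1) / w" using False by (simp add: field_simps)
    have "w ^ m = w ^ (m - k) * w ^ k" using that by (simp add: power_add[symmetric])
    then show ?thesis unfolding 1 using False by (simp add: power_divide)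
  qed
  moreover have "sphere_inverse (Some w) = Some (1 / w)" using False by simp
  ultimately show ?thesis using rational_ext_IS[OF assms, of z "1 / w"] by (simp del: mult_cancel_left)
next
  case w: True
  show ?thesis
  proof (cases "z = 0")
    case False
    have "hyp_coeff m n k * ((1 / z) ^ (n + k) * 0 ^ (m - k) / (- (1 / z)) ^ m)
        = hyp_coeff m n k * (z ^ (m - (n + k)) * 0 ^ (m - k) / (- 1) ^ m)" for k
    proof (cases "n + k \<le> m")
      case True
      have "- (1 / z) = (- 1) / z" by simp
      moreover have "z ^ m = z ^ (m - (n + k)) * z ^ (n + k)" using True by (simp add: power_add[symmetric])
      ultimately show ?thesis using False by (simp only: power_divide) simp
    next
      case False
      then show ?thesis using hyp_coeff_eq_0(2)[OF assms] by simp
    qed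
    then show ?thesis using False w by (simp del: mult_cancel_left)
  qed (use w in simp)
qed

lemma weight_rational:
  assumes "lam = 4 * of_nat m * (of_nat m + 1)" "(z, w) \<in> bidisk"
  shows "rational_ext m n (Some z, Some w) = weight lam n (z, w)"
proof -
  have "radial_ode (lam / 4) n (\<lambda>t. poly (hyp_poly m n) t / (1 - t) ^ m) (ball 0 1)"
    by (rule hyp_radial_ode) (simp add: assms)
  moreover have "poly (hyp_poly m n) 0 / (1 - 0) ^ m = 1"
    by (simp add: poly_0_coeff_0 coeff_hyp_poly)
  ultimately have "weight lam n = weight_fun n (\<lambda>t. poly (hyp_poly m n) t / (1 - t) ^ m)"
    by (rule weight_unique[symmetric])
  then show ?thesis using assms(2)
    by (simp add: weight_fun_def poly_hyp_poly sum_distrib_left sum_divide_distrib power_add power_mult_distrib mult_ac)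
qed

lemma Omega_cases:
  "(Some z, Some w) \<in> Omega \<longleftrightarrow> z * w \<noteq> 1"
  "(Some z, None) \<in> Omega \<longleftrightarrow> z \<noteq> 0"
  "(None, Some w) \<in> Omega \<longleftrightarrow> w \<noteq> 0"
  "(None, None) \<in> Omega"
  by (auto simp: Omega_def)

lemma Omega_chart_denominators:
  "(Some z, sphere_inverse (Some w)) \<in> Omega \<Longrightarrow> w - z \<noteq> 0"
  "(sphere_inverse (Some z), Some w) \<in> Omega \<Longrightarrow> z - w \<noteq> 0"
  "(sphere_inverse (Some z), sphere_inverse (Some w)) \<in> Omega \<Longrightarrow> z * w - 1 \<noteq> 0"
  by (auto simp: Omega_cases split: if_splits)

lemma rational_ext_chart_holomorphic:
  assumes V: "V \<subseteq> Omega"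
  shows "holomorphic2_on (\<lambda>p. rational_ext m n (Some (fst p), Some (snd p))) {(z, w). (Some z, Some w) \<in> V}"
    and "holomorphic2_on (\<lambda>p. rational_ext m n (Some (fst p), sphere_inverse (Some (snd p))))
      {(z, w). (Some z, sphere_inverse (Some w)) \<in> V}"
proof -
  show "holomorphic2_on (\<lambda>p. rational_ext m n (Some (fst p), Some (snd p))) {(z, w). (Some z, Some w) \<in> V}"
    unfolding rational_ext.simps
  proof (intro holomorphic2_intros)
    fix p assume "p \<in> {(z, w). (Some z, Some w) \<in> V}"
    then have "1 - fst p * snd p \<noteq> 0" using V Omega_cases(1)[of "fst p" "snd p"] by auto
    then show "(1 - fst p * snd p) ^ m \<noteq> 0" by simp
  qed
  show "holomorphic2_on (\<lambda>p. rational_ext m n (Some (fst p), sphere_inverse (Some (snd p))))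
      {(z, w). (Some z, sphere_inverse (Some w)) \<in> V}"
    unfolding rational_ext_SI
  proof (intro holomorphic2_intros)
    fix p assume "p \<in> {(z, w). (Some z, sphere_inverse (Some w)) \<in> V}"
    then have "(Some (fst p), sphere_inverse (Some (snd p))) \<in> Omega"
      using V by (simp only: mem_Collect_eq case_prod_unfold) blast
    from Omega_chart_denominators(1)[OF this] show "(snd p - fst p) ^ m \<noteq> 0" by simp
  qed
qed

text \<open>There is no bound on n: points with z = \<infinity> are excluded, so only the w-degree
  matters. For n = m + 1 this, together with its swap on \<open>Omega_plus\<close>, refutes E- and
  E+ for the finite-dimensional space.\<close>

lemma weight_ext_Omega_minus:
  assumes lam: "lam = 4 * of_nat m * (of_nat m + 1)"
  shows "weight lam n \<in> eigenspace_ext lam Omega_minus"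
proof -
  have V: "Omega_minus \<subseteq> Omega" by (auto simp: Omega_minus_def)
  have N: "(None, w) \<notin> Omega_minus" for w by (auto simp: Omega_minus_def)
  note h = rational_ext_chart_holomorphic[OF V, of m n]
  have "sphere_holomorphic2_on (rational_ext m n) Omega_minus"
    unfolding sphere_holomorphic2_on_def sphere_params_def case_prod_unfold
    using h chart_inverse_fst[OF h(1) N]
      chart_inverse_fst[where \<tau> = "\<lambda>w. sphere_inverse (Some w)", OF h(2) N]
    by (simp add: case_prod_unfold del: sphere_inverse.simps rational_ext.simps)
  moreover have "\<forall>z w. (z, w) \<in> bidisk \<longrightarrow> rational_ext m n (Some z, Some w) = weight lam n (z, w)"
    using weight_rational[OF lam] by blast
  ultimately show ?thesis using weight_eigenspace unfolding eigenspace_ext_iff by blast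
qed

lemma weight_ext_Omega:
  assumes lam: "lam = 4 * of_nat m * (of_nat m + 1)" and n: "n \<le> m"
  shows "weight lam n \<in> eigenspace_ext lam Omega"
proof -
  note h = rational_ext_chart_holomorphic[OF subset_refl, of m n]
  have IS: "holomorphic2_on (\<lambda>p. rational_ext m n (sphere_inverse (Some (fst p)), Some (snd p)))
      {(z, w). (sphere_inverse (Some z), Some w) \<in> Omega}"
    unfolding rational_ext_IS[OF n]
  proof (intro holomorphic2_intros)
    fix p assume "p \<in> {(z, w). (sphere_inverse (Some z), Some w) \<in> Omega}"
    then have "(sphere_inverse (Some (fst p)), Some (snd p)) \<in> Omega" by (simp only: mem_Collect_eq case_prod_unfold)
    from Omega_chart_denominators(2)[OF this] show "(fst p - snd p) ^ m \<noteq> 0" by simp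
  qed
  have II: "holomorphic2_on (\<lambda>p. rational_ext m n (sphere_inverse (Some (fst p)), sphere_inverse (Some (snd p))))
      {(z, w). (sphere_inverse (Some z), sphere_inverse (Some w)) \<in> Omega}"
    unfolding rational_ext_II[OF n]
  proof (intro holomorphic2_intros)
    fix p assume "p \<in> {(z, w). (sphere_inverse (Some z), sphere_inverse (Some w)) \<in> Omega}"
    then have "(sphere_inverse (Some (fst p)), sphere_inverse (Some (snd p))) \<in> Omega" by (simp only: mem_Collect_eq case_prod_unfold)
    from Omega_chart_denominators(3)[OF this] show "(fst p * snd p - 1) ^ m \<noteq> 0" by simp
  qed
  have "sphere_holomorphic2_on (rational_ext m n) Omega"
    unfolding sphere_holomorphic2_on_def sphere_params_def case_prod_unfold
    using h IS II
    by (simp add: case_prod_unfold del: sphere_inverse.simps rational_ext.simps)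
  moreover have "\<forall>z w. (z, w) \<in> bidisk \<longrightarrow> rational_ext m n (Some z, Some w) = weight lam n (z, w)"
    using weight_rational[OF lam] by blast
  ultimately show ?thesis using weight_eigenspace unfolding eigenspace_ext_iff by blast
qed

section \<open>Coefficient functionals, bases and dimensions\<close>

lemma coef_weight: "coef n (weight lam k) = (if n = k then 1 else 0)"
  and coef_weight_swap: "coef n (weight lam k \<circ> prod.swap) = (if n = 0 \<and> k = 0 then 1 else 0)"
proof -
  have ev: "\<forall>\<^sub>F z in nhds (0::complex). norm z < 1"
    using eventually_nhds_in_open[of "ball (0::complex) 1" 0] by simp
  have "(deriv ^^ n) (\<lambda>z. weight lam k (z, 0)) 0 = (deriv ^^ n) (\<lambda>z. z ^ k) 0"
    by (rule higher_deriv_cong_ev[OF eventually_mono[OF ev]]) (simp_all add: weight_data)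
  then show "coef n (weight lam k) = (if n = k then 1 else 0)"
    by (simp add: coef_def higher_deriv_power_0)
  have "(deriv ^^ n) (\<lambda>z. weight lam k (0, z)) 0 = (deriv ^^ n) (\<lambda>z. if k = 0 then 1 else 0) 0"
    by (rule higher_deriv_cong_ev[OF eventually_mono[OF ev]]) (simp_all add: weight_data)
  then show "coef n (weight lam k \<circ> prod.swap) = (if n = 0 \<and> k = 0 then 1 else 0)"
    by (simp add: coef_def)
qed

lemma coef_linear:
  assumes "holomorphic2_on F bidisk" "holomorphic2_on H bidisk"
  shows "coef n (\<lambda>p. a * F p + b * H p) = a * coef n F + b * coef n H"
proof -
  note h = holomorphic2_slice0[OF assms(1)] holomorphic2_slice0[OF assms(2)]
  have "(deriv ^^ n) (\<lambda>z. a * F (z, 0) + b * H (z, 0)) 0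
      = (deriv ^^ n) (\<lambda>z. a * F (z, 0)) 0 + (deriv ^^ n) (\<lambda>z. b * H (z, 0)) 0"
    by (rule higher_deriv_add[of _ "ball 0 1"]) (auto intro!: holomorphic_intros h)
  also have "(deriv ^^ n) (\<lambda>z. a * F (z, 0)) 0 = a * (deriv ^^ n) (\<lambda>z. F (z, 0)) 0"
    by (rule higher_deriv_cmult[OF h(1)]) auto
  also have "(deriv ^^ n) (\<lambda>z. b * H (z, 0)) 0 = b * (deriv ^^ n) (\<lambda>z. H (z, 0)) 0"
    by (rule higher_deriv_cmult[OF h(2)]) auto
  finally show ?thesis by (simp add: coef_def add_divide_distrib)
qed

lemma sum_fun_eq: "(\<Sum>i\<in>I. f i) = (\<lambda>x. \<Sum>i\<in>I. f i x :: complex)"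
  by (induction I rule: infinite_finite_induct) (auto simp: fun_eq_iff)

text \<open>The index is the character under rotations, which multiply the j-th function by c^j.
  Integers list the symmetric weight 0 once, so the indices from -m to m give the dimension 2m +
  1.\<close>

definition weight_basis :: "complex \<Rightarrow> int \<Rightarrow> complex \<times> complex \<Rightarrow> complex"
  where "weight_basis lam j = (if j \<ge> 0 then weight lam (nat j) else weight lam (nat (- j)) \<circ> prod.swap)"

definition signed_coef :: "int \<Rightarrow> (complex \<times> complex \<Rightarrow> complex) \<Rightarrow> complex"
  where "signed_coef j F = (if j \<ge> 0 then coef (nat j) F else coef (nat (- j)) (F \<circ> prod.swap))"

lemma swap_swap: "(F \<circ> prod.swap) \<circ> prod.swap = F"
  by (auto simp: fun_eq_iff)

lemma signed_coef_weight_basis: "signed_coef i (weight_basis lam j) = (if i = j then 1 else 0)"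
  unfolding signed_coef_def weight_basis_def
  by (auto simp: coef_weight coef_weight_swap swap_swap)

lemma weight_basis_eigenspace: "weight_basis lam j \<in> eigenspace lam"
  by (simp add: weight_basis_def weight_eigenspace eigenspace_swap)

lemma signed_coef_linear:
  assumes "F \<in> eigenspace lam" "H \<in> eigenspace lam"
  shows "signed_coef j (\<lambda>p. a * F p + b * H p) = a * signed_coef j F + b * signed_coef j H"
proof -
  have "(\<lambda>p. a * F p + b * H p) \<circ> prod.swap = (\<lambda>p. a * (F \<circ> prod.swap) p + b * (H \<circ> prod.swap) p)"
    by auto
  then show ?thesis unfolding signed_coef_def
    using coef_linear[OF eigenspace_holomorphic2[OF assms(1)] eigenspace_holomorphic2[OF assms(2)]]
      coef_linear[OF eigenspace_holomorphic2[OF eigenspace_swap[OF assms(1)]] eigenspace_holomorphic2[OF eigenspace_swap[OF assms(2)]]]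
    by simp
qed

lemma subspaceI:
  assumes "(\<lambda>_. 0) \<in> S" "\<And>F H a b. F \<in> S \<Longrightarrow> H \<in> S \<Longrightarrow> (\<lambda>p. a * F p + b * H p) \<in> S"
  shows "cfun.subspace S"
  unfolding cfun.subspace_def
proof (intro conjI ballI allI)
  show "0 \<in> S" using assms(1) by (simp add: zero_fun_def)
  show "F + H \<in> S" if "F \<in> S" "H \<in> S" for F H
    using assms(2)[OF that, of 1 1] by (simp add: plus_fun_def)
  show "(\<lambda>p. c * F p) \<in> S" if "F \<in> S" for c F
    using assms(2)[OF that that, of c 0] by simp
qed

lemma signed_coef_kernel:
  "cfun.subspace {F \<in> eigenspace lam. \<forall>j\<in>J. signed_coef j F = 0}"
proof (rule subspaceI)
  have "signed_coef j (\<lambda>_. 0) = 0" for j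
    using signed_coef_linear[OF eigenspace_0 eigenspace_0, of j 0 0] by simp
  then show "(\<lambda>_. 0) \<in> {F \<in> eigenspace lam. \<forall>j\<in>J. signed_coef j F = 0}"
    by (simp add: eigenspace_0)
qed (auto intro: eigenspace_linear simp: signed_coef_linear)

lemma inj_weight_basis: "inj (weight_basis lam)"
  by (rule injI) (metis signed_coef_weight_basis zero_neq_one)

text \<open>\<open>signed_coef j\<close> is dual to the family: its kernel contains all other
  members, hence their span, but not the j-th one.\<close>

lemma independent_weight_basis: "cfun.independent (weight_basis lam ` J)"
  unfolding cfun.dependent_def
proof safe
  fix j assume j: "j \<in> J" "weight_basis lam j \<in> cfun.span (weight_basis lam ` J - {weight_basis lam j})"
  let ?K = "{F \<in> eigenspace lam. \<forall>i\<in>{j}. signed_coef i F = 0}"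
  have "cfun.span (weight_basis lam ` J - {weight_basis lam j}) \<subseteq> ?K"
    by (rule cfun.span_minimal[OF _ signed_coef_kernel])
      (auto simp: weight_basis_eigenspace signed_coef_weight_basis)
  then show False using j(2) by (auto simp: signed_coef_weight_basis)
qed

lemma card_weight_basis: "card (weight_basis lam ` {- int m..int m}) = 2 * m + 1"
  using card_image[OF inj_on_subset[OF inj_weight_basis subset_UNIV], of lam "{- int m..int m}"] by simp

lemma weight_space_eq_kernel:
  "weight_space lam m = {F \<in> eigenspace lam. \<forall>j\<in>{j. \<bar>j\<bar> > int m}. signed_coef j F = 0}"
proof -
  have "(\<forall>k>m. coef k F = 0 \<and> swap_coef k F = 0) \<longleftrightarrow> (\<forall>j\<in>{j. \<bar>j\<bar> > int m}. signed_coef j F = 0)" for F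
  proof
    assume a: "\<forall>k>m. coef k F = 0 \<and> swap_coef k F = 0"
    show "\<forall>j\<in>{j. \<bar>j\<bar> > int m}. signed_coef j F = 0"
    proof
      fix j assume "j \<in> {j. \<bar>j\<bar> > int m}"
      then have "nat \<bar>j\<bar> > m" by simp
      then have "coef (nat \<bar>j\<bar>) F = 0" "swap_coef (nat \<bar>j\<bar>) F = 0" "nat \<bar>j\<bar> \<noteq> 0" using a by auto
      then show "signed_coef j F = 0" by (auto simp: signed_coef_def swap_coef_def split: if_splits)
    qed
  next
    assume a: "\<forall>j\<in>{j. \<bar>j\<bar> > int m}. signed_coef j F = 0"
    show "\<forall>k>m. coef k F = 0 \<and> swap_coef k F = 0"
    proof (intro allI impI)
      fix k assume k: "k > m"
      then show "coef k F = 0 \<and> swap_coef k F = 0"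
        using bspec[OF a, of "int k"] bspec[OF a, of "- int k"] by (auto simp: signed_coef_def swap_coef_def)
    qed
  qed
  then show ?thesis by (simp add: weight_space_def)
qed

lemma span_weight_basis: "cfun.span (weight_basis lam ` {- int m..int m}) = weight_space lam m"
proof
  show "cfun.span (weight_basis lam ` {- int m..int m}) \<subseteq> weight_space lam m"
    unfolding weight_space_eq_kernel
    by (rule cfun.span_minimal[OF _ signed_coef_kernel])
      (auto simp: weight_basis_eigenspace signed_coef_weight_basis)
  show "weight_space lam m \<subseteq> cfun.span (weight_basis lam ` {- int m..int m})"
  proof
    fix F assume F: "F \<in> weight_space lam m"
    let ?B = "weight_basis lam ` {- int m..int m}"
    have "weight_term lam (\<lambda>n. coef n F) (\<lambda>n. swap_coef n F) k \<in> cfun.span ?B" if k: "k \<le> m" for k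
    proof -
      have "weight_basis lam (int k) \<in> cfun.span ?B" using k by (intro cfun.span_base) auto
      then have 1: "(\<lambda>x. coef k F * weight lam k x) \<in> cfun.span ?B"
        using cfun.span_scale[of "weight_basis lam (int k)" ?B "coef k F"] by (simp add: weight_basis_def)
      have 2: "(\<lambda>x. swap_coef k F * weight lam k (prod.swap x)) \<in> cfun.span ?B"
      proof (cases "k = 0")
        case True
        then show ?thesis using cfun.span_zero[of ?B] by (simp add: swap_coef_def zero_fun_def)
      next
        case False
        have "weight_basis lam (- int k) \<in> cfun.span ?B" using k by (intro cfun.span_base) auto
        then show ?thesis
          using cfun.span_scale[of "weight_basis lam (- int k)" ?B "swap_coef k F"] False
          by (simp add: weight_basis_def)
      qed
      show ?thesis using cfun.span_add[OF 1 2] by (simp add: weight_term_def plus_fun_def)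
    qed
    then have "(\<Sum>k\<le>m. weight_term lam (\<lambda>n. coef n F) (\<lambda>n. swap_coef n F) k) \<in> cfun.span ?B"
      by (intro cfun.span_sum) auto
    then show "F \<in> cfun.span ?B" using weight_space_expansion[OF F] by (simp add: sum_fun_eq)
  qed
qed

lemma weight_space_dim: "finite_dim (weight_space lam m)" "cfun.dim (weight_space lam m) = 2 * m + 1"
proof -
  let ?B = "weight_basis lam ` {- int m..int m}"
  show "finite_dim (weight_space lam m)"
    unfolding finite_dim_def
    by (intro exI[of _ ?B]) (auto simp: span_weight_basis[symmetric] cfun.span_base)
  have "cfun.span ?B = cfun.span (weight_space lam m)"
    unfolding span_weight_basis[symmetric] cfun.span_span ..
  from cfun.dim_eq_card[OF this independent_weight_basis]
  show "cfun.dim (weight_space lam m) = 2 * m + 1" by (simp add: card_weight_basis)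
qed

lemma eigenspace_not_finite_dim: "\<not> finite_dim (eigenspace lam)"
proof
  assume "finite_dim (eigenspace lam)"
  then obtain B where B: "finite B" "eigenspace lam \<subseteq> cfun.span B" unfolding finite_dim_def by blast
  \<comment> \<open>An independent family of 2 card B + 1 elements is too large for the span of card
    B elements.\<close>
  let ?W = "weight_basis lam ` {- int (card B)..int (card B)}"
  have "?W \<subseteq> cfun.span B" using B(2) weight_basis_eigenspace by blast
  then have "card ?W \<le> card B" using cfun.independent_span_bound[OF B(1) independent_weight_basis] by blast
  then show False by (simp add: card_weight_basis)
qed

text \<open>By Cauchy's estimate on |z| = 1/2 the coefficients are continuous for locally uniform
  convergence. The map s covers the coefficients on both axes at once.\<close>

lemma closure_coef_eq_0:
  assumes A: "A \<subseteq> eigenspace lam" and F: "F \<in> eigenspace lam" "F \<in> hol_topology bidisk closure_of A"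
    and s: "s = id \<or> s = prod.swap" and c: "\<And>H. H \<in> A \<Longrightarrow> coef n (H \<circ> s) = 0"
  shows "coef n (F \<circ> s) = 0"
proof -
  have sX: "H \<circ> s \<in> eigenspace lam" if "H \<in> eigenspace lam" for H
    using s that eigenspace_swap[OF that] by auto
  have "norm (coef n (F \<circ> s)) \<le> 0 + e" if e: "e > 0" for e
  proof -
    define K where "K = s ` (cball 0 (1/2) \<times> {0}) "
    have "continuous_on UNIV s"
      using s unfolding prod.swap_def id_def by (auto intro!: continuous_intros)
    then have "compact K" unfolding K_def
      by (intro compact_continuous_image compact_Times compact_cball) (auto intro: continuous_on_subset)
    moreover have "K \<subseteq> bidisk" unfolding K_def using s by (auto simp: mem_bidisk)
    \<comment> \<open>This tolerance compensates the division by (1/2)^n in Cauchy's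
      estimate.\<close>
    moreover have "0 < e * (1/2) ^ n" using e by simp
    moreover have Ah: "A \<subseteq> hol_space bidisk" using A by (auto simp: eigenspace_def)
    moreover have "\<forall>K e. compact K \<and> K \<subseteq> bidisk \<and> 0 < e \<longrightarrow> (\<exists>G\<in>A. \<forall>p\<in>K. dist (G p) (F p) < e)"
      using F(2) unfolding closure_of_hol_topology[OF Ah] by simp
    ultimately obtain H where H: "H \<in> A" "\<forall>p\<in>K. dist (H p) (F p) < e * (1/2) ^ n"
      by meson
    have hF: "holomorphic2_on (F \<circ> s) bidisk" "holomorphic2_on (H \<circ> s) bidisk"
      using sX F(1) A H(1) by (auto intro: eigenspace_holomorphic2)
    have "norm (coef n (\<lambda>p. 1 * (F \<circ> s) p + (-1) * (H \<circ> s) p)) \<le> e * (1/2) ^ n / (1/2) ^ n"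
    proof (rule coef_bound)
      show "holomorphic2_on (\<lambda>p. 1 * (F \<circ> s) p + (-1) * (H \<circ> s) p) bidisk"
        by (intro holomorphic2_intros hF)
      show "norm (1 * (F \<circ> s) (z, 0) + (-1) * (H \<circ> s) (z, 0)) \<le> e * (1/2) ^ n" if "norm z = 1/2" for z
      proof -
        have "s (z, 0) \<in> K" unfolding K_def using that by auto
        then have "dist (H (s (z, 0))) (F (s (z, 0))) < e * (1/2) ^ n" using H(2) by blast
        then show ?thesis by (simp add: dist_norm norm_minus_commute)
      qed
    qed auto
    also have "coef n (\<lambda>p. 1 * (F \<circ> s) p + (-1) * (H \<circ> s) p) = coef n (F \<circ> s)"
      unfolding coef_linear[OF hF] using c[OF H(1)] by simp
    finally show ?thesis by simp
  qed
  then have "norm (coef n (F \<circ> s)) \<le> 0" by (rule field_le_epsilon)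
  then show ?thesis by simp
qed

section \<open>Which density statements hold\<close>

lemma ext_subset: "eigenspace_ext lam V \<subseteq> eigenspace lam"
  by (auto simp: eigenspace_ext_iff)

lemma Omega_plus_minus:
  "(z, w) \<in> Omega_plus \<longleftrightarrow> (w, z) \<in> Omega_minus" "(z, w) \<in> Omega \<longleftrightarrow> (w, z) \<in> Omega"
proof -
  have "sphere_mult z w = sphere_mult w z" by (cases z; cases w) (auto simp: mult.commute)
  then show "(z, w) \<in> Omega_plus \<longleftrightarrow> (w, z) \<in> Omega_minus" "(z, w) \<in> Omega \<longleftrightarrow> (w, z) \<in> Omega"
    by (auto simp: Omega_plus_def Omega_minus_def Omega_def)
qed

lemma exceptional_ne:
  fixes m k :: nat
  assumes "m < k"
  shows "4 * complex_of_nat m * (of_nat m + 1) \<noteq> 4 * of_nat k * (of_nat k + 1)"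
proof
  assume "4 * complex_of_nat m * (of_nat m + 1) = 4 * of_nat k * (of_nat k + 1)"
  then have "complex_of_nat (4 * m * (m + 1)) = of_nat (4 * k * (k + 1))"
    by (simp only: of_nat_mult of_nat_add of_nat_numeral of_nat_1)
  then have "4 * m * (m + 1) = 4 * k * (k + 1)" by (simp only: of_nat_eq_iff)
  moreover have "m * (m + 1) < k * (k + 1)" using assms by (intro mult_strict_mono) auto
  ultimately show False by simp
qed

text \<open>lam equals 4m(m+1) for at most one m; then n = m + 1 works, and otherwise any n.\<close>

lemma exists_missing_weight:
  "\<exists>n\<ge>1. \<forall>k\<ge>n. lam \<noteq> 4 * complex_of_nat k * (of_nat k + 1)"
proof (cases "\<exists>m::nat. lam = 4 * of_nat m * (of_nat m + 1)")
  case True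
  then obtain m :: nat where m: "lam = 4 * of_nat m * (of_nat m + 1)" by blast
  show ?thesis by (rule exI[of _ "Suc m"]) (use m exceptional_ne in auto)
qed auto

lemma eigenspace_ext_minus_coef:
  assumes F: "F \<in> eigenspace_ext lam Omega_minus" and n: "n \<ge> 1"
    and lam: "\<And>k::nat. k \<ge> n \<Longrightarrow> lam \<noteq> 4 * of_nat k * (of_nat k + 1)"
  shows "coef n (F \<circ> prod.swap) = 0"
  using eigenspace_ext_plus_coef[OF eigenspace_ext_swap[OF F] n lam] Omega_plus_minus(1) by blast

text \<open>For suitable n the coefficient n vanishes on all functions extending to
  \<open>Omega_plus\<close>, hence on the eigenfunctions in their closure, but it is 1 on weight
  n.\<close>

lemma not_dense_plus: "\<not> eigenspace lam \<subseteq> hol_topology bidisk closure_of eigenspace_ext lam Omega_plus"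
proof
  assume d: "eigenspace lam \<subseteq> hol_topology bidisk closure_of eigenspace_ext lam Omega_plus"
  obtain n where n: "n \<ge> 1" "\<And>k. k \<ge> n \<Longrightarrow> lam \<noteq> 4 * complex_of_nat k * (of_nat k + 1)"
    using exists_missing_weight by blast
  have "coef n (weight lam n \<circ> id) = 0"
    by (rule closure_coef_eq_0[OF ext_subset weight_eigenspace])
      (use d weight_eigenspace eigenspace_ext_plus_coef[OF _ n] in auto)
  then show False by (simp add: coef_weight)
qed

lemma not_dense_minus: "\<not> eigenspace lam \<subseteq> hol_topology bidisk closure_of eigenspace_ext lam Omega_minus"
proof
  assume d: "eigenspace lam \<subseteq> hol_topology bidisk closure_of eigenspace_ext lam Omega_minus"
  obtain n where n: "n \<ge> 1" "\<And>k. k \<ge> n \<Longrightarrow> lam \<noteq> 4 * complex_of_nat k * (of_nat k + 1)"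
    using exists_missing_weight by blast
  have "coef n ((weight lam n \<circ> prod.swap) \<circ> prod.swap) = 0"
    by (rule closure_coef_eq_0[OF ext_subset eigenspace_swap[OF weight_eigenspace]])
      (use d eigenspace_swap[OF weight_eigenspace] eigenspace_ext_minus_coef[OF _ n] in auto)
  then show False by (simp add: swap_swap coef_weight)
qed

lemma weight_term_ext:
  assumes "weight lam n \<in> eigenspace_ext lam V" "\<And>z w. (z, w) \<in> V \<Longrightarrow> (w, z) \<in> V"
  shows "weight_term lam p q n \<in> eigenspace_ext lam V"
  using eigenspace_ext_linear[OF assms(1) eigenspace_ext_swap[OF assms], of "p n" "q n"]
  by (simp add: weight_term_def)

lemma Omega_star_swap: "(z, w) \<in> Omega_star \<Longrightarrow> (w, z) \<in> Omega_star"
  unfolding Omega_star_def by (auto simp: mult.commute)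

text \<open>The partial sums of the weight expansion extend, since every weight does and
  \<open>Omega_star\<close> is symmetric under the swap.\<close>

lemma dense_star: "eigenspace lam \<subseteq> hol_topology bidisk closure_of eigenspace_ext lam Omega_star"
proof
  fix F assume F: "F \<in> eigenspace lam"
  have sub: "eigenspace_ext lam Omega_star \<subseteq> hol_space bidisk"
    using ext_subset by (auto simp: eigenspace_def)
  let ?p = "\<lambda>n. coef n F" and ?q = "\<lambda>n. swap_coef n F"
  have "\<exists>G\<in>eigenspace_ext lam Omega_star. \<forall>p\<in>K. dist (G p) (F p) < e"
    if K: "compact K" "K \<subseteq> bidisk" "0 < e" for K e
  proof -
    have "uniform_limit K (\<lambda>N x. \<Sum>n<N. weight_term lam ?p ?q n x) F sequentially"
      using weight_series(2)[OF disk_coeffs_coef[OF eigenspace_holomorphic2[OF F]] disk_coeffs_swap_coef[OF F] K(1,2), of lam]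
        eigenspace_expansion[OF F] by simp
    from uniform_limitD[OF this K(3)]
    obtain N where N: "\<forall>x\<in>K. dist (\<Sum>n<N. weight_term lam ?p ?q n x) (F x) < e"
      unfolding eventually_sequentially by blast
    have "(\<lambda>x. \<Sum>n<N. weight_term lam ?p ?q n x) \<in> eigenspace_ext lam Omega_star"
      by (intro eigenspace_ext_sum weight_term_ext[OF weight_ext_star Omega_star_swap])
    then show ?thesis by (rule bexI[rotated]) (rule N)
  qed
  then show "F \<in> hol_topology bidisk closure_of eigenspace_ext lam Omega_star"
    unfolding closure_of_hol_topology[OF sub] using F by (auto simp: eigenspace_def)
qed

text \<open>The eigenfunction with \<open>F (z, 0) = 1 / (1 - z)\<close> does not extend to \<open>(1, 0)\<close>.\<close>

lemma eigenspace_ne_ext_star: "eigenspace lam \<noteq> eigenspace_ext lam Omega_star"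
proof
  assume eq: "eigenspace lam = eigenspace_ext lam Omega_star"
  have dc: "disk_coeffs (\<lambda>_. 1)" "disk_coeffs (\<lambda>_. 0)" by (auto simp: disk_coeffs_def summable_geometric)
  define F where "F = weight_series lam (\<lambda>_. 1) (\<lambda>_. 0)"
  have FX: "F \<in> eigenspace lam" unfolding F_def by (rule weight_series(3)[OF dc])
  then have "F \<in> eigenspace_ext lam Omega_star" unfolding eq .
  then obtain G where G: "sphere_holomorphic2_on G Omega_star"
    "\<And>z w. (z, w) \<in> bidisk \<Longrightarrow> G (Some z, Some w) = F (z, w)"
    unfolding eigenspace_ext_iff by blast
  have Fz: "F (z, 0) = 1 / (1 - z)" if "norm z < 1" for z
  proof -
    have "(\<lambda>n. z ^ n) sums F (z, 0)"
      using weight_series(1)[OF dc, of "(z, 0)" lam] that by (simp add: F_def weight_term_def weight_data mem_bidisk)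
    then show ?thesis using geometric_sums[OF that] sums_unique2 by blast
  qed
  have h: "holomorphic2_on (\<lambda>p. G (Some (fst p), Some (snd p))) {(z, w). (Some z, Some w) \<in> Omega_star}"
    using G(1) unfolding sphere_holomorphic2_on_def sphere_params_def by (auto simp: case_prod_unfold)
  have "(\<lambda>z. G (Some z, Some 0)) holomorphic_on UNIV"
    using holomorphic2_on_slice(1)[OF h, of UNIV 0] by (force simp: Omega_star_def)
  \<comment> \<open>The factor 1 - z clears the pole: the product is 1 on the unit disk, hence on
    the whole plane, yet it vanishes at z = 1.\<close>
  then have "(\<lambda>z. G (Some z, Some 0) * (1 - z)) holomorphic_on UNIV" by (intro holomorphic_intros)
  moreover have "G (Some z, Some 0) * (1 - z) = 1" if "z \<in> ball 0 1" for z
  proof -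
    have "1 - z \<noteq> 0" using that by auto
    then show ?thesis using Fz[of z] G(2)[of z 0] that by (simp add: mem_bidisk)
  qed
  ultimately have "G (Some 1, Some 0) * (1 - 1) = 1"
    using analytic_continuation_open[of "ball 0 1" UNIV "\<lambda>z. G (Some z, Some 0) * (1 - z)" "\<lambda>_. 1" 1] connected_UNIV by simp
  then show False by simp
qed

text \<open>As E+ and E- are refuted in both cases of \<open>invariant_classification\<close>, the
  exclusive alternative reduces to E0 against NE, decided by whether \<open>Y\<close> is a
  \<open>weight_space\<close> or the full eigenspace.\<close>

theorem theorem2p8:
  fixes lam :: complex and Y :: "(complex \<times> complex \<Rightarrow> complex) set"
  assumes "moebius_invariant_subspace lam Y" and "Y \<noteq> {0}"
  shows
    "((alt_E0 lam Y \<and> \<not> alt_Eplus lam Y \<and> \<not> alt_Eminus lam Y \<and> \<not> alt_NE lam Y) \<or>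
      (\<not> alt_E0 lam Y \<and> alt_Eplus lam Y \<and> \<not> alt_Eminus lam Y \<and> \<not> alt_NE lam Y) \<or>
      (\<not> alt_E0 lam Y \<and> \<not> alt_Eplus lam Y \<and> alt_Eminus lam Y \<and> \<not> alt_NE lam Y) \<or>
      (\<not> alt_E0 lam Y \<and> \<not> alt_Eplus lam Y \<and> \<not> alt_Eminus lam Y \<and> alt_NE lam Y)) \<and>
     (alt_NE lam Y \<longrightarrow> Y = eigenspace lam) \<and>
     ((\<forall>m::nat. lam \<noteq> 4 * of_nat m * (of_nat m + 1)) \<longrightarrow>
       \<not> alt_E0 lam Y \<and> \<not> alt_Eplus lam Y \<and> \<not> alt_Eminus lam Y) \<and>
     (alt_E0 lam Y \<longleftrightarrow> finite_dim Y) \<and>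
     (finite_dim Y \<longrightarrow>
       (\<exists>m::nat. cfun.dim Y = 2 * m + 1 \<and> lam = 4 * of_nat m * (of_nat m + 1))) \<and>
     (alt_NE lam Y \<longrightarrow> Y \<noteq> eigenspace_ext lam Omega_star) \<and>
     (alt_Eplus lam Y \<longrightarrow> Y \<noteq> eigenspace_ext lam Omega_plus) \<and>
     (alt_Eminus lam Y \<longrightarrow> Y \<noteq> eigenspace_ext lam Omega_minus)"
  using invariant_classification[OF assms]
proof (elim disjE exE conjE)
  assume Y: "Y = eigenspace lam"
  have "\<not> alt_E0 lam Y" "\<not> finite_dim Y"
    using eigenspace_not_finite_dim by (auto simp: alt_E0_def Y)
  moreover have "\<not> alt_Eplus lam Y" "\<not> alt_Eminus lam Y"
    using not_dense_plus not_dense_minus by (auto simp: alt_Eplus_def alt_Eminus_def dense_in_def Y)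
  moreover have "alt_NE lam Y"
    using dense_star ext_subset by (simp add: alt_NE_def dense_in_def Y)
  moreover have "Y \<noteq> eigenspace_ext lam Omega_star" using eigenspace_ne_ext_star by (simp add: Y)
  ultimately show ?thesis using Y by blast
next
  fix m :: nat assume lam: "lam = 4 * of_nat m * (of_nat m + 1)" and Y: "Y = weight_space lam m"
  have ne: "lam \<noteq> 4 * of_nat k * (of_nat k + 1)" if "k > m" for k
    unfolding lam using exceptional_ne[OF that] .
  \<comment> \<open>The inclusions demanded by E+, E- and NE fail at index m + 1: weight m + 1
    extends to \<open>Omega_minus\<close> and \<open>Omega_star\<close>, its swap to
    \<open>Omega_plus\<close>, and neither lies in \<open>Y\<close>.\<close>
  have w: "weight lam (Suc m) \<notin> Y" "weight lam (Suc m) \<circ> prod.swap \<notin> Y"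
    unfolding Y weight_space_def by (auto simp: coef_weight swap_coef_def swap_swap intro!: exI[of _ "Suc m"])
  have wm: "weight lam (Suc m) \<in> eigenspace_ext lam Omega_minus" by (rule weight_ext_Omega_minus[OF lam])
  have wp: "weight lam (Suc m) \<circ> prod.swap \<in> eigenspace_ext lam Omega_plus"
    by (rule eigenspace_ext_swap[OF wm]) (simp add: Omega_plus_minus(1))
  have "\<not> alt_Eplus lam Y" "\<not> alt_Eminus lam Y" "\<not> alt_NE lam Y"
    using w wm wp weight_ext_star unfolding alt_Eplus_def alt_Eminus_def alt_NE_def dense_in_def by blast+
  moreover have "Y = eigenspace_ext lam Omega"
  proof
    show "Y \<subseteq> eigenspace_ext lam Omega"
    proof
      fix F assume F: "F \<in> Y"
      have "(\<lambda>x. \<Sum>k\<le>m. weight_term lam (\<lambda>n. coef n F) (\<lambda>n. swap_coef n F) k x) \<in> eigenspace_ext lam Omega"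
        by (intro eigenspace_ext_sum weight_term_ext weight_ext_Omega[OF lam])
          (use Omega_plus_minus(2) in auto)
      then show "F \<in> eigenspace_ext lam Omega" using weight_space_expansion F unfolding Y by metis
    qed
    show "eigenspace_ext lam Omega \<subseteq> Y"
    proof
      fix F assume F: "F \<in> eigenspace_ext lam Omega"
      \<comment> \<open>An extension to \<open>Omega\<close> restricts to both subdomains, so the
        coefficients above m vanish on both axes.\<close>
      have "Omega_plus \<subseteq> Omega" "Omega_minus \<subseteq> Omega" by (auto simp: Omega_plus_def Omega_minus_def)
      then have F': "F \<in> eigenspace_ext lam Omega_plus" "F \<in> eigenspace_ext lam Omega_minus"
        using F eigenspace_ext_mono by blast+
      have "coef k F = 0" "swap_coef k F = 0" if "k > m" for k
        using eigenspace_ext_plus_coef[OF F'(1), of k] eigenspace_ext_minus_coef[OF F'(2), of k] ne that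
        by (auto simp: swap_coef_def)
      then show "F \<in> Y" using F ext_subset unfolding Y weight_space_def by blast
    qed
  qed
  moreover have "finite_dim Y" "cfun.dim Y = 2 * m + 1" using weight_space_dim by (simp_all add: Y)
  ultimately show ?thesis using lam unfolding alt_E0_def by blast
qed

end
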